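(* Let $\Gamma_R\subset\mathbb{R}^2$ be a right trapezoid with parallel sides $l_1,l_2$, side $w_2$ perpendicular to $l_1$ and $l_2$, and remaining (slant) side $w_1$. Let $\Gamma_R^{\ast}$ be a rectangle with $|\Gamma_R^{\ast}|=|\Gamma_R|$ and side lengths in ratio $2:1$, i.e. with longer sides of length $\sqrt{2|\Gamma_R|}$ and shorter sides of length $\sqrt{|\Gamma_R|/2}$; for $\Gamma_R^{\ast}$ let $l_1,l_2$ denote the two shorter sides and $w_1,w_2$ the two longer sides. Then $$\lambda_1^{l_1l_2w_1}(\Gamma_R)\ \ge\ \lambda_1^{l_1l_2w_1}(\Gamma_R^{\ast})=\frac{\pi^2}{|\Gamma_R|},$$ and equality holds if and only if $\Gamma_R$ is congruent to $\Gamma_R^{\ast}$.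
   Context: $\lambda_1^{l_1l_2w_1}(\cdot)$ denotes the first eigenvalue of the mixed problem $\Delta u+\lambda u=0$ with Dirichlet condition $u=0$ on the sides $l_1,l_2,w_1$ and Neumann condition $\partial_\nu u=0$ on the side $w_2$; variationally it is $\inf\{\int|\nabla u|^2/\int u^2: 0\ne u\in W^{1,2},\ u=0 \text{ on } l_1\cup l_2\cup w_1\}$. $|\cdot|$ denotes area.
   Formalization: "Congruent" is taken to respect side labels (parallel sides l1,l2 to the shorter sides, w1 to w1, w2 to w2); as plain sets the claim fails for the same 2:1 rectangle with l1,l2 as its longer sides, whose eigenvalue is 17π²/(8|Γ_R|). *)

theory Defs
  imports "HOL-Analysis.Analysis"
begin

type_synonym pt = "real \<times> real"

definition trap_dom :: "real \<Rightarrow> real \<Rightarrow> real \<Rightarrow> pt set" where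
  "trap_dom a b h = interior (convex hull {(0,0), (a,0), (b,h), (0,h)})"

definition trap_l1 :: "real \<Rightarrow> real \<Rightarrow> real \<Rightarrow> pt set" where
  "trap_l1 a b h = closed_segment (0,0) (a,0)"

definition trap_l2 :: "real \<Rightarrow> real \<Rightarrow> real \<Rightarrow> pt set" where
  "trap_l2 a b h = closed_segment (0,h) (b,h)"

definition trap_w1 :: "real \<Rightarrow> real \<Rightarrow> real \<Rightarrow> pt set" where
  "trap_w1 a b h = closed_segment (a,0) (b,h)"

definition trap_w2 :: "real \<Rightarrow> real \<Rightarrow> real \<Rightarrow> pt set" where
  "trap_w2 a b h = closed_segment (0,0) (0,h)"

definition isometry2 :: "(pt \<Rightarrow> pt) \<Rightarrow> bool" where
  "isometry2 f \<longleftrightarrow> (\<forall>x y. dist (f x) (f y) = dist x y)"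

definition C1_grad :: "(pt \<Rightarrow> real) \<Rightarrow> (pt \<Rightarrow> pt) \<Rightarrow> bool" where
  "C1_grad phi dphi \<longleftrightarrow>
     (\<forall>x. (phi has_derivative (\<lambda>v. dphi x \<bullet> v)) (at x)) \<and> continuous_on UNIV dphi"

definition weak_grad :: "pt set \<Rightarrow> (pt \<Rightarrow> real) \<Rightarrow> (pt \<Rightarrow> pt) \<Rightarrow> bool" where
  "weak_grad \<Omega> u G \<longleftrightarrow>
     set_borel_measurable lebesgue \<Omega> u \<and> set_borel_measurable lebesgue \<Omega> G \<and>
     set_integrable lebesgue \<Omega> (\<lambda>x. (u x)\<^sup>2) \<and>
     set_integrable lebesgue \<Omega> (\<lambda>x. (norm (G x))\<^sup>2) \<and>
     (\<forall>phi dphi. C1_grad phi dphi \<and> compact (closure {x. phi x \<noteq> 0})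
         \<and> closure {x. phi x \<noteq> 0} \<subseteq> \<Omega> \<longrightarrow>
        (\<forall>i\<in>Basis. (LINT x:\<Omega>|lebesgue. u x * (dphi x \<bullet> i))
                   = - (LINT x:\<Omega>|lebesgue. (G x \<bullet> i) * phi x)))"

text \<open>u in W^{1,2}(Omega) with u = 0 on Gamma in the trace sense: u is a W^{1,2}(Omega)-limit
  of C^1 functions vanishing in a neighbourhood of Gamma.\<close>
definition H1_zero_on :: "pt set \<Rightarrow> pt set \<Rightarrow> (pt \<Rightarrow> real) \<Rightarrow> (pt \<Rightarrow> pt) \<Rightarrow> bool" where
  "H1_zero_on \<Omega> \<Gamma> u G \<longleftrightarrow> weak_grad \<Omega> u G \<and>
     (\<exists>phi dphi. (\<forall>n. C1_grad (phi n) (dphi n) \<and>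
                       (\<exists>U. open U \<and> \<Gamma> \<subseteq> U \<and> (\<forall>x\<in>U. phi n x = 0))) \<and>
        (\<lambda>n. LINT x:\<Omega>|lebesgue. (phi n x - u x)\<^sup>2) \<longlonglongrightarrow> 0 \<and>
        (\<lambda>n. LINT x:\<Omega>|lebesgue. (norm (dphi n x - G x))\<^sup>2) \<longlonglongrightarrow> 0)"

text \<open>First mixed eigenvalue: Dirichlet on Gamma, Neumann on the rest (variational).\<close>
definition lambda1 :: "pt set \<Rightarrow> pt set \<Rightarrow> real" where
  "lambda1 \<Omega> \<Gamma> = Inf {(LINT x:\<Omega>|lebesgue. (norm (G x))\<^sup>2) / (LINT x:\<Omega>|lebesgue. (u x)\<^sup>2)
       | u G. H1_zero_on \<Omega> \<Gamma> u G \<and> (LINT x:\<Omega>|lebesgue. (u x)\<^sup>2) \<noteq> 0}"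

definition trap_lambda :: "(pt \<Rightarrow> pt) \<Rightarrow> real \<Rightarrow> real \<Rightarrow> real \<Rightarrow> real" where
  "trap_lambda g a b h =
     lambda1 (g ` trap_dom a b h) (g ` (trap_l1 a b h \<union> trap_l2 a b h \<union> trap_w1 a b h))"

definition trap_congruent ::
  "(pt \<Rightarrow> pt) \<Rightarrow> real \<Rightarrow> real \<Rightarrow> real \<Rightarrow> (pt \<Rightarrow> pt) \<Rightarrow> real \<Rightarrow> real \<Rightarrow> real \<Rightarrow> bool" where
  "trap_congruent g a b h g' a' b' h' \<longleftrightarrow> (\<exists>f. isometry2 f
     \<and> f ` (g ` trap_dom a b h) = g' ` trap_dom a' b' h'
     \<and> f ` (g ` (trap_l1 a b h \<union> trap_l2 a b h)) = g' ` (trap_l1 a' b' h' \<union> trap_l2 a' b' h')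
     \<and> f ` (g ` trap_w1 a b h) = g' ` trap_w1 a' b' h'
     \<and> f ` (g ` trap_w2 a b h) = g' ` trap_w2 a' b' h')"

end

theory Submission
  imports Defs
begin

text \<open>
  Slice the trapezoid by horizontal lines: on the slice of width w(y) the x-part of the energy is at
  least (pi / 2 w(y))^2 times the mass. Feed this into the vertical slices: extended by zero, each of
  them is a function f on [0,h] vanishing at both ends, and it remains to bound
  int f'^2 + (pi / 2 w)^2 f^2 from below for an affine width w. By AM-GM this follows from the
  uncertainty inequality |f'| |f/w| >= (pi / mean w) |f|^2 (L2 norms), with equality only if w is constant.
  Normalise to w = 1 + th s on [-1,1]. If |f/w|^2 is comparable to |f|^2, split f into its even and odd
  parts: the Dirichlet gap between them (factor 4) beats, pointwise, the coupling of the two parts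
  caused by 1/w^2. If |f/w|^2 is small, f sits near the wide end and a harmonic oscillator bound there
  suffices. A Heisenberg bound makes the gap uniform when th is not 0, which gives strictness.
\<close>

section \<open>One-dimensional inequalities\<close>

text \<open>The eigenvalue is an infimum, and no minimiser is constructed. A strict inequality for
  each single function could therefore be lost in the limit, so for unequal parallel sides every
  estimate carries an explicit factor above 1 that depends only on the relative slope. Equal sides
  are treated separately: there the slice bound is the exact eigenvalue, and AM-GM equality singles
  out the ratio 2:1. The two regimes come from a genuine failure of the parity argument. Write N, B,
  P for the mass, the weighted mass and the normalised energy of a slice. With k = N / B the claim P
  B >= N^2 reads P - 2 k N + k^2 B >= 0. On the values at s and -s this is a form in two variables,
  and as |th s| tends to 1 it stops being positive once k exceeds 4 - sqrt 6, about 1.55. So it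
  covers B / N down to about 0.645. The cut is made at 0.65, and below it the mass must sit near the
  wide end. All estimates are proved for C1 functions that vanish near the Dirichlet sides, the
  class whose closure defines the boundary condition; traces and corners never have to be
  examined.\<close>

text \<open>Integrate the nonnegative function (f' - p f)^2.\<close>

lemma riccati_lower_bound:
  fixes f f' p p' :: "real \<Rightarrow> real"
  assumes "a \<le> b"
    and f: "\<And>x. x \<in> {a..b} \<Longrightarrow> (f has_real_derivative f' x) (at x within {a..b})"
    and p: "\<And>x. x \<in> {a..b} \<Longrightarrow> (p has_real_derivative p' x) (at x within {a..b})"
    and cf: "continuous_on {a..b} f'" and cp: "continuous_on {a..b} p'"
  shows "p b * (f b)\<^sup>2 - p a * (f a)\<^sup>2
      \<le> integral {a..b} (\<lambda>x. (f' x)\<^sup>2) + integral {a..b} (\<lambda>x. (p' x + (p x)\<^sup>2) * (f x)\<^sup>2)"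
proof -
  have f0: "continuous_on {a..b} f" using f DERIV_continuous_on by blast
  have p0: "continuous_on {a..b} p" using p DERIV_continuous_on by blast
  have "((\<lambda>x. p x * (f x)\<^sup>2) has_real_derivative (p' x * (f x)\<^sup>2 + 2 * p x * f x * f' x))
      (at x within {a..b})" if "x \<in> {a..b}" for x
    by (rule derivative_eq_intros f[OF that] p[OF that] refl)+ (simp add: algebra_simps)
  then have "((\<lambda>x. p' x * (f x)\<^sup>2 + 2 * p x * f x * f' x) has_integral
      (p b * (f b)\<^sup>2 - p a * (f a)\<^sup>2)) {a..b}"
    by (intro fundamental_theorem_of_calculus[OF \<open>a \<le> b\<close>])
      (simp add: has_real_derivative_iff_has_vector_derivative)
  moreover have "((\<lambda>x. (f' x)\<^sup>2 + (p' x + (p x)\<^sup>2) * (f x)\<^sup>2) has_integral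
      (integral {a..b} (\<lambda>x. (f' x)\<^sup>2) + integral {a..b} (\<lambda>x. (p' x + (p x)\<^sup>2) * (f x)\<^sup>2))) {a..b}"
    by (intro has_integral_add integrable_integral integrable_continuous_interval continuous_intros
        f0 p0 cf cp)
  moreover have "p' x * (f x)\<^sup>2 + 2 * p x * f x * f' x \<le> (f' x)\<^sup>2 + (p' x + (p x)\<^sup>2) * (f x)\<^sup>2" for x
    using zero_le_power2[of "f' x - p x * f x"] by (simp add: power2_eq_square algebra_simps)
  ultimately show ?thesis
    by (rule has_integral_le)
qed

lemma square_bound_limit:
  fixes I J C :: real
  assumes "0 < C" "\<And>c. 0 < c \<Longrightarrow> c < C \<Longrightarrow> c\<^sup>2 * I \<le> J"
  shows "C\<^sup>2 * I \<le> J"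
proof (rule tendsto_upperbound)
  show "((\<lambda>c. c\<^sup>2 * I) \<longlongrightarrow> C\<^sup>2 * I) (at_left C)"
    by (intro tendsto_intros)
  show "\<forall>\<^sub>F c in at_left C. c\<^sup>2 * I \<le> J"
    using eventually_at_left_real[OF \<open>0 < C\<close>] by eventually_elim (use assms(2) in auto)
qed simp

text \<open>The weight is the logarithmic derivative of cos (c (x - m)), a solution of psi'' = - c^2
  psi; hence p' + p^2 is the constant - c^2.\<close>

lemma tan_riccati:
  fixes c m x :: real
  assumes "cos (c * (x - m)) \<noteq> 0"
  shows "((\<lambda>x. - c * tan (c * (x - m))) has_real_derivative - c\<^sup>2 - (- c * tan (c * (x - m)))\<^sup>2) (at x within S)"
proof -
  have "((\<lambda>x. - c * tan (c * (x - m))) has_real_derivative - c * (inverse ((cos (c * (x - m)))\<^sup>2) * c)) (at x within S)"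
    by (rule derivative_eq_intros refl assms | simp)+
  moreover have "- c * (inverse ((cos (c * (x - m)))\<^sup>2) * c) = - c\<^sup>2 - (- c * tan (c * (x - m)))\<^sup>2"
    unfolding power_inverse[symmetric] tan_sec[OF assms, symmetric]
    by (simp add: power2_eq_square algebra_simps)
  ultimately show ?thesis by simp
qed

text \<open>The weight p stays bounded for c below the optimal constant, so no boundary limits arise;
  the sharp constant is recovered from square_bound_limit.\<close>

lemma wirtinger_aux:
  fixes f f' :: "real \<Rightarrow> real"
  assumes "a \<le> b" and c: "\<And>x. x \<in> {a..b} \<Longrightarrow> \<bar>c * (x - m)\<bar> < pi / 2"
    and f: "\<And>x. x \<in> {a..b} \<Longrightarrow> (f has_real_derivative f' x) (at x within {a..b})"
    and cf: "continuous_on {a..b} f'"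
    and "f b = 0" "f a = 0 \<or> a = m"
  shows "c\<^sup>2 * integral {a..b} (\<lambda>x. (f x)\<^sup>2) \<le> integral {a..b} (\<lambda>x. (f' x)\<^sup>2)"
proof -
  let ?p = "\<lambda>x. - c * tan (c * (x - m))"
  have cn: "cos (c * (x - m)) \<noteq> 0" if "x \<in> {a..b}" for x
    using c[OF that] cos_gt_zero_pi[of "c * (x - m)"] by (simp add: abs_less_iff) linarith
  have "?p b * (f b)\<^sup>2 - ?p a * (f a)\<^sup>2
      \<le> integral {a..b} (\<lambda>x. (f' x)\<^sup>2) + integral {a..b} (\<lambda>x. (- c\<^sup>2 - (?p x)\<^sup>2 + (?p x)\<^sup>2) * (f x)\<^sup>2)"
  proof (rule riccati_lower_bound[OF \<open>a \<le> b\<close> f _ cf])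
    show "(?p has_real_derivative - c\<^sup>2 - (?p x)\<^sup>2) (at x within {a..b})" if "x \<in> {a..b}" for x
      using cn[OF that] by (rule tan_riccati)
    show "continuous_on {a..b} (\<lambda>x. - c\<^sup>2 - (?p x)\<^sup>2)"
      by (intro continuous_intros) (use cn in auto)
  qed
  \<comment> \<open>The boundary term at \<open>a\<close> dies either because \<open>f\<close>
    vanishes there or, when a = m, because the weight does. The second alternative is the Neumann
    end.\<close>
  then show ?thesis using assms(5,6) by auto
qed

lemma wirtinger_mixed:
  fixes f f' :: "real \<Rightarrow> real"
  assumes "l > 0"
    and "\<And>x. x \<in> {0..l} \<Longrightarrow> (f has_real_derivative f' x) (at x within {0..l})"
    and "continuous_on {0..l} f'"
    and "f l = 0"
  shows "(pi / (2 * l))\<^sup>2 * integral {0..l} (\<lambda>x. (f x)\<^sup>2) \<le> integral {0..l} (\<lambda>x. (f' x)\<^sup>2)"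
proof (rule square_bound_limit)
  fix c assume c: "0 < c" "c < pi / (2 * l)"
  have "\<bar>c * (x - 0)\<bar> < pi / 2" if "x \<in> {0..l}" for x
  proof -
    have "c * x \<le> c * l" using that c by (intro mult_left_mono) auto
    also have "\<dots> < pi / 2" using c \<open>l > 0\<close> by (simp add: field_simps)
    finally show ?thesis using that c by simp
  qed
  then show "c\<^sup>2 * integral {0..l} (\<lambda>x. (f x)\<^sup>2) \<le> integral {0..l} (\<lambda>x. (f' x)\<^sup>2)"
    using assms by (intro wirtinger_aux[where m = 0]) auto
qed (use assms in auto)

lemma wirtinger_dirichlet:
  fixes f f' :: "real \<Rightarrow> real"
  assumes "l > 0"
    and "\<And>x. x \<in> {0..l} \<Longrightarrow> (f has_real_derivative f' x) (at x within {0..l})"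
    and "continuous_on {0..l} f'"
    and "f 0 = 0" "f l = 0"
  shows "(pi / l)\<^sup>2 * integral {0..l} (\<lambda>x. (f x)\<^sup>2) \<le> integral {0..l} (\<lambda>x. (f' x)\<^sup>2)"
proof (rule square_bound_limit)
  fix c assume c: "0 < c" "c < pi / l"
  have "\<bar>c * (x - l / 2)\<bar> < pi / 2" if "x \<in> {0..l}" for x
  proof -
    have "\<bar>c * (x - l / 2)\<bar> = c * \<bar>x - l / 2\<bar>" using c by (simp add: abs_mult)
    also have "\<dots> \<le> c * (l / 2)"
      by (rule mult_left_mono) (use that c in \<open>auto simp: abs_if\<close>)
    also have "\<dots> < pi / 2" using c \<open>l > 0\<close> by (simp add: field_simps)
    finally show ?thesis .
  qed
  then show "c\<^sup>2 * integral {0..l} (\<lambda>x. (f x)\<^sup>2) \<le> integral {0..l} (\<lambda>x. (f' x)\<^sup>2)"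
    using assms by (intro wirtinger_aux[where m = "l / 2"]) auto
qed (use assms in auto)

text \<open>The weight - c x, the logarithmic derivative of a Gaussian, gives c N <= Q + c^2 S for
  every c; the best choice is c = N / (2 S). If S = 0, letting c grow forces N = 0.\<close>

lemma heisenberg_interval:
  fixes f f' :: "real \<Rightarrow> real"
  assumes f: "\<And>x. x \<in> {a..b} \<Longrightarrow> (f has_real_derivative f' x) (at x within {a..b})"
    and cf: "continuous_on {a..b} f'"
    and "f a = 0" "f b = 0" "a \<le> b"
  shows "(integral {a..b} (\<lambda>x. (f x)\<^sup>2))\<^sup>2
    \<le> 4 * integral {a..b} (\<lambda>x. (f' x)\<^sup>2) * integral {a..b} (\<lambda>x. x\<^sup>2 * (f x)\<^sup>2)"
proof -
  define N S Q where "N = integral {a..b} (\<lambda>x. (f x)\<^sup>2)"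
    and "S = integral {a..b} (\<lambda>x. x\<^sup>2 * (f x)\<^sup>2)" and "Q = integral {a..b} (\<lambda>x. (f' x)\<^sup>2)"
  have f0: "continuous_on {a..b} f" using f DERIV_continuous_on by blast
  have key: "c * N \<le> Q + c\<^sup>2 * S" for c :: real
  proof -
    have "- c * b * (f b)\<^sup>2 - (- c * a) * (f a)\<^sup>2
      \<le> integral {a..b} (\<lambda>x. (f' x)\<^sup>2) + integral {a..b} (\<lambda>x. (- c + (- c * x)\<^sup>2) * (f x)\<^sup>2)"
      by (rule riccati_lower_bound[OF \<open>a \<le> b\<close> f _ cf]) (auto intro!: derivative_eq_intros)
    also have "integral {a..b} (\<lambda>x. (- c + (- c * x)\<^sup>2) * (f x)\<^sup>2)
       = integral {a..b} (\<lambda>x. c\<^sup>2 * (x\<^sup>2 * (f x)\<^sup>2) - c * (f x)\<^sup>2)"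
      by (simp add: algebra_simps power_mult_distrib)
    also have "\<dots> = c\<^sup>2 * S - c * N" unfolding S_def N_def
      by (subst integral_diff) (auto intro!: integrable_continuous_interval continuous_intros f0)
    finally show ?thesis using assms by (simp add: Q_def)
  qed
  have nn: "0 \<le> S" "0 \<le> N" unfolding S_def N_def
    by (auto intro!: integral_nonneg integrable_continuous_interval continuous_intros f0)
  show ?thesis
  proof (cases "S = 0")
    case True
    have "N = 0"
    proof (rule ccontr)
      assume "N \<noteq> 0"
      then show False using key[of "(Q + 1) / N"] True by simp
    qed
    then show ?thesis by (simp add: N_def[symmetric] S_def[symmetric] True)
  next
    case False
    then have "S > 0" using nn by simp
    have "N / (2 * S) * N \<le> Q + (N / (2 * S))\<^sup>2 * S" by (rule key)
    then have "N\<^sup>2 \<le> 4 * Q * S" using \<open>S > 0\<close> by (simp add: field_simps power2_eq_square)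
    then show ?thesis by (simp add: N_def S_def Q_def)
  qed
qed

text \<open>Measuring distance from an endpoint where \<open>f\<close> vanishes improves the
  constant: the oscillator on a half line has the first odd Hermite function as ground state, with
  level 3 c instead of c. Squaring this 3 produces the 9. In the application b is the wide
  end.\<close>

lemma heisenberg_halfline:
  fixes f f' :: "real \<Rightarrow> real"
  assumes f: "\<And>x. x \<in> {a..b} \<Longrightarrow> (f has_real_derivative f' x) (at x within {a..b})"
    and cf: "continuous_on {a..b} f'"
    and "f a = 0" "f b = 0" "a \<le> b"
  shows "9 * (integral {a..b} (\<lambda>x. (f x)\<^sup>2))\<^sup>2
    \<le> 4 * integral {a..b} (\<lambda>x. (f' x)\<^sup>2) * integral {a..b} (\<lambda>x. (b - x)\<^sup>2 * (f x)\<^sup>2)"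
proof -
  define N S Q where "N = integral {a..b} (\<lambda>x. (f x)\<^sup>2)"
    and "S = integral {a..b} (\<lambda>x. (b - x)\<^sup>2 * (f x)\<^sup>2)" and "Q = integral {a..b} (\<lambda>x. (f' x)\<^sup>2)"
  define T where "T = integral {a..b} (\<lambda>x. (b - x) * (f x)\<^sup>2)"
  have f0: "continuous_on {a..b} f" using f DERIV_continuous_on by blast
  \<comment> \<open>The bracket S + 2 e T + e^2 N is the second moment about the shifted point b +
    e; it tends to S as e tends to 0.\<close>
  have key0: "3 * c * N \<le> Q + c\<^sup>2 * (S + 2 * e * T + e\<^sup>2 * N)" if "e > 0" for c e :: real
  proof -
    \<comment> \<open>logarithmic derivative of X exp (- c X^2 / 2) with X = b + e - x; the shift e removes the pole at b\<close>
    let ?p = "\<lambda>x. c * (b + e - x) - 1 / (b + e - x)"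
    let ?p' = "\<lambda>x. - c - 1 / (b + e - x)\<^sup>2"
    have "?p b * (f b)\<^sup>2 - ?p a * (f a)\<^sup>2
      \<le> integral {a..b} (\<lambda>x. (f' x)\<^sup>2) + integral {a..b} (\<lambda>x. (?p' x + (?p x)\<^sup>2) * (f x)\<^sup>2)"
      by (rule riccati_lower_bound[OF \<open>a \<le> b\<close> f _ cf])
        (use that in \<open>auto intro!: derivative_eq_intros continuous_intros simp: power2_eq_square\<close>)
    also have "integral {a..b} (\<lambda>x. (?p' x + (?p x)\<^sup>2) * (f x)\<^sup>2)
      = integral {a..b} (\<lambda>x. c\<^sup>2 * ((b - x)\<^sup>2 * (f x)\<^sup>2) + c\<^sup>2 * (2 * e) * ((b - x) * (f x)\<^sup>2)
           + (c\<^sup>2 * e\<^sup>2 - 3 * c) * (f x)\<^sup>2)"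
    proof (rule integral_cong)
      fix x assume "x \<in> {a..b}"
      then have "b + e - x \<noteq> 0" using that by auto
      then have "?p' x + (?p x)\<^sup>2 = c\<^sup>2 * (b + e - x)\<^sup>2 - 3 * c"
        by (simp add: power2_diff power_divide power_mult_distrib)
      also have "\<dots> = c\<^sup>2 * (b - x)\<^sup>2 + c\<^sup>2 * (2 * e) * (b - x) + (c\<^sup>2 * e\<^sup>2 - 3 * c)"
        by (simp add: power2_eq_square algebra_simps)
      finally have eq: "?p' x + (?p x)\<^sup>2 = \<dots>" .
      show "(?p' x + (?p x)\<^sup>2) * (f x)\<^sup>2 = c\<^sup>2 * ((b - x)\<^sup>2 * (f x)\<^sup>2)
          + c\<^sup>2 * (2 * e) * ((b - x) * (f x)\<^sup>2) + (c\<^sup>2 * e\<^sup>2 - 3 * c) * (f x)\<^sup>2"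
        unfolding eq by (simp only: distrib_right mult.assoc)
    qed
    also have "\<dots> = c\<^sup>2 * S + c\<^sup>2 * (2 * e) * T + (c\<^sup>2 * e\<^sup>2 - 3 * c) * N" unfolding S_def N_def T_def
      by (subst integral_add integral_mult_right;
          (intro integrable_continuous_interval continuous_intros f0)?)+ simp
    finally show ?thesis using assms by (simp add: Q_def algebra_simps)
  qed
  have key: "3 * c * N \<le> Q + c\<^sup>2 * S" for c
  proof (rule tendsto_lowerbound)
    have "((\<lambda>e. Q + c\<^sup>2 * (S + 2 * e * T + e\<^sup>2 * N)) \<longlongrightarrow> Q + c\<^sup>2 * (S + 2 * 0 * T + 0\<^sup>2 * N)) (at_right 0)"
      by (intro tendsto_intros)
    then show "((\<lambda>e. Q + c\<^sup>2 * (S + 2 * e * T + e\<^sup>2 * N)) \<longlongrightarrow> Q + c\<^sup>2 * S) (at_right 0)" by simp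
    show "\<forall>\<^sub>F e in at_right 0. 3 * c * N \<le> Q + c\<^sup>2 * (S + 2 * e * T + e\<^sup>2 * N)"
      using eventually_at_right_less[of "0::real"] by eventually_elim (rule key0)
  qed simp
  have nn: "0 \<le> S" "0 \<le> N" unfolding S_def N_def
    by (auto intro!: integral_nonneg integrable_continuous_interval continuous_intros f0)
  show ?thesis
  proof (cases "S = 0")
    case True
    have "N = 0"
    proof (rule ccontr)
      assume "N \<noteq> 0"
      then show False using key[of "(Q + 1) / (3 * N)"] True by simp
    qed
    then show ?thesis by (simp add: N_def[symmetric] S_def[symmetric] True)
  next
    case False
    then have "S > 0" using nn by simp
    have "3 * (3 * N / (2 * S)) * N \<le> Q + (3 * N / (2 * S))\<^sup>2 * S" by (rule key)
    then have "9 * N\<^sup>2 \<le> 4 * Q * S" using \<open>S > 0\<close> by (simp add: field_simps power2_eq_square)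
    then show ?thesis by (simp add: N_def S_def Q_def)
  qed
qed

section \<open>Positivity of the quadratic form in the even and odd parts\<close>

lemma quadratic_form_lower_bound:
  fixes A C H a b :: real
  shows "(A * C - H\<^sup>2) * (a\<^sup>2 + b\<^sup>2) \<le> (A + C) * (A * a\<^sup>2 + 2 * H * a * b + C * b\<^sup>2)"
proof -
  \<comment> \<open>Cayley-Hamilton for the symmetric matrix M of the form: trace times the form
    minus determinant times |v|^2 is |M v|^2. So for positive trace, determinant / trace bounds the
    form from below.\<close>
  have "(A + C) * (A * a\<^sup>2 + 2 * H * a * b + C * b\<^sup>2) - (A * C - H\<^sup>2) * (a\<^sup>2 + b\<^sup>2)
    = (A * a + H * b)\<^sup>2 + (C * b + H * a)\<^sup>2"
    by (simp add: power2_eq_square algebra_simps)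
  then show ?thesis by (smt (verit) zero_le_power2)
qed

text \<open>For c <= 0 the right-hand side is concave in D, so it lies above the chord through its
  values at D = 0 and D = 1.\<close>

lemma concave_quadratic_lower_bound:
  fixes c p q D e0 e1 :: real
  assumes "c \<le> 0" "0 \<le> D" "D \<le> 1"
  shows "(1 - D) * (c + p + q) + D * (2 * p + q) \<le> c * (1 - D)\<^sup>2 + p * (1 + D) + q"
proof -
  have "c * (1 - D)\<^sup>2 + p * (1 + D) + q - ((1 - D) * (c + p + q) + D * (2 * p + q))
    = - c * (D * (1 - D))"
    by (simp add: power2_eq_square algebra_simps)
  moreover have "0 \<le> - c * (D * (1 - D))" using assms by (intro mult_nonneg_nonneg) auto
  ultimately show ?thesis by linarith
qed

text \<open>The determinant of the form, times (1 - d^2)^2, is concave in D = d^2; at D = 0 it is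
  (k - 1)^2 ((k - 1)^2 + 3) and at D = 1 it is k^2 (k^2 - 8 k + 10), positive for k < 4 - sqrt 6.\<close>

lemma parity_form_lower_bound:
  fixes k d a b :: real
  assumes k: "1 / 2 \<le> k" "k \<le> 77 / 50" and d: "\<bar>d\<bar> < 1"
  shows "d\<^sup>2 / 2000 * (a\<^sup>2 + b\<^sup>2)
    \<le> (1 - 2 * k) * a\<^sup>2 + (4 - 2 * k) * b\<^sup>2
      + k\<^sup>2 / 2 * ((a + b)\<^sup>2 / (1 + d)\<^sup>2 + (a - b)\<^sup>2 / (1 - d)\<^sup>2)"
    (is "?L \<le> ?R")
proof -
  define D where "D = d\<^sup>2"
  have D: "0 \<le> D" "D < 1" using d by (auto simp: D_def abs_square_less_1)
  \<comment> \<open>Multiplication by \<open>m\<close> clears both denominators. The determinant of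
    the cleared form again contains one factor \<open>m\<close>, which cancels in the end, so the
    bound does not degenerate as |d| tends to 1.\<close>
  define m where "m = (1 - D)\<^sup>2"
  have m: "0 < m" "m \<le> 1" using D by (auto simp: m_def power_le_one)
  define A C H where "A = (1 - 2 * k) * m + k\<^sup>2 * (1 + D)"
    and "C = (4 - 2 * k) * m + k\<^sup>2 * (1 + D)" and "H = - 2 * d * k\<^sup>2"
  define Q where "Q = A * a\<^sup>2 + 2 * H * a * b + C * b\<^sup>2"
  have m_eq: "m = (1 + d)\<^sup>2 * (1 - d)\<^sup>2" by (simp add: m_def D_def power2_eq_square algebra_simps)
  have d': "1 + d \<noteq> 0" "1 - d \<noteq> 0" using d by auto
  define R where "R = ?R"
  have RQ: "m * R = Q"
  proof -
    have "m * R = m * (1 - 2 * k) * a\<^sup>2 + m * (4 - 2 * k) * b\<^sup>2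
      + k\<^sup>2 / 2 * ((1 - d)\<^sup>2 * (a + b)\<^sup>2 + (1 + d)\<^sup>2 * (a - b)\<^sup>2)"
      using d' unfolding m_eq R_def by (simp add: distrib_left mult_ac)
    also have "\<dots> = Q" unfolding Q_def A_def C_def H_def D_def
      by (simp add: power2_eq_square algebra_simps)
    finally show ?thesis .
  qed
  define v where "v = (1 - 2 * k) * (4 - 2 * k) * (1 - D)\<^sup>2 + (5 - 4 * k) * k\<^sup>2 * (1 + D) + k ^ 4"
  have det: "A * C - H\<^sup>2 = m * v"
    unfolding A_def C_def H_def v_def m_def
    by (simp add: D_def power2_eq_square power4_eq_xxxx algebra_simps)
  \<comment> \<open>The lower bound 1 / 2 on k gives this sign, which makes \<open>v\<close> concave
    in D.\<close>
  have c0: "(1 - 2 * k) * (4 - 2 * k) \<le> 0" using k by (intro mult_nonpos_nonneg) auto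
  have "(1 - D) * ((1 - 2 * k) * (4 - 2 * k) + (5 - 4 * k) * k\<^sup>2 + k ^ 4)
      + D * (2 * ((5 - 4 * k) * k\<^sup>2) + k ^ 4) \<le> v"
    unfolding v_def using concave_quadratic_lower_bound[OF c0 D(1), of "(5 - 4 * k) * k\<^sup>2" "k ^ 4"] D by simp
  moreover have "0 \<le> (1 - D) * ((1 - 2 * k) * (4 - 2 * k) + (5 - 4 * k) * k\<^sup>2 + k ^ 4)"
  proof (rule mult_nonneg_nonneg)
    have "(1 - 2 * k) * (4 - 2 * k) + (5 - 4 * k) * k\<^sup>2 + k ^ 4 = (k - 1)\<^sup>2 * ((k - 1)\<^sup>2 + 3)"
      by (simp add: power2_eq_square power4_eq_xxxx algebra_simps)
    then show "0 \<le> (1 - 2 * k) * (4 - 2 * k) + (5 - 4 * k) * k\<^sup>2 + k ^ 4" by simp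
  qed (use D in auto)
  moreover have "D * (12 / 1000) \<le> D * (2 * ((5 - 4 * k) * k\<^sup>2) + k ^ 4)"
  proof (rule mult_left_mono)
    \<comment> \<open>77/50 lies just below the root 4 - sqrt 6 of k^2 - 8 k + 10, and 323/50 = 8 -
      77/50. The product falls short of that polynomial by 129/2500, which supplies the positive
      margin 5/100.\<close>
    have "0 \<le> (77 / 50 - k) * (323 / 50 - k)" using k by (intro mult_nonneg_nonneg) auto
    moreover have "(77 / 50 - k) * (323 / 50 - k) = k\<^sup>2 - 8 * k + 24871 / 2500"
      by (simp add: power2_eq_square field_simps)
    ultimately have "5 / 100 \<le> k\<^sup>2 - 8 * k + 10" by linarith
    moreover have "1 / 4 \<le> k\<^sup>2" using k power_mono[of "1/2" k 2] by (simp add: power_divide)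
    ultimately have "1 / 4 * (5 / 100) \<le> k\<^sup>2 * (k\<^sup>2 - 8 * k + 10)" by (intro mult_mono) auto
    then show "12 / 1000 \<le> 2 * ((5 - 4 * k) * k\<^sup>2) + k ^ 4"
      by (simp add: power2_eq_square power4_eq_xxxx algebra_simps)
  qed (use D in auto)
  ultimately have v: "D * (12 / 1000) \<le> v" by linarith
  have k2: "k\<^sup>2 \<le> 12 / 5" using k power_mono[of k "77/50" 2] by (simp add: power_divide)
  \<comment> \<open>The trace turns the determinant bound into a bound on the form. The constant
    1/2000 of the statement is a rounding down of (12/1000) / 13.\<close>
  have tr: "0 < A + C" "A + C \<le> 13"
  proof -
    have eq: "A + C = (5 - 4 * k) * m + 2 * k\<^sup>2 + 2 * k\<^sup>2 * D" by (simp add: A_def C_def algebra_simps)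
    have "min 0 (5 - 4 * k) \<le> (5 - 4 * k) * m"
      using m by (cases "5 - 4 * k \<ge> 0") (auto simp: min_def mult_le_cancel_left2)
    moreover have "0 < 2 * k\<^sup>2 + min 0 (5 - 4 * k)"
    proof -
      have "0 < 2 * (k - 1)\<^sup>2 + 3" "0 < 2 * k\<^sup>2" using k by (auto intro: add_nonneg_pos)
      then show ?thesis by (simp add: min_def power2_eq_square algebra_simps)
    qed
    moreover have "0 \<le> 2 * k\<^sup>2 * D" using D by simp
    ultimately show "0 < A + C" using eq by linarith
    have "(5 - 4 * k) * m \<le> 3 * 1" using k m by (intro mult_mono) auto
    moreover have "2 * k\<^sup>2 * D \<le> 2 * k\<^sup>2 * 1" using D by (intro mult_left_mono) auto
    ultimately show "A + C \<le> 13" using eq k2 by linarith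
  qed
  have "m * (D * (12 / 1000)) * (a\<^sup>2 + b\<^sup>2) \<le> m * v * (a\<^sup>2 + b\<^sup>2)"
    using v m by (intro mult_right_mono mult_left_mono) auto
  also have "\<dots> \<le> (A + C) * Q" unfolding Q_def det[symmetric] by (rule quadratic_form_lower_bound)
  finally have AQ: "m * (D * (12 / 1000)) * (a\<^sup>2 + b\<^sup>2) \<le> (A + C) * Q" .
  moreover have "0 \<le> m * (D * (12 / 1000)) * (a\<^sup>2 + b\<^sup>2)" using m D by simp
  ultimately have "0 \<le> (A + C) * Q" by linarith
  then have "0 \<le> Q" using tr by (simp add: zero_le_mult_iff)
  then have "(A + C) * Q \<le> 13 * Q" using tr by (intro mult_right_mono) auto
  moreover have "m * (13 * R) = 13 * Q" unfolding RQ[symmetric] by (simp only: mult.left_commute)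
  moreover have "m * (D * (12 / 1000)) * (a\<^sup>2 + b\<^sup>2) = m * (D * (12 / 1000) * (a\<^sup>2 + b\<^sup>2))"
    by (simp only: mult.assoc)
  ultimately have "m * (D * (12 / 1000) * (a\<^sup>2 + b\<^sup>2)) \<le> m * (13 * R)"
    using AQ by linarith
  then have "D * (12 / 1000) * (a\<^sup>2 + b\<^sup>2) \<le> 13 * R" using m by (subst (asm) mult_le_cancel_left_pos)
  moreover have "?L = D * (a\<^sup>2 + b\<^sup>2) / 2000" by (simp add: D_def)
  moreover have "0 \<le> D * (a\<^sup>2 + b\<^sup>2)" using D by simp
  ultimately have "?L \<le> R" by linarith
  then show ?thesis by (simp only: R_def)
qed

text \<open>The same form in the point values x = f s and y = f (- s) with d = \<theta> s, arranged
  so that the left side is a function of s plus its reflection and can be folded onto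
  [0, 1].\<close>

corollary parity_form_lower_bound':
  fixes k d x y :: real
  assumes "1 / 2 \<le> k" "k \<le> 77 / 50" "\<bar>d\<bar> < 1"
  shows "2 * ((d\<^sup>2 / 2000 * x\<^sup>2 + 2 * k * x\<^sup>2 - k\<^sup>2 * (x\<^sup>2 / (1 + d)\<^sup>2))
       + (d\<^sup>2 / 2000 * y\<^sup>2 + 2 * k * y\<^sup>2 - k\<^sup>2 * (y\<^sup>2 / (1 - d)\<^sup>2)))
    \<le> (x + y)\<^sup>2 + 4 * (x - y)\<^sup>2"
proof -
  have s: "(x + y) + (x - y) = 2 * x" "(x + y) - (x - y) = 2 * y"
    "(2 * x)\<^sup>2 = 4 * x\<^sup>2" "(2 * y)\<^sup>2 = 4 * y\<^sup>2"
    and sq: "(x + y)\<^sup>2 + (x - y)\<^sup>2 = 2 * x\<^sup>2 + 2 * y\<^sup>2"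
    by (simp_all add: power2_eq_square algebra_simps)
  have "d\<^sup>2 / 2000 * (2 * x\<^sup>2 + 2 * y\<^sup>2)
    \<le> (1 - 2 * k) * (x + y)\<^sup>2 + (4 - 2 * k) * (x - y)\<^sup>2
      + k\<^sup>2 / 2 * (4 * x\<^sup>2 / (1 + d)\<^sup>2 + 4 * y\<^sup>2 / (1 - d)\<^sup>2)"
    using parity_form_lower_bound[OF assms, of "x + y" "x - y"] unfolding s sq .
  moreover have "2 * k * (x + y)\<^sup>2 + 2 * k * (x - y)\<^sup>2 = 2 * k * (2 * x\<^sup>2 + 2 * y\<^sup>2)"
    unfolding sq[symmetric] by (simp add: distrib_left)
  moreover have "k\<^sup>2 / 2 * (4 * x\<^sup>2 / (1 + d)\<^sup>2 + 4 * y\<^sup>2 / (1 - d)\<^sup>2)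
    = 2 * (k\<^sup>2 * (x\<^sup>2 / (1 + d)\<^sup>2)) + 2 * (k\<^sup>2 * (y\<^sup>2 / (1 - d)\<^sup>2))"
    by (simp add: distrib_left)
  ultimately show ?thesis by (simp add: left_diff_distrib distrib_left)
qed

section \<open>Even and odd parts on the symmetric interval\<close>

lemma integral_fold_symmetric:
  fixes g :: "real \<Rightarrow> real"
  assumes "continuous_on {-1..1} g"
  shows "integral {-1..1} g = integral {0..1} (\<lambda>s. g s + g (- s))"
proof -
  have c: "continuous_on {0..1} g" "continuous_on {-1..0} g"
    by (rule continuous_on_subset[OF assms]; simp)+
  have c': "continuous_on {0..1} (\<lambda>s. g (- s))"
    by (rule continuous_on_compose2[OF c(2)]) (auto intro: continuous_intros)
  have "integral {-1..1} g = integral {-1..0} g + integral {0..1} g"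
    using Henstock_Kurzweil_Integration.integral_combine[where a = "-1" and c = 0 and b = 1 and f = g] integrable_continuous_interval[OF assms] by simp
  also have "integral {-1..0} g = integral {0..1} (\<lambda>s. g (- s))"
    using Henstock_Kurzweil_Integration.integral_reflect_real[of 0 "-1" g] by simp
  also have "integral {0..1} (\<lambda>s. g (- s)) + integral {0..1} g = integral {0..1} (\<lambda>s. g (- s) + g s)"
    by (rule integral_add[symmetric]) (intro integrable_continuous_interval c c')+
  finally show ?thesis by (simp add: add.commute)
qed

context
  fixes f f' :: "real \<Rightarrow> real"
  assumes f: "\<And>x. x \<in> {-1..1} \<Longrightarrow> (f has_real_derivative f' x) (at x within {-1..1})"
    and cf': "continuous_on {-1..1} f'"
    and bd: "f (-1) = 0" "f 1 = 0"
begin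

lemma cont_f: "continuous_on {-1..1} f"
  using f DERIV_continuous_on by blast

text \<open>On [0, 1] the even combination vanishes only at 1, with Wirtinger constant (pi / 2)^2,
  while the odd one vanishes at both ends, with constant pi^2. Their ratio is the weight 4. The
  cross terms of the derivatives cancel in the sum of squares.\<close>

lemma parity_energy:
  fixes a o' :: "real \<Rightarrow> real"
  defines "a \<equiv> \<lambda>s. f s + f (- s)" and "o' \<equiv> \<lambda>s. f s - f (- s)"
  shows "integral {0..1} (\<lambda>s. (a s)\<^sup>2 + 4 * (o' s)\<^sup>2) \<le> 8 / pi\<^sup>2 * integral {-1..1} (\<lambda>s. (f' s)\<^sup>2)"
proof -
  define a1 o1 where "a1 = (\<lambda>s. f' s - f' (- s))" and "o1 = (\<lambda>s. f' s + f' (- s))"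
  have c: "continuous_on {0..1} f" "continuous_on {-1..0} f"
       "continuous_on {0..1} f'" "continuous_on {-1..0} f'"
    by (rule continuous_on_subset[OF cont_f] continuous_on_subset[OF cf']; simp)+
  have c': "continuous_on {0..1} (\<lambda>s. f (- s))" "continuous_on {0..1} (\<lambda>s. f' (- s))"
    by (rule continuous_on_compose2[OF c(2)] continuous_on_compose2[OF c(4)]; auto intro: continuous_intros)+
  have f1: "(f has_real_derivative f' s) (at s within {0..1})" if "s \<in> {0..1}" for s
    using f[of s] that by (auto intro: DERIV_subset)
  have f2: "((\<lambda>s. f (- s)) has_real_derivative - f' (- s)) (at s within {0..1})" if "s \<in> {0..1}" for s
  proof -
    have "(f has_real_derivative f' (- s)) (at (- s) within uminus ` {0..1})"
      using f[of "- s"] that by (intro DERIV_subset[OF f]) auto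
    then have "((f \<circ> uminus) has_real_derivative f' (- s) * - 1) (at s within {0..1})"
      by (rule DERIV_image_chain) (auto intro!: derivative_eq_intros)
    then show ?thesis by (simp add: o_def)
  qed
  have da: "(a has_real_derivative a1 s) (at s within {0..1})" if "s \<in> {0..1}" for s
    unfolding a_def a1_def by (rule derivative_eq_intros f1[OF that] f2[OF that])+ simp
  have do: "(o' has_real_derivative o1 s) (at s within {0..1})" if "s \<in> {0..1}" for s
    unfolding o'_def o1_def by (rule derivative_eq_intros f1[OF that] f2[OF that])+ simp
  have ca: "continuous_on {0..1} a1" "continuous_on {0..1} o1" "continuous_on {0..1} a" "continuous_on {0..1} o'"
    unfolding a1_def o1_def a_def o'_def by (intro continuous_intros c c')+
  have "(pi / (2 * 1))\<^sup>2 * integral {0..1} (\<lambda>s. (a s)\<^sup>2) \<le> integral {0..1} (\<lambda>s. (a1 s)\<^sup>2)"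
    by (rule wirtinger_mixed) (use da ca bd in \<open>auto simp: a_def\<close>)
  moreover have "(pi / 1)\<^sup>2 * integral {0..1} (\<lambda>s. (o' s)\<^sup>2) \<le> integral {0..1} (\<lambda>s. (o1 s)\<^sup>2)"
    by (rule wirtinger_dirichlet) (use do ca bd in \<open>auto simp: o'_def\<close>)
  ultimately have "pi\<^sup>2 / 4 * (integral {0..1} (\<lambda>s. (a s)\<^sup>2) + 4 * integral {0..1} (\<lambda>s. (o' s)\<^sup>2))
     \<le> integral {0..1} (\<lambda>s. (a1 s)\<^sup>2) + integral {0..1} (\<lambda>s. (o1 s)\<^sup>2)"
    by (simp add: power_divide algebra_simps)
  also have "\<dots> = integral {0..1} (\<lambda>s. (a1 s)\<^sup>2 + (o1 s)\<^sup>2)"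
    by (rule integral_add[symmetric]; intro integrable_continuous_interval continuous_intros ca)
  also have "\<dots> = integral {0..1} (\<lambda>s. 2 * ((f' s)\<^sup>2 + (f' (- s))\<^sup>2))"
    by (simp add: a1_def o1_def power2_eq_square algebra_simps)
  also have "\<dots> = 2 * integral {-1..1} (\<lambda>s. (f' s)\<^sup>2)"
    by (simp only: integral_mult_right integral_fold_symmetric[OF continuous_on_power[OF cf']])
  also have "integral {0..1} (\<lambda>s. (a s)\<^sup>2) + 4 * integral {0..1} (\<lambda>s. (o' s)\<^sup>2)
     = integral {0..1} (\<lambda>s. (a s)\<^sup>2 + 4 * (o' s)\<^sup>2)"
    by (subst integral_add; (intro integrable_continuous_interval continuous_intros ca)?) simp
  finally show ?thesis by (simp add: field_simps)
qed

text \<open>Dropping the surplus of the odd part from \<open>parity_energy\<close> leaves N <= P,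
  which settles the regime where the weighted mass is large.\<close>

lemma wirtinger_symmetric:
  "integral {-1..1} (\<lambda>s. (f s)\<^sup>2) \<le> 4 / pi\<^sup>2 * integral {-1..1} (\<lambda>s. (f' s)\<^sup>2)"
proof -
  have c: "continuous_on {0..1} f" "continuous_on {-1..0} f"
    by (rule continuous_on_subset[OF cont_f]; simp)+
  have c': "continuous_on {0..1} (\<lambda>s. f (- s))"
    by (rule continuous_on_compose2[OF c(2)]; auto intro: continuous_intros)
  have "2 * integral {-1..1} (\<lambda>s. (f s)\<^sup>2) = integral {0..1} (\<lambda>s. 2 * ((f s)\<^sup>2 + (f (- s))\<^sup>2))"
    by (simp only: integral_mult_right integral_fold_symmetric[OF continuous_on_power[OF cont_f]])
  also have "\<dots> \<le> integral {0..1} (\<lambda>s. (f s + f (- s))\<^sup>2 + 4 * (f s - f (- s))\<^sup>2)"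
  proof (rule integral_le; (intro integrable_continuous_interval continuous_intros c c')?)
    fix s
    have "0 \<le> 3 * (f s - f (- s))\<^sup>2" by simp
    then show "2 * ((f s)\<^sup>2 + (f (- s))\<^sup>2) \<le> (f s + f (- s))\<^sup>2 + 4 * (f s - f (- s))\<^sup>2"
      by (simp add: power2_eq_square algebra_simps)
  qed
  also have "\<dots> \<le> 8 / pi\<^sup>2 * integral {-1..1} (\<lambda>s. (f' s)\<^sup>2)"
    by (rule parity_energy)
  finally show ?thesis by simp
qed

text \<open>The linearised uncertainty inequality, obtained by integrating the pointwise form with d
  = \<theta> s. The pointwise surplus d^2 / 2000 becomes the second-moment term, which is later
  bounded below to produce the gap.\<close>

lemma parity_bound:
  fixes k \<theta> :: real
  assumes k: "1 / 2 \<le> k" "k \<le> 77 / 50" and th: "\<bar>\<theta>\<bar> < 1"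
  shows "2 * k * integral {-1..1} (\<lambda>s. (f s)\<^sup>2) + \<theta>\<^sup>2 / 2000 * integral {-1..1} (\<lambda>s. s\<^sup>2 * (f s)\<^sup>2)
    \<le> 4 / pi\<^sup>2 * integral {-1..1} (\<lambda>s. (f' s)\<^sup>2)
      + k\<^sup>2 * integral {-1..1} (\<lambda>s. (f s)\<^sup>2 / (1 + \<theta> * s)\<^sup>2)"
proof -
  have c: "continuous_on {0..1} f" "continuous_on {-1..0} f"
    by (rule continuous_on_subset[OF cont_f]; simp)+
  have c': "continuous_on {0..1} (\<lambda>s. f (- s))"
    by (rule continuous_on_compose2[OF c(2)]; auto intro: continuous_intros)
  have ts: "\<bar>\<theta> * s\<bar> < 1" if "\<bar>s\<bar> \<le> 1" for s
  proof -
    have "\<bar>\<theta>\<bar> * \<bar>s\<bar> \<le> \<bar>\<theta>\<bar> * 1" using that by (intro mult_left_mono) auto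
    then show ?thesis using th by (simp add: abs_mult)
  qed
  have nz: "1 + \<theta> * s \<noteq> 0" if "s \<in> {-1..1}" for s using ts[of s] that by (auto simp: abs_le_iff)
  define F where "F = (\<lambda>s. \<theta>\<^sup>2 / 2000 * (s\<^sup>2 * (f s)\<^sup>2) + 2 * k * (f s)\<^sup>2 - k\<^sup>2 * ((f s)\<^sup>2 / (1 + \<theta> * s)\<^sup>2))"
  have cF: "continuous_on {-1..1} F" unfolding F_def
    by (intro continuous_intros cont_f) (use nz in auto)
  have cF': "continuous_on {0..1} F" "continuous_on {0..1} (\<lambda>s. F (- s))"
    by (rule continuous_on_compose2[OF cF] continuous_on_subset[OF cF]; auto intro: continuous_intros)+
  have "2 * integral {-1..1} F = integral {0..1} (\<lambda>s. 2 * (F s + F (- s)))"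
    by (simp only: integral_mult_right integral_fold_symmetric[OF cF])
  also have "\<dots> \<le> integral {0..1} (\<lambda>s. (f s + f (- s))\<^sup>2 + 4 * (f s - f (- s))\<^sup>2)"
  proof (rule integral_le; (intro integrable_continuous_interval continuous_intros c c' cF')?)
    fix s :: real assume "s \<in> {0..1}"
    then have "\<bar>\<theta> * s\<bar> < 1" by (intro ts) auto
    then show "2 * (F s + F (- s)) \<le> (f s + f (- s))\<^sup>2 + 4 * (f s - f (- s))\<^sup>2"
      using parity_form_lower_bound'[OF k, of "\<theta> * s" "f s" "f (- s)"]
      by (simp add: F_def power_mult_distrib mult.assoc)
  qed
  also have "\<dots> \<le> 8 / pi\<^sup>2 * integral {-1..1} (\<lambda>s. (f' s)\<^sup>2)"
    by (rule parity_energy)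
  finally have "integral {-1..1} F \<le> 4 / pi\<^sup>2 * integral {-1..1} (\<lambda>s. (f' s)\<^sup>2)" by simp
  moreover have "integral {-1..1} F = \<theta>\<^sup>2 / 2000 * integral {-1..1} (\<lambda>s. s\<^sup>2 * (f s)\<^sup>2)
    + 2 * k * integral {-1..1} (\<lambda>s. (f s)\<^sup>2) - k\<^sup>2 * integral {-1..1} (\<lambda>s. (f s)\<^sup>2 / (1 + \<theta> * s)\<^sup>2)"
  proof -
    have i: "(\<lambda>s. s\<^sup>2 * (f s)\<^sup>2) integrable_on {-1..1}" "(\<lambda>s. (f s)\<^sup>2) integrable_on {-1..1}"
      "(\<lambda>s. (f s)\<^sup>2 / (1 + \<theta> * s)\<^sup>2) integrable_on {-1..1}"
      by (intro integrable_continuous_interval continuous_intros cont_f; use nz in auto)+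
    show ?thesis unfolding F_def
      by (subst integral_diff integral_add; (intro integrable_add integrable_on_mult_right i)?)+ (simp only: integral_mult_right)
  qed
  ultimately show ?thesis by linarith
qed

end

section \<open>Mass near the wide end, and the uncertainty inequality\<close>

lemma inverse_square_tangent:
  fixes z :: real
  assumes "0 \<le> z" "z < 1"
  shows "1 + 11 * z\<^sup>2 \<le> 1 / (1 - z)\<^sup>2"
proof -
  \<comment> \<open>The largest admissible coefficient of z^2 is the minimum of (2 - z) / (z (1 -
    z)^2), about 11.09, attained at z = (3 - sqrt 5) / 2; hence the 11. In this positivity
    certificate the squares are centred near that point, and the affine remainder is positive on [0,
    1).\<close>
  have "2 - 12 * z + 22 * z\<^sup>2 - 11 * z ^ 3
    = 11 * (1 - z) * (z - 7 / 18)\<^sup>2 + 22 / 9 * (z - 91 / 250)\<^sup>2 + (63487 / 5062500 - 53 / 40500 * z)"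
    by (simp add: power2_eq_square power3_eq_cube field_simps)
  also have "0 \<le> \<dots>"
    using assms by (intro add_nonneg_nonneg) auto
  finally have "0 \<le> z * (2 - 12 * z + 22 * z\<^sup>2 - 11 * z ^ 3)" using assms by simp
  also have "\<dots> = 1 - (1 + 11 * z\<^sup>2) * (1 - z)\<^sup>2"
    by (simp add: power2_eq_square power3_eq_cube algebra_simps)
  finally show ?thesis using assms by (simp add: pos_le_divide_eq)
qed

lemma pi_squared_le: "pi\<^sup>2 \<le> 99 / 10"
proof -
  have "pi \<le> 3.1416" using pi_approx by (simp add: abs_le_iff)
  then have "pi\<^sup>2 \<le> 3.1416\<^sup>2" by (intro power_mono) auto
  also have "(3.1416\<^sup>2 :: real) \<le> 99 / 10" by (simp add: power2_eq_square)
  finally show ?thesis .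
qed

text \<open>The numerical check behind \<open>harmonic_bound\<close>, with W = 1 + \<theta>. It is
  nearly tight at W = 2, where the left side is 1.54; the value 155/100 is still small enough that
  155/100 * 65/100 <= 101/100.\<close>

lemma width_polynomial_bound:
  fixes W :: real
  assumes "1 \<le> W" "W \<le> 2"
  shows "101 / 100 * W\<^sup>2 - 10 * ((W - 1) / W)\<^sup>2 \<le> 155 / 100"
proof -
  define t where "t = W - 1"
  have t: "0 \<le> t" "t \<le> 1" using assms by (auto simp: t_def)
  have "0 \<le> t\<^sup>2 * (1 - t)" using t by simp
  then have "t ^ 3 \<le> t\<^sup>2" by (simp add: power2_eq_square power3_eq_cube algebra_simps)
  have "t ^ 4 \<le> t ^ 3" using t by (simp add: power_decreasing)
  have "0 \<le> 44 / 100 * (1 - t)\<^sup>2" by simp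
  then have "0 \<le> 44 / 100 - 88 / 100 * t + 44 / 100 * t\<^sup>2" by (simp add: power2_eq_square field_simps)
  then have "101 / 100 * (1 + 4 * t + 6 * t\<^sup>2 + 4 * t ^ 3 + t ^ 4) - 10 * t\<^sup>2
      \<le> 155 / 100 * (1 + 2 * t + t\<^sup>2)"
    using \<open>t ^ 3 \<le> t\<^sup>2\<close> \<open>t ^ 4 \<le> t ^ 3\<close> t by (simp add: field_simps)
  moreover have "1 + 4 * t + 6 * t\<^sup>2 + 4 * t ^ 3 + t ^ 4 = W\<^sup>2 * W\<^sup>2"
    by (simp add: t_def power2_eq_square power3_eq_cube power4_eq_xxxx algebra_simps)
  moreover have "1 + 2 * t + t\<^sup>2 = W\<^sup>2" by (simp add: t_def power2_eq_square algebra_simps)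
  moreover have "t\<^sup>2 = W\<^sup>2 * ((W - 1) / W)\<^sup>2" using assms by (simp add: t_def power_divide)
  ultimately have "W\<^sup>2 * (101 / 100 * W\<^sup>2 - 10 * ((W - 1) / W)\<^sup>2) \<le> W\<^sup>2 * (155 / 100)"
    by (simp add: algebra_simps)
  then show ?thesis using assms by (subst (asm) mult_le_cancel_left_pos) auto
qed

context
  fixes f f' :: "real \<Rightarrow> real"
  assumes f: "\<And>x. x \<in> {-1..1} \<Longrightarrow> (f has_real_derivative f' x) (at x within {-1..1})"
    and cf': "continuous_on {-1..1} f'"
    and bd: "f (-1) = 0" "f 1 = 0"
begin

text \<open>In the coordinate z = \<rho> (1 - s), proportional to the distance from the wide end,
  the weight is 1 / (W^2 (1 - z)^2). The parabola 1 + 11 z^2 below 1 / (1 - z)^2 bounds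
  \<open>B\<close> by the mass and the second moment \<open>X\<close>, and the half-line Heisenberg
  inequality prevents both \<open>X\<close> and \<open>P\<close> from being small.\<close>

lemma harmonic_bound:
  fixes \<theta> :: real
  defines "N \<equiv> integral {-1..1} (\<lambda>s. (f s)\<^sup>2)"
    and "B \<equiv> integral {-1..1} (\<lambda>s. (f s)\<^sup>2 / (1 + \<theta> * s)\<^sup>2)"
    and "P \<equiv> 4 / pi\<^sup>2 * integral {-1..1} (\<lambda>s. (f' s)\<^sup>2)"
  assumes th: "0 \<le> \<theta>" "\<theta> < 1" and BN: "B \<le> 65 / 100 * N"
  shows "101 / 100 * N\<^sup>2 \<le> P * B"
proof -
  note cf = cont_f[OF f cf' bd]
  define X where "X = integral {-1..1} (\<lambda>s. (1 - s)\<^sup>2 * (f s)\<^sup>2)"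
  define W \<rho> where "W = 1 + \<theta>" and "\<rho> = \<theta> / W"
  have W: "1 \<le> W" "W < 2" using th by (auto simp: W_def)
  have nz: "1 + \<theta> * s > 0" if "s \<in> {-1..1}" for s
  proof -
    have "\<theta> * -1 \<le> \<theta> * s" using that th by (intro mult_left_mono) auto
    then show ?thesis using th by simp
  qed
  have i: "(\<lambda>s. (f s)\<^sup>2) integrable_on {-1..1}" "(\<lambda>s. (1 - s)\<^sup>2 * (f s)\<^sup>2) integrable_on {-1..1}"
    "(\<lambda>s. (f s)\<^sup>2 / (1 + \<theta> * s)\<^sup>2) integrable_on {-1..1}" "(\<lambda>s. (f' s)\<^sup>2) integrable_on {-1..1}"
    by (intro integrable_continuous_interval continuous_intros cf cf'; use nz in \<open>auto simp: less_le\<close>)+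
  have nn: "0 \<le> N" "0 \<le> B" "0 \<le> P" unfolding N_def B_def P_def
    by (auto intro!: integral_nonneg divide_nonneg_nonneg mult_nonneg_nonneg i)
  have "9 * N\<^sup>2 \<le> 4 * integral {-1..1} (\<lambda>s. (f' s)\<^sup>2) * X"
    unfolding N_def X_def by (rule heisenberg_halfline[OF f cf' bd]) auto
  also have "\<dots> = pi\<^sup>2 * (P * X)" by (simp add: P_def)
  also have "\<dots> \<le> 99 / 10 * (P * X)"
    unfolding X_def using nn pi_squared_le by (intro mult_right_mono mult_nonneg_nonneg integral_nonneg i) auto
  \<comment> \<open>The estimate pi^2 <= 99/10 = 9 * 11/10 is tailored to the 9 of the Heisenberg
    bound, so that the factor 11 here matches the 11 of the parabola.\<close>
  finally have PX: "10 * N\<^sup>2 \<le> 11 * (P * X)" by simp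
  have "N + 11 * \<rho>\<^sup>2 * X = integral {-1..1} (\<lambda>s. (f s)\<^sup>2 + 11 * \<rho>\<^sup>2 * ((1 - s)\<^sup>2 * (f s)\<^sup>2))"
    unfolding N_def X_def
    by (subst integral_add; (intro integrable_on_mult_right i)?) (simp only: integral_mult_right)
  also have "\<dots> \<le> integral {-1..1} (\<lambda>s. W\<^sup>2 * ((f s)\<^sup>2 / (1 + \<theta> * s)\<^sup>2))"
  proof (rule integral_le; (intro integrable_add integrable_on_mult_right i)?)
    fix s :: real assume s: "s \<in> {-1..1}"
    define z where "z = \<rho> * (1 - s)"
    have eq: "1 + \<theta> * s = W * (1 - z)" using W by (simp add: z_def \<rho>_def W_def field_simps)
    have "0 < W * (1 - z)" using nz[OF s] eq by simp
    then have z: "0 \<le> z" "z < 1" using W s th by (auto simp: z_def \<rho>_def zero_less_mult_iff)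
    have "(f s)\<^sup>2 * (1 + 11 * z\<^sup>2) \<le> (f s)\<^sup>2 * (1 / (1 - z)\<^sup>2)"
      by (intro mult_left_mono inverse_square_tangent z) auto
    also have "\<dots> = W\<^sup>2 * ((f s)\<^sup>2 / (1 + \<theta> * s)\<^sup>2)"
      unfolding eq using W by (simp add: power_mult_distrib)
    finally show "(f s)\<^sup>2 + 11 * \<rho>\<^sup>2 * ((1 - s)\<^sup>2 * (f s)\<^sup>2) \<le> W\<^sup>2 * ((f s)\<^sup>2 / (1 + \<theta> * s)\<^sup>2)"
      by (simp add: z_def power_mult_distrib distrib_left mult_ac)
  qed
  also have "\<dots> = W\<^sup>2 * B" by (simp only: B_def integral_mult_right)
  finally have Y: "N + 11 * \<rho>\<^sup>2 * X \<le> W\<^sup>2 * B" .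
  show ?thesis
  proof (cases "\<theta> = 0")
    \<comment> \<open>Here \<rho> = 0 and the final cancellation is impossible. Instead W = 1, so
      \<open>Y\<close> gives N <= B, which together with B <= 65/100 N leaves only N = 0.\<close>
    case True
    then have "N = 0" using Y BN nn by (simp add: W_def \<rho>_def)
    then show ?thesis using nn by simp
  next
    case False
    then have "\<rho>\<^sup>2 > 0" using th W by (simp add: \<rho>_def)
    \<comment> \<open>Eliminate \<open>X\<close>, which \<open>PX\<close> bounds from below and
      \<open>Y\<close> from above.\<close>
    have "\<rho>\<^sup>2 * (10 * N\<^sup>2) \<le> \<rho>\<^sup>2 * (11 * (P * X))" by (intro mult_left_mono PX) auto
    also have "\<dots> = P * (11 * \<rho>\<^sup>2 * X)" by simp
    also have "\<dots> \<le> P * (W\<^sup>2 * B - N)" using Y nn by (intro mult_left_mono) auto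
    finally have 1: "\<rho>\<^sup>2 * (10 * N\<^sup>2) \<le> P * (W\<^sup>2 * B - N)" .
    \<comment> \<open>What remains is 101/100 (W^2 B - N) <= 10 \<rho>^2 B, and this is the place
      where smallness of B / N is spent.\<close>
    have "\<rho> = (W - 1) / W" by (simp add: \<rho>_def W_def)
    then have "101 / 100 * W\<^sup>2 - 10 * \<rho>\<^sup>2 \<le> 155 / 100" using width_polynomial_bound W by simp
    then have "(101 / 100 * W\<^sup>2 - 10 * \<rho>\<^sup>2) * B \<le> 155 / 100 * B" using nn by (intro mult_right_mono) auto
    also have "\<dots> \<le> 101 / 100 * N" using BN nn by simp
    finally have "101 / 100 * (W\<^sup>2 * B - N) \<le> 10 * \<rho>\<^sup>2 * B" by (simp add: algebra_simps)
    then have "P * (101 / 100 * (W\<^sup>2 * B - N)) \<le> P * (10 * \<rho>\<^sup>2 * B)" using nn by (intro mult_left_mono) auto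
    with 1 have "\<rho>\<^sup>2 * (101 / 100 * N\<^sup>2) \<le> \<rho>\<^sup>2 * (P * B)" by (simp add: algebra_simps)
    then show ?thesis using \<open>\<rho>\<^sup>2 > 0\<close> by (subst (asm) mult_le_cancel_left_pos)
  qed
qed

lemma uncertainty_nonneg_slope:
  fixes \<theta> :: real
  defines "N \<equiv> integral {-1..1} (\<lambda>s. (f s)\<^sup>2)"
    and "B \<equiv> integral {-1..1} (\<lambda>s. (f s)\<^sup>2 / (1 + \<theta> * s)\<^sup>2)"
    and "P \<equiv> 4 / pi\<^sup>2 * integral {-1..1} (\<lambda>s. (f' s)\<^sup>2)"
  assumes th: "0 \<le> \<theta>" "\<theta> < 1"
  shows "(1 + \<theta>\<^sup>2 / 100000) * N\<^sup>2 \<le> P * B"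
proof -
  note cf = cont_f[OF f cf' bd]
  define S where "S = integral {-1..1} (\<lambda>s. s\<^sup>2 * (f s)\<^sup>2)"
  have nz: "1 + \<theta> * s > 0" if "s \<in> {-1..1}" for s
  proof -
    have "\<theta> * -1 \<le> \<theta> * s" using that th by (intro mult_left_mono) auto
    then show ?thesis using th by simp
  qed
  have i: "(\<lambda>s. (f s)\<^sup>2) integrable_on {-1..1}" "(\<lambda>s. s\<^sup>2 * (f s)\<^sup>2) integrable_on {-1..1}"
    "(\<lambda>s. (f s)\<^sup>2 / (1 + \<theta> * s)\<^sup>2) integrable_on {-1..1}" "(\<lambda>s. (f' s)\<^sup>2) integrable_on {-1..1}"
    by (intro integrable_continuous_interval continuous_intros cf cf'; use nz in \<open>auto simp: less_le\<close>)+
  have nn: "0 \<le> N" "0 \<le> B" "0 \<le> P" "0 \<le> S" unfolding N_def B_def P_def S_def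
    by (auto intro!: integral_nonneg divide_nonneg_nonneg mult_nonneg_nonneg i)
  have th2: "\<theta>\<^sup>2 \<le> 1" using th by (simp add: power_le_one)
  then have "(1 + \<theta>\<^sup>2 / 100000) * N\<^sup>2 \<le> 101 / 100 * N\<^sup>2" by (intro mult_right_mono) auto
  then have th2N: "(1 + \<theta>\<^sup>2 / 100000) * N\<^sup>2 \<le> 101 / 100 * N\<^sup>2" "(1 + \<theta>\<^sup>2 / 100000) * N\<^sup>2 \<le> 2 * N\<^sup>2"
    using zero_le_power2[of N] by linarith+
  have PN: "N \<le> P" unfolding N_def P_def by (rule wirtinger_symmetric[OF f cf' bd])
  \<comment> \<open>The last range is the one where k = N / B is admissible for the parity form: 1/2
    < k < 100/65, and 100/65 is below 77/50.\<close>
  consider "N = 0" | "B \<le> 65 / 100 * N" | "2 * N \<le> B" | "N > 0" "65 / 100 * N < B" "B < 2 * N"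
    using nn by linarith
  then show ?thesis
  proof cases
    case 1
    then show ?thesis using nn by simp
  next
    case 2
    have "101 / 100 * N\<^sup>2 \<le> P * B"
      using harmonic_bound[of \<theta>] th 2 by (simp add: N_def B_def P_def)
    then show ?thesis using th2N by linarith
  next
    case 3
    have "N * (2 * N) \<le> P * B" using 3 PN nn by (intro mult_mono) auto
    then have "2 * N\<^sup>2 \<le> P * B" by (simp add: power2_eq_square)
    then show ?thesis using th2N by linarith
  next
    case 4
    then have B: "B > 0" by simp
    define c where "c = \<theta>\<^sup>2 / 2000"
    have c: "0 \<le> c" by (simp add: c_def)
    have k: "1 / 2 \<le> N / B" "N / B \<le> 77 / 50" using 4 B by (auto simp: field_simps)
    \<comment> \<open>k = N / B is the optimal linearisation: multiplied by \<open>B\<close>, the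
      terms 2 k N and k^2 B become 2 N^2 and N^2, so N^2 is left over exactly.\<close>
    have "2 * (N / B) * N + c * S \<le> P + (N / B)\<^sup>2 * B"
      using parity_bound[OF f cf' bd k, of \<theta>, folded N_def B_def P_def S_def c_def] th by simp
    then have "(2 * (N / B) * N + c * S) * B \<le> (P + (N / B)\<^sup>2 * B) * B"
      using B by (intro mult_right_mono) auto
    moreover have "2 * (N / B) * N * B = 2 * N\<^sup>2" "(N / B)\<^sup>2 * B * B = N\<^sup>2"
      using B by (simp_all add: power2_eq_square)
    ultimately have par: "N\<^sup>2 + c * S * B \<le> P * B"
      unfolding distrib_right by linarith
    show ?thesis
    proof (cases "2 * N\<^sup>2 \<le> P * B")
      case True
      then show ?thesis using th2N by linarith
    next
      case False
      \<comment> \<open>If the energy is not already large, \<open>f\<close> cannot concentrate at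
        the centre s = 0, where the pointwise surplus degenerates: this Heisenberg bound yields B <=
        20 S, hence S B >= 2/100 N^2. With c = \<theta>^2 / 2000 this is the gap \<theta>^2 /
        100000.\<close>
      have "N\<^sup>2 \<le> 4 * integral {-1..1} (\<lambda>s. (f' s)\<^sup>2) * S"
        unfolding N_def S_def by (rule heisenberg_interval[OF f cf' bd]) auto
      also have "\<dots> = pi\<^sup>2 * (P * S)" by (simp add: P_def)
      also have "\<dots> \<le> 10 * (P * S)" using pi_squared_le nn by (intro mult_right_mono) auto
      finally have "N\<^sup>2 * B \<le> 10 * (P * S) * B" using B by (intro mult_right_mono) auto
      also have "\<dots> = 10 * (P * B) * S" by simp
      also have "\<dots> \<le> 10 * (2 * N\<^sup>2) * S" using False nn by (intro mult_right_mono mult_left_mono) auto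
      finally have "N\<^sup>2 * B \<le> N\<^sup>2 * (20 * S)" by simp
      then have "B \<le> 20 * S" using \<open>N > 0\<close> by (subst (asm) mult_le_cancel_left_pos) auto
      then have "65 / 100 * N \<le> 20 * S" using 4 by simp
      then have "65 / 100 * N * (65 / 100 * N) \<le> 20 * S * B"
        by (rule mult_mono) (use 4 nn in auto)
      moreover have "0 \<le> S * B" using nn by simp
      ultimately have "2 / 100 * N\<^sup>2 \<le> S * B" by (simp add: power2_eq_square)
      then have "c * (2 / 100 * N\<^sup>2) \<le> c * (S * B)" using c by (intro mult_left_mono) auto
      then show ?thesis using par by (simp add: c_def algebra_simps)
    qed
  qed
qed

end

text \<open>The reflection s -> - s exchanges the wide and the narrow end, which reduces negative
  slopes to the case already treated.\<close>

lemma uncertainty_affine_weight: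
  fixes f f' :: "real \<Rightarrow> real" and \<theta> :: real
  assumes f: "\<And>x. x \<in> {-1..1} \<Longrightarrow> (f has_real_derivative f' x) (at x within {-1..1})"
    and cf': "continuous_on {-1..1} f'"
    and bd: "f (-1) = 0" "f 1 = 0" and th: "\<bar>\<theta>\<bar> < 1"
  shows "(1 + \<theta>\<^sup>2 / 100000) * (integral {-1..1} (\<lambda>s. (f s)\<^sup>2))\<^sup>2
    \<le> 4 / pi\<^sup>2 * integral {-1..1} (\<lambda>s. (f' s)\<^sup>2) * integral {-1..1} (\<lambda>s. (f s)\<^sup>2 / (1 + \<theta> * s)\<^sup>2)"
proof (cases "\<theta> \<ge> 0")
  case True
  then show ?thesis using uncertainty_nonneg_slope[OF f cf' bd] th by simp
next
  case False
  have r: "integral {-1..1} g = integral {-1..1} (\<lambda>s. g (- s))" for g :: "real \<Rightarrow> real"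
    using Henstock_Kurzweil_Integration.integral_reflect_real[of 1 "-1" g] by simp
  have "((\<lambda>s. f (- s)) has_real_derivative - f' (- s)) (at s within {-1..1})" if "s \<in> {-1..1}" for s
  proof -
    have "(f has_real_derivative f' (- s)) (at (- s) within uminus ` {-1..1})"
      using f[of "- s"] that by (intro DERIV_subset[OF f]) auto
    then have "((f \<circ> uminus) has_real_derivative f' (- s) * - 1) (at s within {-1..1})"
      by (rule DERIV_image_chain) (auto intro!: derivative_eq_intros)
    then show ?thesis by (simp add: o_def)
  qed
  moreover have "continuous_on {-1..1} (\<lambda>s. - f' (- s))"
    by (intro continuous_intros continuous_on_compose2[OF cf']) (auto intro: continuous_intros)
  ultimately have "(1 + (- \<theta>)\<^sup>2 / 100000) * (integral {-1..1} (\<lambda>s. (f (- s))\<^sup>2))\<^sup>2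
    \<le> 4 / pi\<^sup>2 * integral {-1..1} (\<lambda>s. (- f' (- s))\<^sup>2)
      * integral {-1..1} (\<lambda>s. (f (- s))\<^sup>2 / (1 + - \<theta> * s)\<^sup>2)"
    using bd th False by (intro uncertainty_nonneg_slope) auto
  then show ?thesis
    by (subst (1 2 3) r) simp
qed

section \<open>From the uncertainty inequality to the bound on one vertical slice\<close>

text \<open>The factor 1 / 100000 is the (far from optimal) gap that separates non-rectangles from rectangles.\<close>

definition slice_const :: "real \<Rightarrow> real \<Rightarrow> real \<Rightarrow> real" where
  "slice_const a b h = (if a = b then (pi / h)\<^sup>2 + (pi / (2 * a))\<^sup>2
     else 2 * pi\<^sup>2 / ((a + b) * h) * sqrt (1 + ((b - a) / (b + a))\<^sup>2 / 100000))"

text \<open>For a = b the excess is the perfect square (pi / (2 a) - pi / h)^2, the defect in AM-GM,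
  so equality means h = 2 a. For a \<noteq> b the square root exceeds 1 and equality is
  impossible.\<close>

lemma slice_const_ge:
  fixes a b h :: real
  assumes pos: "a > 0" "b > 0" "h > 0"
  shows "2 * pi\<^sup>2 / ((a + b) * h) \<le> slice_const a b h"
    and "slice_const a b h = 2 * pi\<^sup>2 / ((a + b) * h) \<longleftrightarrow> a = b \<and> h = 2 * a"
proof -
  have eq: "slice_const a a h - 2 * pi\<^sup>2 / ((a + a) * h) = (pi * (h - 2 * a) / (2 * a * h))\<^sup>2"
    using pos by (simp add: slice_const_def power2_eq_square field_simps)
  have "2 * pi\<^sup>2 / ((a + b) * h) < slice_const a b h" if "a \<noteq> b"
  proof -
    have "0 < ((b - a) / (b + a))\<^sup>2" using that pos by simp
    then have "1 < sqrt (1 + ((b - a) / (b + a))\<^sup>2 / 100000)" by simp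
    moreover have "0 < 2 * pi\<^sup>2 / ((a + b) * h)" using pos by simp
    ultimately have "2 * pi\<^sup>2 / ((a + b) * h) * 1
        < 2 * pi\<^sup>2 / ((a + b) * h) * sqrt (1 + ((b - a) / (b + a))\<^sup>2 / 100000)"
      by (intro mult_strict_left_mono)
    then show ?thesis using that by (simp add: slice_const_def)
  qed
  moreover have "2 * pi\<^sup>2 / ((a + a) * h) \<le> slice_const a a h"
    using eq zero_le_power2[of "pi * (h - 2 * a) / (2 * a * h)"] by linarith
  moreover have "slice_const a a h = 2 * pi\<^sup>2 / ((a + a) * h) \<longleftrightarrow> h = 2 * a"
  proof -
    have "slice_const a a h = 2 * pi\<^sup>2 / ((a + a) * h) \<longleftrightarrow> (pi * (h - 2 * a) / (2 * a * h))\<^sup>2 = 0"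
      using eq by linarith
    then show ?thesis using pos by simp
  qed
  ultimately show "2 * pi\<^sup>2 / ((a + b) * h) \<le> slice_const a b h"
    and "slice_const a b h = 2 * pi\<^sup>2 / ((a + b) * h) \<longleftrightarrow> a = b \<and> h = 2 * a"
    by (cases "a = b"; force)+
qed

lemma integral_rescale_interval:
  fixes g :: "real \<Rightarrow> real"
  assumes "h > 0" "continuous_on {0..h} g"
  shows "integral {0..h} g = h / 2 * integral {-1..1} (\<lambda>s. g (h / 2 * s + h / 2))"
proof -
  have "(g has_integral integral {0..h} g) (cbox 0 h)"
    using integrable_integral[OF integrable_continuous_interval[OF assms(2)]] by simp
  from has_integral_affinity'[OF this, of "h / 2" "h / 2"]
  have "((\<lambda>s. g (h / 2 * s + h / 2)) has_integral (integral {0..h} g / (h / 2))) {-1..1}"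
    using \<open>h > 0\<close> by (simp add: field_simps)
  from integral_unique[OF this] show ?thesis using \<open>h > 0\<close> by (simp add: field_simps)
qed

text \<open>When a = b the potential is constant, and Wirtinger for the derivative term keeps the
  full dependence on h / a. Otherwise the product bound is turned into a bound on the sum by AM-GM;
  the loss is harmless because the gap factor already excludes equality.\<close>

lemma slice_energy:
  fixes f f' :: "real \<Rightarrow> real"
  assumes pos: "a > 0" "b > 0" "h > 0"
    and f: "\<And>y. y \<in> {0..h} \<Longrightarrow> (f has_real_derivative f' y) (at y within {0..h})"
    and cf': "continuous_on {0..h} f'"
    and bd: "f 0 = 0" "f h = 0"
  shows "slice_const a b h * integral {0..h} (\<lambda>y. (f y)\<^sup>2)
    \<le> integral {0..h} (\<lambda>y. (f' y)\<^sup>2)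
      + integral {0..h} (\<lambda>y. (pi / (2 * (a + (b - a) * y / h)))\<^sup>2 * (f y)\<^sup>2)"
proof (cases "a = b")
  case True
  then show ?thesis using wirtinger_dirichlet[OF \<open>h > 0\<close> f cf' bd]
    by (simp add: slice_const_def distrib_right)
next
  case False
  \<comment> \<open>With y = h / 2 (1 + s) the width becomes (a + b) / 2 (1 + \<theta> s), and
    positive side lengths give |\<theta>| < 1.\<close>
  define \<theta> where "\<theta> = (b - a) / (b + a)"
  define r where "r = sqrt (1 + \<theta>\<^sup>2 / 100000)"
  define F where "F = (\<lambda>s. f (h / 2 * s + h / 2))"
  define F' where "F' = (\<lambda>s. h / 2 * f' (h / 2 * s + h / 2))"
  define N P B where "N = integral {-1..1} (\<lambda>s. (F s)\<^sup>2)"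
    and "P = 4 / pi\<^sup>2 * integral {-1..1} (\<lambda>s. (F' s)\<^sup>2)"
    and "B = integral {-1..1} (\<lambda>s. (F s)\<^sup>2 / (1 + \<theta> * s)\<^sup>2)"
  have cf: "continuous_on {0..h} f" using f DERIV_continuous_on by blast
  have img: "h / 2 * s + h / 2 \<in> {0..h}" if "s \<in> {-1..1}" for s
  proof -
    have "h / 2 * -1 \<le> h / 2 * s" "h / 2 * s \<le> h / 2 * 1" using that pos by (intro mult_left_mono; simp)+
    then show ?thesis by simp
  qed
  have dF: "(F has_real_derivative F' s) (at s within {-1..1})" if s: "s \<in> {-1..1}" for s
  proof -
    have "(f has_real_derivative f' (h / 2 * s + h / 2)) (at (h / 2 * s + h / 2) within (\<lambda>s. h / 2 * s + h / 2) ` {-1..1})"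
      using img by (intro DERIV_subset[OF f[OF img[OF s]]]) auto
    then have "((f \<circ> (\<lambda>s. h / 2 * s + h / 2)) has_real_derivative f' (h / 2 * s + h / 2) * (h / 2)) (at s within {-1..1})"
      by (rule DERIV_image_chain) (auto intro!: derivative_eq_intros)
    then show ?thesis by (simp add: o_def F_def F'_def mult.commute)
  qed
  have cF': "continuous_on {-1..1} F'"
    unfolding F'_def by (intro continuous_intros continuous_on_compose2[OF cf']) (use img in auto)
  have cF: "continuous_on {-1..1} F" using dF DERIV_continuous_on by blast
  have th: "\<bar>\<theta>\<bar> < 1" unfolding \<theta>_def using pos by (simp add: abs_if field_simps)
  have "(r * N)\<^sup>2 \<le> P * B"
    using uncertainty_affine_weight[OF dF cF' _ _ th] bd
    by (simp add: N_def P_def B_def r_def power_mult_distrib F_def)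
  have wpos: "a + (b - a) * y / h > 0" if "y \<in> {0..h}" for y
  proof -
    have "a + (b - a) * y / h = (a * (h - y) + b * y) / h" using pos by (simp add: field_simps)
    moreover have "0 < a * (h - y) + b * y"
      using pos that by (cases "y = 0") (auto intro!: add_nonneg_pos mult_nonneg_nonneg)
    ultimately show ?thesis using pos by simp
  qed
  have eN: "integral {0..h} (\<lambda>y. (f y)\<^sup>2) = h / 2 * N"
    unfolding N_def F_def by (rule integral_rescale_interval) (auto intro!: continuous_intros cf pos)
  \<comment> \<open>The normalisation 4 / pi^2 in \<open>P\<close> is chosen so that the derivative
    energy and the potential energy share the factor pi^2 / (2 h).\<close>
  have eP: "integral {0..h} (\<lambda>y. (f' y)\<^sup>2) = pi\<^sup>2 / (2 * h) * P"
  proof -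
    have "integral {0..h} (\<lambda>y. (f' y)\<^sup>2) = h / 2 * integral {-1..1} (\<lambda>s. (f' (h / 2 * s + h / 2))\<^sup>2)"
      by (rule integral_rescale_interval) (auto intro!: continuous_intros cf' pos)
    moreover have "integral {-1..1} (\<lambda>s. (F' s)\<^sup>2) = (h / 2)\<^sup>2 * integral {-1..1} (\<lambda>s. (f' (h / 2 * s + h / 2))\<^sup>2)"
      unfolding F'_def power_mult_distrib by (rule integral_mult_right)
    ultimately show ?thesis using pos by (simp add: P_def power2_eq_square field_simps)
  qed
  have eB: "integral {0..h} (\<lambda>y. (pi / (2 * (a + (b - a) * y / h)))\<^sup>2 * (f y)\<^sup>2)
      = pi\<^sup>2 / (2 * h) * ((h / (a + b))\<^sup>2 * B)"
  proof -
    have "integral {0..h} (\<lambda>y. (pi / (2 * (a + (b - a) * y / h)))\<^sup>2 * (f y)\<^sup>2)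
      = h / 2 * integral {-1..1} (\<lambda>s. (pi / (2 * (a + (b - a) * (h / 2 * s + h / 2) / h)))\<^sup>2 * (F s)\<^sup>2)"
      unfolding F_def
    proof (rule integral_rescale_interval[OF \<open>h > 0\<close>])
      have "2 * (a + (b - a) * y / h) \<noteq> 0" if "y \<in> {0..h}" for y using wpos[OF that] by simp
      then show "continuous_on {0..h} (\<lambda>y. (pi / (2 * (a + (b - a) * y / h)))\<^sup>2 * (f y)\<^sup>2)"
        by (intro continuous_intros cf) (use pos in auto)
    qed
    also have "(\<lambda>s. (pi / (2 * (a + (b - a) * (h / 2 * s + h / 2) / h)))\<^sup>2 * (F s)\<^sup>2)
      = (\<lambda>s. (pi / (a + b))\<^sup>2 * ((F s)\<^sup>2 / (1 + \<theta> * s)\<^sup>2))"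
    proof
      fix s
      have "2 * (a + (b - a) * (h / 2 * s + h / 2) / h) = (a + b) * (1 + \<theta> * s)"
        using pos by (simp add: \<theta>_def field_simps)
      then show "(pi / (2 * (a + (b - a) * (h / 2 * s + h / 2) / h)))\<^sup>2 * (F s)\<^sup>2
         = (pi / (a + b))\<^sup>2 * ((F s)\<^sup>2 / (1 + \<theta> * s)\<^sup>2)"
        by (simp add: power_divide power_mult_distrib)
    qed
    also have "integral {-1..1} \<dots> = (pi / (a + b))\<^sup>2 * B"
      unfolding B_def by (rule integral_mult_right)
    finally show ?thesis using pos by (simp add: power2_eq_square field_simps)
  qed
  have nn: "0 \<le> P" "0 \<le> B" "0 \<le> N" "0 \<le> r"
  proof -
    show "0 \<le> P" unfolding P_def
      by (intro mult_nonneg_nonneg integral_nonneg integrable_continuous_interval continuous_intros cF') auto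
    show "0 \<le> N" unfolding N_def
      by (intro integral_nonneg integrable_continuous_interval continuous_intros cF) auto
    have "1 + \<theta> * s \<noteq> 0" if "s \<in> {-1..1}" for s
    proof -
      have "\<bar>\<theta>\<bar> * \<bar>s\<bar> \<le> \<bar>\<theta>\<bar> * 1" using that by (intro mult_left_mono) auto
      then have "\<bar>\<theta> * s\<bar> < 1" using th by (simp add: abs_mult)
      then show ?thesis by auto
    qed
    then show "0 \<le> B" unfolding B_def
      by (intro integral_nonneg integrable_continuous_interval continuous_intros cF) auto
  qed (simp add: r_def)
  \<comment> \<open>After rescaling, the total energy is proportional to P + q^2 B with q = h / (a +
    b), and AM-GM bounds this by 2 q sqrt (P B) >= 2 q r N.\<close>
  define q where "q = h / (a + b)"
  have q: "q > 0" using pos by (simp add: q_def)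
  have "2 * q * (r * N) \<le> P + q\<^sup>2 * B"
  proof (rule power2_le_imp_le)
    have "(2 * q * (r * N))\<^sup>2 = 4 * q\<^sup>2 * (r * N)\<^sup>2" by (simp add: power_mult_distrib)
    also have "\<dots> \<le> 4 * q\<^sup>2 * (P * B)" using \<open>(r * N)\<^sup>2 \<le> P * B\<close> by (intro mult_left_mono) auto
    also have "\<dots> \<le> (P + q\<^sup>2 * B)\<^sup>2"
      using zero_le_power2[of "P - q\<^sup>2 * B"] by (simp add: power2_eq_square algebra_simps)
    finally show "(2 * q * (r * N))\<^sup>2 \<le> (P + q\<^sup>2 * B)\<^sup>2" .
  qed (use nn in auto)
  then have "pi\<^sup>2 / (2 * h) * (2 * q * (r * N)) \<le> pi\<^sup>2 / (2 * h) * (P + q\<^sup>2 * B)"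
    using pos by (intro mult_left_mono) auto
  moreover have "slice_const a b h * (h / 2 * N) = pi\<^sup>2 / (2 * h) * (2 * q * (r * N))"
  proof -
    define m where "m = a + b"
    have m: "m > 0" using pos by (simp add: m_def)
    have "slice_const a b h = 2 * pi\<^sup>2 / (m * h) * r"
      using False by (simp add: slice_const_def r_def \<theta>_def m_def)
    moreover have "q = h / m" by (simp add: q_def m_def)
    ultimately show ?thesis using m pos by (simp add: power2_eq_square)
  qed
  ultimately have "slice_const a b h * (h / 2 * N) \<le> pi\<^sup>2 / (2 * h) * (P + q\<^sup>2 * B)" by simp
  also have "\<dots> = pi\<^sup>2 / (2 * h) * P + pi\<^sup>2 / (2 * h) * (q\<^sup>2 * B)" by (rule distrib_left)
  finally show ?thesis unfolding eN eP eB q_def .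
qed

section \<open>Plane isometries\<close>

lemma isometry2_decompose:
  assumes "isometry2 g"
  obtains L where "orthogonal_transformation L" "g = (\<lambda>x. g 0 + L x)"
proof
  show "orthogonal_transformation (\<lambda>x. g x - g 0)"
    using assms by (simp add: orthogonal_transformation_isometry isometry2_def dist_norm)
qed simp

lemma isometry2_bij: "isometry2 g \<Longrightarrow> bij g"
proof -
  assume "isometry2 g"
  then obtain L where L: "orthogonal_transformation L" "g = (\<lambda>x. g 0 + L x)" by (rule isometry2_decompose)
  have "bij ((+) (g 0) \<circ> L)"
    by (rule bij_comp[OF orthogonal_transformation_bij[OF L(1)]]) (simp add: bij_def)
  moreover have "g = (+) (g 0) \<circ> L" using L(2) by (simp add: o_def)
  ultimately show "bij g" by simp
qed

lemma isometry2D: "isometry2 g \<Longrightarrow> dist (g x) (g y) = dist x y"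
  by (simp only: isometry2_def)

lemma isometry2I: "(\<And>x y. dist (g x) (g y) = dist x y) \<Longrightarrow> isometry2 g"
  by (simp only: isometry2_def) simp

lemma isometry2_inv:
  assumes "isometry2 g"
  shows "isometry2 (inv g)"
proof (rule isometry2I)
  fix x y
  have "surj g" using isometry2_bij[OF assms] by (rule bij_is_surj)
  then have "dist x y = dist (g (inv g x)) (g (inv g y))" by (simp only: surj_f_inv_f)
  then show "dist (inv g x) (inv g y) = dist x y" by (simp only: isometry2D[OF assms])
qed

lemma isometry2_comp:
  assumes "isometry2 f" "isometry2 g"
  shows "isometry2 (f \<circ> g)"
  by (rule isometry2I) (simp only: o_apply isometry2D[OF assms(1)] isometry2D[OF assms(2)])

lemma isometry2_continuous: "isometry2 g \<Longrightarrow> continuous_on S g"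
  unfolding continuous_on_iff by (simp only: isometry2D) blast

lemma isometry2_image_vimage: "isometry2 g \<Longrightarrow> g ` S = inv g -` S"
  by (simp add: bij_vimage_eq_inv_image isometry2_bij bij_imp_bij_inv inv_inv_eq)

text \<open>If L maps (x, y) to (p x + q y, r x + s y) with p nonzero, substitute u = p x + q y in the inner
  integral and then v = r u / p + d y in the outer one; the Jacobians p and d multiply to a determinant of modulus 1.\<close>

lemma nn_integral_orthogonal_plane:
  fixes L :: "pt \<Rightarrow> pt" and F :: "pt \<Rightarrow> ennreal"
  assumes L: "orthogonal_transformation L" and F[measurable]: "F \<in> borel_measurable borel"
  shows "(\<integral>\<^sup>+z. F (L z) \<partial>lborel) = (\<integral>\<^sup>+z. F z \<partial>lborel)"
proof -
  define p q r s where "p = fst (L (1, 0))" and "q = fst (L (0, 1))"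
    and "r = snd (L (1, 0))" and "s = snd (L (0, 1))"
  have lin: "linear L" and inner: "\<And>v w. L v \<bullet> L w = v \<bullet> w"
    using L unfolding orthogonal_transformation_def by blast+
  have Lxy: "L (x, y) = (p * x + q * y, r * x + s * y)" for x y
  proof -
    have "L (x *\<^sub>R (1, 0) + y *\<^sub>R (0, 1)) = x *\<^sub>R L (1, 0) + y *\<^sub>R L (0, 1)"
      by (simp only: linear_add[OF lin] linear_scale[OF lin])
    then show ?thesis by (simp add: p_def q_def r_def s_def prod_eq_iff)
  qed
  have e: "v \<bullet> w = fst v * fst w + snd v * snd w" for v w :: pt
    by (cases v; cases w) simp
  have rel: "p * p + r * r = 1" "q * q + s * s = 1" "p * q + r * s = 0"
  proof -
    have "p * p + r * r = L (1, 0) \<bullet> L (1, 0)" by (simp only: e p_def r_def)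
    then show "p * p + r * r = 1" by (simp only: inner) simp
    have "q * q + s * s = L (0, 1) \<bullet> L (0, 1)" by (simp only: e q_def s_def)
    then show "q * q + s * s = 1" by (simp only: inner) simp
    have "p * q + r * s = L (1, 0) \<bullet> L (0, 1)" by (simp only: e p_def q_def r_def s_def)
    then show "p * q + r * s = 0" by (simp only: inner) simp
  qed
  have mL[measurable]: "L \<in> borel_measurable borel"
    using linear_continuous_on[OF lin[unfolded linear_conv_bounded_linear]]
    by (rule borel_measurable_continuous_onI)
  have swap: "(\<integral>\<^sup>+y. \<integral>\<^sup>+x. G (x, y) \<partial>lborel \<partial>lborel) = (\<integral>\<^sup>+z. G z \<partial>lborel)"
    and dir: "(\<integral>\<^sup>+x. \<integral>\<^sup>+y. G (x, y) \<partial>lborel \<partial>lborel) = (\<integral>\<^sup>+z. G z \<partial>lborel)"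
    if [measurable]: "G \<in> borel_measurable borel" for G :: "pt \<Rightarrow> ennreal"
  proof -
    have G: "G \<in> borel_measurable (lborel \<Otimes>\<^sub>M lborel)" by (simp add: lborel_prod)
    show "(\<integral>\<^sup>+y. \<integral>\<^sup>+x. G (x, y) \<partial>lborel \<partial>lborel) = (\<integral>\<^sup>+z. G z \<partial>lborel)"
      using lborel_pair.nn_integral_snd[OF G] by (simp add: lborel_prod)
    show "(\<integral>\<^sup>+x. \<integral>\<^sup>+y. G (x, y) \<partial>lborel \<partial>lborel) = (\<integral>\<^sup>+z. G z \<partial>lborel)"
      using lborel.nn_integral_fst[OF G] by (simp add: lborel_prod)
  qed
  have m1: "(\<lambda>y. \<integral>\<^sup>+x. G (x, y) \<partial>lborel) \<in> borel_measurable lborel"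
    and m2: "(\<lambda>x. \<integral>\<^sup>+y. G (x, y) \<partial>lborel) \<in> borel_measurable lborel"
    if "G \<in> borel_measurable borel" for G :: "pt \<Rightarrow> ennreal"
  proof -
    have G: "G \<in> borel_measurable (lborel \<Otimes>\<^sub>M lborel)" using that by (simp add: lborel_prod)
    show "(\<lambda>x. \<integral>\<^sup>+y. G (x, y) \<partial>lborel) \<in> borel_measurable lborel"
      using G by (rule lborel.borel_measurable_nn_integral_fst)
    have "(\<lambda>(x, y). G (y, x)) \<in> borel_measurable (lborel \<Otimes>\<^sub>M lborel)"
      using G by (rule measurable_pair_swap)
    then show "(\<lambda>y. \<integral>\<^sup>+x. G (x, y) \<partial>lborel) \<in> borel_measurable lborel"
      using lborel.borel_measurable_nn_integral_fst by fastforce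
  qed
  have FLm: "(\<lambda>z. F (L z)) \<in> borel_measurable borel" using measurable_compose[OF mL F] .
  have FL: "(\<integral>\<^sup>+y. \<integral>\<^sup>+x. F (p * x + q * y, r * x + s * y) \<partial>lborel \<partial>lborel) = (\<integral>\<^sup>+z. F (L z) \<partial>lborel)"
    using swap[OF FLm] by (simp add: Lxy)
  show ?thesis
  proof (cases "p = 0")
    \<comment> \<open>The matrix is antidiagonal with entries of modulus 1, so each coordinate is
      substituted on its own; the exchange of coordinates is absorbed by the order of integration in
      \<open>FL\<close>.\<close>
    case True
    then have "r \<noteq> 0" using rel by auto
    then have "s = 0" using rel True by simp
    then have r1: "\<bar>r\<bar> = 1" "\<bar>q\<bar> = 1" using rel True by (auto simp: abs_square_eq_1 power2_eq_square[symmetric])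
    then have nz: "r \<noteq> 0" "q \<noteq> 0" by auto
    have "(\<integral>\<^sup>+x. F (q * y, r * x) \<partial>lborel) = (\<integral>\<^sup>+v. F (q * y, v) \<partial>lborel)" for y
      by (subst nn_integral_real_affine[of "\<lambda>v. F (q * y, v)" r 0]) (use r1 nz in auto)
    then have "(\<integral>\<^sup>+z. F (L z) \<partial>lborel) = (\<integral>\<^sup>+y. \<integral>\<^sup>+v. F (q * y, v) \<partial>lborel \<partial>lborel)"
      unfolding FL[symmetric] using True \<open>s = 0\<close> by simp
    also have "\<dots> = (\<integral>\<^sup>+u. \<integral>\<^sup>+v. F (u, v) \<partial>lborel \<partial>lborel)"
      by (subst nn_integral_real_affine[of "\<lambda>u. \<integral>\<^sup>+v. F (u, v) \<partial>lborel" q 0]) (use r1 nz in auto)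
    also have "\<dots> = (\<integral>\<^sup>+z. F z \<partial>lborel)" by (rule dir[OF F])
    finally show ?thesis .
  next
    case False
    define d where "d = (p * s - q * r) / p"
    \<comment> \<open>Lagrange's identity: orthonormal columns force the determinant to be 1 or
      -1.\<close>
    have "(p * s - q * r)\<^sup>2 = (p * p + r * r) * (q * q + s * s) - (p * q + r * s)\<^sup>2"
      by (simp add: power2_eq_square algebra_simps)
    then have "\<bar>p * s - q * r\<bar> = 1" unfolding rel by (simp add: abs_square_eq_1)
    then have pd: "\<bar>p\<bar> * \<bar>d\<bar> = 1" "d \<noteq> 0" using False by (auto simp: d_def abs_mult[symmetric])
    let ?H = "\<lambda>z. F (fst z, r / p * fst z + d * snd z)"
    have Hm: "?H \<in> borel_measurable borel"
    proof -
      have "(\<lambda>z::pt. (fst z, r / p * fst z + d * snd z)) \<in> borel_measurable borel"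
        by (intro borel_measurable_continuous_onI continuous_intros)
      from measurable_compose[OF this F] show ?thesis .
    qed
    have in1: "ennreal \<bar>p\<bar> * (\<integral>\<^sup>+x. F (p * x + q * y, r * x + s * y) \<partial>lborel) = (\<integral>\<^sup>+u. ?H (u, y) \<partial>lborel)" for y
    proof -
      have m: "(\<lambda>u. ?H (u, y)) \<in> borel_measurable borel"
        by (rule measurable_compose[OF _ Hm]) (intro borel_measurable_continuous_onI continuous_intros)
      have "r / p * (q * y + p * x) + d * y = r * x + s * y" for x
        using False by (simp add: d_def field_simps)
      then show ?thesis
        by (subst nn_integral_real_affine[OF m False, of "q * y"]) (simp add: add.commute)
    qed
    have in2: "ennreal \<bar>d\<bar> * (\<integral>\<^sup>+y. ?H (u, y) \<partial>lborel) = (\<integral>\<^sup>+v. F (u, v) \<partial>lborel)" for u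
    proof -
      have "(\<lambda>v. F (u, v)) \<in> borel_measurable borel"
        by (rule measurable_compose[OF _ F]) (intro borel_measurable_continuous_onI continuous_intros)
      from nn_integral_real_affine[OF this pd(2), of "r / p * u"] show ?thesis by simp
    qed
    have "ennreal \<bar>p\<bar> * (\<integral>\<^sup>+z. F (L z) \<partial>lborel) = (\<integral>\<^sup>+y. \<integral>\<^sup>+u. ?H (u, y) \<partial>lborel \<partial>lborel)"
    proof -
      have "(\<lambda>y. \<integral>\<^sup>+x. F (p * x + q * y, r * x + s * y) \<partial>lborel) \<in> borel_measurable lborel"
        using m1[OF FLm] by (simp only: Lxy)
      then have "ennreal \<bar>p\<bar> * (\<integral>\<^sup>+y. \<integral>\<^sup>+x. F (p * x + q * y, r * x + s * y) \<partial>lborel \<partial>lborel)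
        = (\<integral>\<^sup>+y. ennreal \<bar>p\<bar> * (\<integral>\<^sup>+x. F (p * x + q * y, r * x + s * y) \<partial>lborel) \<partial>lborel)"
        by (rule nn_integral_cmult[symmetric])
      then show ?thesis by (simp only: in1 FL)
    qed
    also have "\<dots> = (\<integral>\<^sup>+u. \<integral>\<^sup>+y. ?H (u, y) \<partial>lborel \<partial>lborel)"
      by (simp only: swap[OF Hm] dir[OF Hm])
    finally have *: "ennreal \<bar>p\<bar> * (\<integral>\<^sup>+z. F (L z) \<partial>lborel) = (\<integral>\<^sup>+u. \<integral>\<^sup>+y. ?H (u, y) \<partial>lborel \<partial>lborel)" .
    have "ennreal \<bar>d\<bar> * (ennreal \<bar>p\<bar> * (\<integral>\<^sup>+z. F (L z) \<partial>lborel))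
      = (\<integral>\<^sup>+u. \<integral>\<^sup>+v. F (u, v) \<partial>lborel \<partial>lborel)"
    proof -
      have "(\<lambda>u. \<integral>\<^sup>+y. ?H (u, y) \<partial>lborel) \<in> borel_measurable lborel" by (rule m2[OF Hm])
      then have "ennreal \<bar>d\<bar> * (\<integral>\<^sup>+u. \<integral>\<^sup>+y. ?H (u, y) \<partial>lborel \<partial>lborel)
          = (\<integral>\<^sup>+u. ennreal \<bar>d\<bar> * (\<integral>\<^sup>+y. ?H (u, y) \<partial>lborel) \<partial>lborel)"
        by (rule nn_integral_cmult[symmetric])
      then show ?thesis
        by (simp only: in2 *)
    qed
    also have "\<dots> = (\<integral>\<^sup>+z. F z \<partial>lborel)" by (rule dir[OF F])
    finally show ?thesis
      using pd by (simp add: mult.assoc[symmetric] ennreal_mult[symmetric] mult.commute)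
  qed
qed

lemma distr_isometry2:
  assumes "isometry2 g"
  shows "distr lborel borel g = lborel"
proof -
  obtain L where L: "orthogonal_transformation L" "g = (\<lambda>x. g 0 + L x)"
    using assms by (rule isometry2_decompose)
  have mL[measurable]: "L \<in> borel_measurable borel"
    using L(1) linear_continuous_on linear_conv_bounded_linear orthogonal_transformation_linear
    by (intro borel_measurable_continuous_onI) blast
  have "distr lborel borel L = lborel"
  proof (rule measure_eqI)
    fix A assume "A \<in> sets (distr lborel borel L)"
    then have A[measurable]: "A \<in> sets borel" by simp
    have "emeasure (distr lborel borel L) A = (\<integral>\<^sup>+z. indicator A (L z) \<partial>lborel)"
      by (subst nn_integral_distr[of L lborel borel "indicator A", symmetric]) auto
    also have "\<dots> = (\<integral>\<^sup>+z. indicator A z \<partial>lborel)"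
      by (rule nn_integral_orthogonal_plane[OF L(1)]) measurable
    finally show "emeasure (distr lborel borel L) A = emeasure lborel A" by simp
  qed simp
  then have "lborel = distr (distr lborel borel L) borel ((+) (g 0))"
    by (simp add: lborel_distr_plus)
  also have "\<dots> = distr lborel borel ((+) (g 0) \<circ> L)"
    by (rule distr_distr) auto
  also have "(+) (g 0) \<circ> L = g" by (subst (2) L(2)) (simp add: o_def)
  finally show ?thesis by simp
qed

text \<open>Carries integrals over the placed trapezoid back to the standard position and from
  \<open>lebesgue\<close> to \<open>lborel\<close>, where Fubini is available. The integrand is
  Borel, which holds for the C1 approximants and test functions to which this is applied.\<close>

lemma set_integral_isometry2:
  fixes q :: "pt \<Rightarrow> real"
  assumes g: "isometry2 g" and S: "S \<in> sets borel" and q[measurable]: "q \<in> borel_measurable borel"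
  shows "(LINT x:(g ` S)|lebesgue. q x) = (LINT x|lborel. indicator S x * q (g x))"
proof -
  have gm[measurable]: "g \<in> borel_measurable borel" "inv g \<in> borel_measurable borel"
    using g isometry2_inv by (auto intro: borel_measurable_continuous_onI isometry2_continuous)
  have gS[measurable]: "g ` S \<in> sets borel"
    unfolding isometry2_image_vimage[OF g] using measurable_sets[OF gm(2) S] by simp
  have "(LINT x:(g ` S)|lebesgue. q x) = (LINT x|lborel. indicator (g ` S) x * q x)"
    unfolding set_lebesgue_integral_def by (simp add: integral_completion)
  also have "\<dots> = (LINT x|distr lborel borel g. indicator (g ` S) x * q x)"
    by (simp add: distr_isometry2[OF g])
  also have "\<dots> = (LINT x|lborel. indicator (g ` S) (g x) * q (g x))"
    by (rule integral_distr) measurable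
  also have "(\<lambda>x. indicator (g ` S) (g x) * q (g x)) = (\<lambda>x. indicator S x * q (g x))"
    using isometry2_bij[OF g] by (auto simp: indicator_def bij_def inj_image_mem_iff)
  finally show ?thesis .
qed

section \<open>Slicing the trapezoid\<close>

definition trap_width :: "real \<Rightarrow> real \<Rightarrow> real \<Rightarrow> real \<Rightarrow> real" where
  "trap_width a b h y = a + (b - a) * y / h"

definition closed_trap :: "real \<Rightarrow> real \<Rightarrow> real \<Rightarrow> pt set" where
  "closed_trap a b h = {z. 0 \<le> snd z \<and> snd z \<le> h \<and> 0 \<le> fst z \<and> fst z \<le> trap_width a b h (snd z)}"

text \<open>Only the Dirichlet part of the boundary; the Neumann side on the axis x = 0 is left
  out.\<close>

definition trap_bdry :: "real \<Rightarrow> real \<Rightarrow> real \<Rightarrow> pt set" where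
  "trap_bdry a b h = trap_l1 a b h \<union> trap_l2 a b h \<union> trap_w1 a b h"

lemma trap_width_pos:
  assumes "a > 0" "b > 0" "h > 0" "0 \<le> y" "y \<le> h"
  shows "trap_width a b h y > 0"
proof -
  have "trap_width a b h y = (a * (h - y) + b * y) / h"
    using assms by (simp add: trap_width_def field_simps)
  moreover have "0 < a * (h - y) + b * y"
    using assms by (cases "y = 0") (auto intro!: add_nonneg_pos mult_nonneg_nonneg)
  ultimately show ?thesis using assms by simp
qed

lemma closed_trap_halfspaces:
  assumes "h > 0"
  shows "closed_trap a b h = {z. (0, -1) \<bullet> z \<le> 0} \<inter> {z. (0, 1) \<bullet> z \<le> h} \<inter> {z. (-1, 0) \<bullet> z \<le> 0}
    \<inter> {z. (1, (a - b) / h) \<bullet> z \<le> a}"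
proof -
  have "fst z \<le> trap_width a b h (snd z) \<longleftrightarrow> (1, (a - b) / h) \<bullet> z \<le> a" for z
    using assms by (cases z) (simp add: trap_width_def field_simps)
  then show ?thesis by (auto simp: closed_trap_def)
qed

lemma convex_hull_trap:
  assumes pos: "a > 0" "b > 0" "h > 0"
  shows "convex hull {(0, 0), (a, 0), (b, h), (0, h)} = closed_trap a b h"
proof
  show "convex hull {(0, 0), (a, 0), (b, h), (0, h)} \<subseteq> closed_trap a b h"
  proof (rule hull_minimal)
    show "convex (closed_trap a b h)"
      unfolding closed_trap_halfspaces[OF pos(3)] by (intro convex_Int convex_halfspace_le)
    show "{(0, 0), (a, 0), (b, h), (0, h)} \<subseteq> closed_trap a b h"
      using pos by (auto simp: closed_trap_def trap_width_def)
  qed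
  show "closed_trap a b h \<subseteq> convex hull {(0, 0), (a, 0), (b, h), (0, h)}" (is "_ \<subseteq> ?H")
  proof
    fix z assume z: "z \<in> closed_trap a b h"
    \<comment> \<open>\<open>s\<close> is the relative height and \<open>r\<close> the relative
      position within the horizontal slice: z is reached by interpolating with \<open>r\<close>
      along both parallel sides and then with \<open>s\<close> between the two points.\<close>
    define s r where "s = snd z / h" and "r = fst z / trap_width a b h (snd z)"
    have W: "trap_width a b h (snd z) > 0" using z pos by (intro trap_width_pos) (auto simp: closed_trap_def)
    have sr: "0 \<le> s" "s \<le> 1" "0 \<le> r" "r \<le> 1"
      using z pos W by (auto simp: s_def r_def closed_trap_def)
    have c: "(1 - u) *\<^sub>R p + u *\<^sub>R q \<in> ?H" if "p \<in> ?H" "q \<in> ?H" "0 \<le> u" "u \<le> 1" for p q u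
      using convex_convex_hull[of "{(0, 0), (a, 0), (b, h), (0, h)}"] that by (auto intro: convexD_alt)
    have "(1 - r) *\<^sub>R (0, 0) + r *\<^sub>R (a, 0) \<in> ?H" "(1 - r) *\<^sub>R (0, h) + r *\<^sub>R (b, h) \<in> ?H"
      by (rule c; use sr in \<open>auto intro: hull_inc\<close>)+
    moreover have "(1 - r) *\<^sub>R (0, 0) + r *\<^sub>R (a, 0) = (r * a, 0 :: real)" "(1 - r) *\<^sub>R (0, h) + r *\<^sub>R (b, h) = (r * b, h)"
      by (simp_all add: algebra_simps)
    ultimately have "(1 - s) *\<^sub>R (r * a, 0) + s *\<^sub>R (r * b, h) \<in> ?H"
      using sr by (intro c) (simp_all only:)
    moreover have "(1 - s) * (r * a) + s * (r * b) = fst z"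
    proof -
      have "(1 - s) * (r * a) + s * (r * b) = r * trap_width a b h (snd z)"
        by (simp add: s_def trap_width_def diff_divide_distrib algebra_simps)
      then show ?thesis using W by (simp add: r_def)
    qed
    moreover have "s * h = snd z" using pos by (simp add: s_def)
    ultimately show "z \<in> ?H" by (cases z) simp
  qed
qed

lemma trap_dom_eq:
  assumes pos: "a > 0" "b > 0" "h > 0"
  shows "trap_dom a b h = {z. 0 < snd z \<and> snd z < h \<and> 0 < fst z \<and> fst z < trap_width a b h (snd z)}"
proof -
  have "fst z < trap_width a b h (snd z) \<longleftrightarrow> (1, (a - b) / h) \<bullet> z < a" for z
    using pos by (cases z) (simp add: trap_width_def field_simps)
  moreover have "trap_dom a b h = {z. (0, -1) \<bullet> z < 0} \<inter> {z. (0, 1) \<bullet> z < h} \<inter> {z. (-1, 0) \<bullet> z < 0}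
    \<inter> {z. (1, (a - b) / h) \<bullet> z < a}"
    unfolding trap_dom_def convex_hull_trap[OF pos] closed_trap_halfspaces[OF pos(3)]
    by (simp add: interior_halfspace_le zero_prod_def)
  ultimately show ?thesis by auto
qed

lemma open_trap_dom: "open (trap_dom a b h)"
  by (simp add: trap_dom_def)

lemma trap_dom_subset_closed:
  assumes "a > 0" "b > 0" "h > 0"
  shows "trap_dom a b h \<subseteq> closed_trap a b h"
  unfolding trap_dom_eq[OF assms] closed_trap_def by auto

lemma compact_closed_trap:
  assumes "a > 0" "b > 0" "h > 0"
  shows "compact (closed_trap a b h)"
  unfolding convex_hull_trap[OF assms, symmetric] by (intro finite_imp_compact_convex_hull) simp

text \<open>A vertical line with x > 0 can leave the trapezoid only through Dirichlet sides. This is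
  what makes extension by zero along such lines smooth.\<close>

lemma closed_trap_boundary:
  assumes pos: "a > 0" "b > 0" "h > 0"
    and z: "z \<in> closed_trap a b h" "z \<notin> trap_dom a b h" "fst z > 0"
  shows "z \<in> trap_bdry a b h"
proof -
  obtain x y where zxy: "z = (x, y)" by (cases z)
  have xy: "0 \<le> y" "y \<le> h" "0 < x" "x \<le> trap_width a b h y"
    using z zxy by (auto simp: closed_trap_def)
  consider "y = 0" | "y = h" | "x = trap_width a b h y"
    using z xy unfolding trap_dom_eq[OF pos] zxy by force
  then show ?thesis
  proof cases
    case 1
    then have "z \<in> trap_l1 a b h"
      unfolding trap_l1_def in_segment zxy using xy pos
      by (intro exI[of _ "x / a"] conjI) (auto simp: trap_width_def)
    then show ?thesis by (simp add: trap_bdry_def)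
  next
    case 2
    then have "z \<in> trap_l2 a b h"
      unfolding trap_l2_def in_segment zxy using xy pos
      by (intro exI[of _ "x / b"] conjI) (auto simp: trap_width_def divide_simps algebra_simps)
    then show ?thesis by (simp add: trap_bdry_def)
  next
    case 3
    then have "z \<in> trap_w1 a b h"
      unfolding trap_w1_def in_segment zxy using xy pos
      by (intro exI[of _ "y / h"] conjI) (auto simp: trap_width_def field_simps)
    then show ?thesis by (simp add: trap_bdry_def)
  qed
qed

lemma integrable_trap_dom:
  fixes q :: "pt \<Rightarrow> real"
  assumes pos: "a > 0" "b > 0" "h > 0" and q: "continuous_on (closed_trap a b h) q"
  shows "integrable lborel (\<lambda>z. indicator (trap_dom a b h) z * q z)"
proof -
  have "integrable lborel (\<lambda>z. indicator (trap_dom a b h) z *\<^sub>R (indicator (closed_trap a b h) z *\<^sub>R q z))"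
    by (intro integrable_mult_indicator borel_integrable_compact compact_closed_trap pos q)
      (simp add: open_trap_dom)
  also have "(\<lambda>z. indicator (trap_dom a b h) z *\<^sub>R (indicator (closed_trap a b h) z *\<^sub>R q z))
      = (\<lambda>z. indicator (trap_dom a b h) z * q z)"
  proof
    fix z show "indicator (trap_dom a b h) z *\<^sub>R (indicator (closed_trap a b h) z *\<^sub>R q z)
        = indicator (trap_dom a b h) z * q z"
      using trap_dom_subset_closed[OF pos] by (cases "z \<in> trap_dom a b h") auto
  qed
  finally show ?thesis .
qed

lemma integral_horizontal_slices:
  fixes H :: "pt \<Rightarrow> real"
  assumes "integrable lborel H"
  shows "integrable lborel (\<lambda>y. LINT x|lborel. H (x, y))"
    and "(LINT y|lborel. LINT x|lborel. H (x, y)) = (LINT z|lborel. H z)"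
proof -
  have H: "integrable (lborel \<Otimes>\<^sub>M lborel) (\<lambda>(x, y). H (x, y))" using assms by (simp add: lborel_prod)
  show "integrable lborel (\<lambda>y. LINT x|lborel. H (x, y))"
    using lborel_pair.integrable_snd[OF H] .
  show "(LINT y|lborel. LINT x|lborel. H (x, y)) = (LINT z|lborel. H z)"
    using lborel_pair.integral_snd[OF H] by (simp add: lborel_prod)
qed

lemma integral_vertical_slices:
  fixes H :: "pt \<Rightarrow> real"
  assumes "integrable lborel H"
  shows "integrable lborel (\<lambda>x. LINT y|lborel. H (x, y))"
    and "(LINT x|lborel. LINT y|lborel. H (x, y)) = (LINT z|lborel. H z)"
proof -
  have H: "integrable (lborel \<Otimes>\<^sub>M lborel) (\<lambda>(x, y). H (x, y))" using assms by (simp add: lborel_prod)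
  show "integrable lborel (\<lambda>x. LINT y|lborel. H (x, y))"
    using lborel_pair.integrable_fst[OF H] .
  show "(LINT x|lborel. LINT y|lborel. H (x, y)) = (LINT z|lborel. H z)"
    using lborel_pair.integral_fst[OF H] by (simp add: lborel_prod)
qed

lemma integral_mono_horizontal_slices:
  fixes F G :: "pt \<Rightarrow> real"
  assumes F: "integrable lborel F" and G: "integrable lborel G"
    and le: "\<And>y. (LINT x|lborel. F (x, y)) \<le> (LINT x|lborel. G (x, y))"
  shows "(LINT z|lborel. F z) \<le> (LINT z|lborel. G z)"
  unfolding integral_horizontal_slices(2)[OF F, symmetric] integral_horizontal_slices(2)[OF G, symmetric]
  by (intro integral_mono integral_horizontal_slices(1) F G le)

lemma integral_mono_vertical_slices:
  fixes F G :: "pt \<Rightarrow> real"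
  assumes F: "integrable lborel F" and G: "integrable lborel G"
    and le: "\<And>x. (LINT y|lborel. F (x, y)) \<le> (LINT y|lborel. G (x, y))"
  shows "(LINT z|lborel. F z) \<le> (LINT z|lborel. G z)"
  unfolding integral_vertical_slices(2)[OF F, symmetric] integral_vertical_slices(2)[OF G, symmetric]
  by (intro integral_mono integral_vertical_slices(1) F G le)

lemma lborel_integral_eq_interval:
  fixes k :: "real \<Rightarrow> real"
  assumes k: "continuous_on {c..d} k" and z: "\<And>y. y \<notin> {c<..<d} \<Longrightarrow> k' y = 0" "\<And>y. y \<in> {c<..<d} \<Longrightarrow> k' y = k y"
  shows "(LINT y|lborel. k' y) = integral {c..d} k"
proof -
  have i: "set_integrable lborel {c<..<d} k"
    by (rule set_integrable_subset[OF borel_integrable_atLeastAtMost'[OF k]]) auto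
  have "k' = (\<lambda>y. indicator {c<..<d} y *\<^sub>R k y)"
    using z by (auto simp: indicator_def fun_eq_iff)
  then have "(LINT y|lborel. k' y) = (LINT y:{c<..<d}|lborel. k y)"
    by (simp add: set_lebesgue_integral_def)
  also have "\<dots> = integral {c<..<d} k" by (rule set_borel_integral_eq_integral[OF i])
  also have "\<dots> = integral {c..d} k" by (simp add: integral_open_interval_real)
  finally show ?thesis .
qed

lemma horizontal_slice_integral:
  fixes q :: "pt \<Rightarrow> real"
  assumes pos: "a > 0" "b > 0" "h > 0" and y: "0 < y" "y < h"
    and q: "continuous_on {0..trap_width a b h y} (\<lambda>x. q (x, y))"
  shows "(LINT x|lborel. indicator (trap_dom a b h) (x, y) * q (x, y))
    = integral {0..trap_width a b h y} (\<lambda>x. q (x, y))"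
  by (rule lborel_integral_eq_interval[OF q]) (use y in \<open>auto simp: trap_dom_eq[OF pos]\<close>)

section \<open>The energy bound for C1 functions in standard position\<close>

lemma C1_grad_partial:
  assumes "C1_grad phi dphi"
  shows "((\<lambda>x. phi (x, y)) has_real_derivative fst (dphi (x, y))) (at x within S)"
    and "((\<lambda>y. phi (x, y)) has_real_derivative snd (dphi (x, y))) (at y within S)"
proof -
  have d: "(phi has_derivative (\<lambda>v. dphi z \<bullet> v)) (at z)" for z using assms unfolding C1_grad_def by blast
  have "((\<lambda>x. phi (x, y)) has_derivative (\<lambda>t. dphi (x, y) \<bullet> (t, 0))) (at x within S)"
    by (rule has_derivative_compose[OF _ d]) (auto intro!: derivative_eq_intros)
  then show "((\<lambda>x. phi (x, y)) has_real_derivative fst (dphi (x, y))) (at x within S)"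
    by (simp add: has_field_derivative_def inner_prod_def)
  have "((\<lambda>y. phi (x, y)) has_derivative (\<lambda>t. dphi (x, y) \<bullet> (0, t))) (at y within S)"
    by (rule has_derivative_compose[OF _ d]) (auto intro!: derivative_eq_intros)
  then show "((\<lambda>y. phi (x, y)) has_real_derivative snd (dphi (x, y))) (at y within S)"
    by (simp add: has_field_derivative_def inner_prod_def)
qed

lemma C1_grad_continuous:
  assumes "C1_grad phi dphi"
  shows "continuous_on S phi" "continuous_on S dphi"
proof -
  show "continuous_on S phi"
    using assms unfolding C1_grad_def
    by (intro has_derivative_continuous_on[where f' = "\<lambda>z v. dphi z \<bullet> v"]) (auto intro: has_derivative_at_withinI)
  show "continuous_on S dphi"
    using assms continuous_on_subset unfolding C1_grad_def by blast
qed

lemma C1_grad_zero_on_open: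
  assumes "C1_grad phi dphi" "open U" "z \<in> U" "\<And>x. x \<in> U \<Longrightarrow> phi x = 0"
  shows "dphi z = 0"
proof -
  have "(phi has_derivative (\<lambda>v. dphi z \<bullet> v)) (at z)" using assms unfolding C1_grad_def by blast
  moreover have "(phi has_derivative (\<lambda>v. 0)) (at z)"
    by (rule has_derivative_transform_within_open[OF has_derivative_const assms(2,3)]) (use assms(4) in auto)
  ultimately have "(\<lambda>v. dphi z \<bullet> v) = (\<lambda>v. 0)" by (rule has_derivative_unique)
  then have "dphi z \<bullet> dphi z = 0" by metis
  then show ?thesis by simp
qed

theorem dirichlet_energy_bound:
  assumes pos: "a > 0" "b > 0" "h > 0"
    and phi: "C1_grad phi dphi"
    and U: "open U" "trap_bdry a b h \<subseteq> U" "\<And>x. x \<in> U \<Longrightarrow> phi x = 0"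
  shows "slice_const a b h * (LINT z|lborel. indicator (trap_dom a b h) z * (phi z)\<^sup>2)
    \<le> (LINT z|lborel. indicator (trap_dom a b h) z * (norm (dphi z))\<^sup>2)"
proof -
  let ?i = "\<lambda>z. indicator (trap_dom a b h) z :: real"
  define w where "w = trap_width a b h"
  define V where "V = (\<lambda>z::pt. (pi / (2 * w (snd z)))\<^sup>2)"
  note dom = trap_dom_eq[OF pos]
  have wpos: "w y > 0" if "0 \<le> y" "y \<le> h" for y
    unfolding w_def by (rule trap_width_pos[OF pos that])
  have cV: "continuous_on (closed_trap a b h) V"
  proof -
    have "2 * w (snd z) \<noteq> 0" if "z \<in> closed_trap a b h" for z
      using that wpos[of "snd z"] by (auto simp: closed_trap_def)
    moreover have "continuous_on (closed_trap a b h) (\<lambda>z. w (snd z))"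
      unfolding w_def trap_width_def by (intro continuous_intros) (use pos in auto)
    ultimately show ?thesis unfolding V_def by (intro continuous_intros) auto
  qed
  note cphi = C1_grad_continuous[OF phi]
  have int: "integrable lborel (\<lambda>z. ?i z * (phi z)\<^sup>2)" "integrable lborel (\<lambda>z. ?i z * (V z * (phi z)\<^sup>2))"
    "integrable lborel (\<lambda>z. ?i z * (fst (dphi z))\<^sup>2)" "integrable lborel (\<lambda>z. ?i z * (snd (dphi z))\<^sup>2)"
    by (intro integrable_trap_dom pos continuous_intros cphi cV)+
  have horizontal: "(LINT z|lborel. ?i z * (V z * (phi z)\<^sup>2)) \<le> (LINT z|lborel. ?i z * (fst (dphi z))\<^sup>2)"
  proof (rule integral_mono_horizontal_slices[OF int(2,3)])
    fix y
    show "(LINT x|lborel. ?i (x, y) * (V (x, y) * (phi (x, y))\<^sup>2))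
        \<le> (LINT x|lborel. ?i (x, y) * (fst (dphi (x, y)))\<^sup>2)"
    proof (cases "0 < y \<and> y < h")
      case True
      then have y: "0 < y" "y < h" by auto
      then have wy: "w y > 0" by (intro wpos) auto
      have "(w y, y) \<in> trap_w1 a b h"
        unfolding trap_w1_def in_segment w_def trap_width_def using y pos
        by (intro exI[of _ "y / h"] conjI) (auto simp: field_simps)
      then have bd: "phi (w y, y) = 0" using U by (auto simp: trap_bdry_def)
      have c: "continuous_on S (\<lambda>x. phi (x, y))" "continuous_on S (\<lambda>x. dphi (x, y))" for S
        by (rule continuous_on_compose2[OF cphi(1)[of UNIV]] continuous_on_compose2[OF cphi(2)[of UNIV]];
            auto intro!: continuous_intros)+
      have "(LINT x|lborel. ?i (x, y) * (V (x, y) * (phi (x, y))\<^sup>2))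
          = integral {0..w y} (\<lambda>x. V (x, y) * (phi (x, y))\<^sup>2)"
        unfolding w_def by (rule horizontal_slice_integral[OF pos y]) (simp add: V_def, intro continuous_intros c)
      also have "\<dots> = (pi / (2 * w y))\<^sup>2 * integral {0..w y} (\<lambda>x. (phi (x, y))\<^sup>2)"
        by (simp add: V_def)
      \<comment> \<open>The slice runs from the Neumann end x = 0 to the slant side, where phi
        vanishes, so the mixed constant applies.\<close>
      also have "\<dots> \<le> integral {0..w y} (\<lambda>x. (fst (dphi (x, y)))\<^sup>2)"
        by (rule wirtinger_mixed[OF wy C1_grad_partial(1)[OF phi] _ bd]) (intro continuous_intros c)
      also have "\<dots> = (LINT x|lborel. ?i (x, y) * (fst (dphi (x, y)))\<^sup>2)"
        unfolding w_def by (rule horizontal_slice_integral[OF pos y, symmetric]) (intro continuous_intros c)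
      finally show ?thesis .
    next
      case False
      then have "?i (x, y) = 0" for x by (auto simp: dom)
      then show ?thesis by simp
    qed
  qed
  have "(LINT z|lborel. slice_const a b h * (?i z * (phi z)\<^sup>2))
      \<le> (LINT z|lborel. ?i z * (snd (dphi z))\<^sup>2 + ?i z * (V z * (phi z)\<^sup>2))"
  proof (rule integral_mono_vertical_slices)
    show "integrable lborel (\<lambda>z. slice_const a b h * (?i z * (phi z)\<^sup>2))"
      "integrable lborel (\<lambda>z. ?i z * (snd (dphi z))\<^sup>2 + ?i z * (V z * (phi z)\<^sup>2))"
      using int by auto
    fix x
    show "(LINT y|lborel. slice_const a b h * (?i (x, y) * (phi (x, y))\<^sup>2))
      \<le> (LINT y|lborel. ?i (x, y) * (snd (dphi (x, y)))\<^sup>2 + ?i (x, y) * (V (x, y) * (phi (x, y))\<^sup>2))"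
    proof (cases "x > 0")
      case False
      then have "?i (x, y) = 0" for y by (auto simp: dom)
      then show ?thesis by simp
    next
      case True
      define f f' where "f = (\<lambda>y. ?i (x, y) * phi (x, y))" and "f' = (\<lambda>y. ?i (x, y) * snd (dphi (x, y)))"
      \<comment> \<open>A vertical line may leave through the slant side at a height strictly
        between 0 and h, but the one-dimensional estimate needs a C1 function on all of [0, h]. The
        open sets \<open>D\<close>, where \<open>f\<close> agrees with phi, and \<open>E\<close>,
        where \<open>f\<close> vanishes identically, cover the line, so regularity of the zero
        extension is a local matter.\<close>
      define D where "D = {y. (x, y) \<in> trap_dom a b h}"
      define E where "E = {y. (x, y) \<in> U \<union> - closed_trap a b h}"
      have cx: "continuous_on UNIV (\<lambda>y. (x, y))" by (intro continuous_intros)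
      have oD: "open D" using open_vimage[OF open_trap_dom cx] by (simp add: D_def vimage_def)
      have "closed (closed_trap a b h)" using compact_closed_trap[OF pos] by (rule compact_imp_closed)
      then have oE: "open E"
        using open_vimage[OF _ cx, of "U \<union> - closed_trap a b h"] U by (simp add: E_def vimage_def open_Un open_Compl)
      have DE: "y \<in> D \<or> y \<in> E" for y
        using closed_trap_boundary[OF pos, of "(x, y)"] True U by (auto simp: D_def E_def)
      have fD: "f y = phi (x, y)" "f' y = snd (dphi (x, y))" if "y \<in> D" for y
        using that by (auto simp: f_def f'_def D_def)
      have fE: "f y = 0" "f' y = 0" if y: "y \<in> E" for y
      proof -
        consider "(x, y) \<in> U" | "(x, y) \<notin> closed_trap a b h" using y by (auto simp: E_def)
        then have "f y = 0 \<and> f' y = 0"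
        proof cases
          case 1
          then show ?thesis using U(3) C1_grad_zero_on_open[OF phi U(1) 1 U(3)] by (simp add: f_def f'_def)
        next
          case 2
          then have "(x, y) \<notin> trap_dom a b h" using trap_dom_subset_closed[OF pos] by blast
          then show ?thesis by (simp add: f_def f'_def)
        qed
        then show "f y = 0" "f' y = 0" by auto
      qed
      have c: "continuous_on S (\<lambda>y. phi (x, y))" "continuous_on S (\<lambda>y. dphi (x, y))" for S
        by (rule continuous_on_compose2[OF cphi(1)[of UNIV]] continuous_on_compose2[OF cphi(2)[of UNIV]];
            auto intro!: continuous_intros)+
      have df: "(f has_real_derivative f' y) (at y)" for y
        using DE[of y]
      proof
        assume y: "y \<in> D"
        show ?thesis
          by (rule has_field_derivative_transform_within_open[OF _ oD y, of "\<lambda>y. phi (x, y)"])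
            (use fD y C1_grad_partial(2)[OF phi] in auto)
      next
        assume y: "y \<in> E"
        show ?thesis
          by (rule has_field_derivative_transform_within_open[OF _ oE y, of "\<lambda>y. 0"]) (use fE y in auto)
      qed
      have "continuous_on (D \<union> E) f'"
      proof (rule continuous_on_open_Un[OF oD oE])
        have "continuous_on D (\<lambda>y. snd (dphi (x, y)))" by (intro continuous_intros c)
        then show "continuous_on D f'" using fD(2) by (simp cong: continuous_on_cong)
        have "continuous_on E (\<lambda>y. 0 :: real)" by simp
        then show "continuous_on E f'" using fE(2) by (simp cong: continuous_on_cong)
      qed
      moreover have "D \<union> E = UNIV" using DE by auto
      ultimately have cf': "continuous_on S f'" for S using continuous_on_subset by (metis subset_UNIV)
      have cf: "continuous_on S f" for S
        using df DERIV_isCont continuous_at_imp_continuous_on by blast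
      have out: "?i (x, y) = 0" if "y \<notin> {0<..<h}" for y using that by (auto simp: dom)
      have i1: "(?i z)\<^sup>2 = ?i z" for z by (auto simp: indicator_def)
      have i2: "?i z * t\<^sup>2 = (?i z * t)\<^sup>2" for z t by (auto simp: indicator_def)
      have cw: "continuous_on {0..h} (\<lambda>y. (pi / (2 * w y))\<^sup>2)"
      proof -
        have "2 * w y \<noteq> 0" if "y \<in> {0..h}" for y using that wpos[of y] by auto
        moreover have "continuous_on {0..h} w"
          unfolding w_def trap_width_def[abs_def] by (intro continuous_intros) (use pos in auto)
        ultimately show ?thesis by (intro continuous_intros) auto
      qed
      have "(LINT y|lborel. slice_const a b h * (?i (x, y) * (phi (x, y))\<^sup>2))
          = integral {0..h} (\<lambda>y. slice_const a b h * (f y)\<^sup>2)"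
        by (rule lborel_integral_eq_interval)
          (intro continuous_on_mult continuous_on_const continuous_on_power cf, auto simp: out i2 f_def)
      also have "\<dots> = slice_const a b h * integral {0..h} (\<lambda>y. (f y)\<^sup>2)" by simp
      also have "\<dots> \<le> integral {0..h} (\<lambda>y. (f' y)\<^sup>2)
          + integral {0..h} (\<lambda>y. (pi / (2 * w y))\<^sup>2 * (f y)\<^sup>2)"
        unfolding w_def trap_width_def
        by (rule slice_energy[OF pos])
          (use df cf' out in \<open>auto simp: f_def intro: has_field_derivative_at_within\<close>)
      also have "\<dots> = integral {0..h} (\<lambda>y. (f' y)\<^sup>2 + (pi / (2 * w y))\<^sup>2 * (f y)\<^sup>2)"
        by (rule integral_add[symmetric]; intro integrable_continuous_interval continuous_on_mult
            continuous_on_power cf cf' cw)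
      also have "\<dots> = (LINT y|lborel. ?i (x, y) * (snd (dphi (x, y)))\<^sup>2 + ?i (x, y) * (V (x, y) * (phi (x, y))\<^sup>2))"
        by (rule lborel_integral_eq_interval[symmetric])
          (intro continuous_on_add continuous_on_mult[OF cw] continuous_on_power cf cf',
            auto simp: out f_def f'_def V_def i1 power_mult_distrib mult_ac)
      finally show ?thesis .
    qed
  qed
  also have "\<dots> = (LINT z|lborel. ?i z * (snd (dphi z))\<^sup>2) + (LINT z|lborel. ?i z * (V z * (phi z)\<^sup>2))"
    by (rule Bochner_Integration.integral_add[OF int(4,2)])
  also have "\<dots> \<le> (LINT z|lborel. ?i z * (snd (dphi z))\<^sup>2) + (LINT z|lborel. ?i z * (fst (dphi z))\<^sup>2)"
    using horizontal by simp
  also have "\<dots> = (LINT z|lborel. ?i z * (snd (dphi z))\<^sup>2 + ?i z * (fst (dphi z))\<^sup>2)"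
    by (rule Bochner_Integration.integral_add[OF int(4,3), symmetric])
  also have "(\<lambda>z. ?i z * (snd (dphi z))\<^sup>2 + ?i z * (fst (dphi z))\<^sup>2) = (\<lambda>z. ?i z * (norm (dphi z))\<^sup>2)"
    by (simp add: norm_prod_def fun_eq_iff distrib_left add.commute)
  finally show ?thesis by simp
qed

section \<open>Passage to Sobolev functions\<close>

text \<open>Young's inequality with a free parameter d takes the place of Cauchy-Schwarz: the error
  is at most (1 + 1 / d) times the squared distance plus d times the limit mass. First d is fixed
  small, then n is taken large.\<close>

lemma L2_norm_tendsto:
  fixes p :: "nat \<Rightarrow> 'a \<Rightarrow> 'b::euclidean_space" and u :: "'a \<Rightarrow> 'b"
  assumes p[measurable]: "\<And>n. p n \<in> borel_measurable M" and u[measurable]: "u \<in> borel_measurable M"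
    and ip: "\<And>n. integrable M (\<lambda>x. (norm (p n x))\<^sup>2)" and iu: "integrable M (\<lambda>x. (norm (u x))\<^sup>2)"
    and lim: "(\<lambda>n. LINT x|M. (norm (p n x - u x))\<^sup>2) \<longlonglongrightarrow> 0"
  shows "(\<lambda>n. LINT x|M. (norm (p n x))\<^sup>2) \<longlonglongrightarrow> (LINT x|M. (norm (u x))\<^sup>2)"
proof -
  define I where "I = (LINT x|M. (norm (u x))\<^sup>2)"
  define e where "e = (\<lambda>n. LINT x|M. (norm (p n x - u x))\<^sup>2)"
  have I: "0 \<le> I" by (simp add: I_def)
  \<comment> \<open>Essential for the meaning of the limit hypothesis: the integral of a
    nonintegrable function is 0 by convention, so convergence to 0 alone would say nothing.\<close>
  have id: "integrable M (\<lambda>x. (norm (p n x - u x))\<^sup>2)" for n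
  proof (rule Bochner_Integration.integrable_bound)
    show "integrable M (\<lambda>x. 2 * (norm (p n x))\<^sup>2 + 2 * (norm (u x))\<^sup>2)" using ip iu by auto
    show "AE x in M. norm ((norm (p n x - u x))\<^sup>2) \<le> norm (2 * (norm (p n x))\<^sup>2 + 2 * (norm (u x))\<^sup>2)"
    proof (rule AE_I2)
      fix x
      have "(norm (p n x - u x))\<^sup>2 \<le> (norm (p n x) + norm (u x))\<^sup>2"
        by (intro power_mono norm_triangle_ineq4) auto
      also have "\<dots> \<le> 2 * (norm (p n x))\<^sup>2 + 2 * (norm (u x))\<^sup>2"
        using zero_le_power2[of "norm (p n x) - norm (u x)"] by (simp add: power2_eq_square algebra_simps)
      finally show "norm ((norm (p n x - u x))\<^sup>2) \<le> norm (2 * (norm (p n x))\<^sup>2 + 2 * (norm (u x))\<^sup>2)" by simp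
    qed
  qed measurable
  have bound: "\<bar>(LINT x|M. (norm (p n x))\<^sup>2) - I\<bar> \<le> (1 + 1 / d) * e n + d * I" if d: "d > 0" for d n
  proof -
    have pt: "\<bar>(norm (p n x))\<^sup>2 - (norm (u x))\<^sup>2\<bar> \<le> (1 + 1 / d) * (norm (p n x - u x))\<^sup>2 + d * (norm (u x))\<^sup>2" for x
    proof -
      define a b c where "a = norm (p n x)" and "b = norm (u x)" and "c = norm (p n x - u x)"
      have ab: "\<bar>a - b\<bar> \<le> c" unfolding a_def b_def c_def by (rule norm_triangle_ineq3)
      have nn: "0 \<le> a" "0 \<le> b" "0 \<le> c" by (auto simp: a_def b_def c_def)
      have "\<bar>a\<^sup>2 - b\<^sup>2\<bar> = \<bar>a - b\<bar> * (a + b)" using nn by (simp add: square_diff_square_factored power2_eq_square abs_mult)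
      also have "\<dots> \<le> c * (c + 2 * b)" using ab nn by (intro mult_mono) auto
      also have "\<dots> = c\<^sup>2 + 2 * (c * b)" by (simp add: power2_eq_square algebra_simps)
      also have "2 * (c * b) \<le> c\<^sup>2 / d + d * b\<^sup>2"
      proof -
        have "0 \<le> (c - d * b)\<^sup>2 / d" using d by simp
        also have "\<dots> = c\<^sup>2 / d + d * b\<^sup>2 - 2 * (c * b)" using d by (simp add: power2_eq_square field_simps)
        finally show ?thesis by simp
      qed
      finally have "\<bar>a\<^sup>2 - b\<^sup>2\<bar> \<le> (1 + 1 / d) * c\<^sup>2 + d * b\<^sup>2" by (simp add: algebra_simps)
      then show ?thesis by (simp add: a_def b_def c_def)
    qed
    have "(LINT x|M. (norm (p n x))\<^sup>2) - I = (LINT x|M. (norm (p n x))\<^sup>2 - (norm (u x))\<^sup>2)"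
      unfolding I_def by (rule Bochner_Integration.integral_diff[symmetric, OF ip iu])
    also have "\<bar>\<dots>\<bar> \<le> (LINT x|M. \<bar>(norm (p n x))\<^sup>2 - (norm (u x))\<^sup>2\<bar>)" by (rule integral_abs_bound)
    also have "\<dots> \<le> (LINT x|M. (1 + 1 / d) * (norm (p n x - u x))\<^sup>2 + d * (norm (u x))\<^sup>2)"
      using pt by (intro integral_mono) (use ip iu id in auto)
    also have "\<dots> = (1 + 1 / d) * e n + d * I"
      unfolding e_def I_def using iu id by (subst Bochner_Integration.integral_add) auto
    finally show ?thesis .
  qed
  show ?thesis
    unfolding I_def[symmetric]
  proof (rule LIMSEQ_I)
    fix r :: real assume r: "r > 0"
    \<comment> \<open>The denominator uses I + 1 so that I = 0 is covered as well.\<close>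
    define d where "d = r / (2 * (I + 1))"
    have d: "d > 0" using r I by (simp add: d_def)
    have "d * I \<le> r / 2" using r I by (simp add: d_def field_simps)
    have "(\<lambda>n. (1 + 1 / d) * e n) \<longlonglongrightarrow> (1 + 1 / d) * 0"
      unfolding e_def by (intro tendsto_intros lim)
    then have "\<forall>\<^sub>F n in sequentially. (1 + 1 / d) * e n < r / 2"
      using r by (intro order_tendstoD) auto
    then obtain N where N: "\<And>n. n \<ge> N \<Longrightarrow> (1 + 1 / d) * e n < r / 2"
      by (auto simp: eventually_sequentially)
    show "\<exists>no. \<forall>n\<ge>no. norm ((LINT x|M. (norm (p n x))\<^sup>2) - I) < r"
    proof (intro exI allI impI)
      fix n assume "n \<ge> N"
      then show "norm ((LINT x|M. (norm (p n x))\<^sup>2) - I) < r"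
        unfolding real_norm_def using bound[OF d, of n] N[of n] \<open>d * I \<le> r / 2\<close> by linarith
    qed
  qed
qed

lemma C1_grad_isometry2:
  assumes phi: "C1_grad phi dphi" and g: "isometry2 g"
  shows "\<exists>dpsi. C1_grad (\<lambda>x. phi (g x)) dpsi \<and> (\<forall>x. norm (dpsi x) = norm (dphi (g x)))"
proof -
  obtain L where L: "orthogonal_transformation L" "g = (\<lambda>x. g 0 + L x)" using g by (rule isometry2_decompose)
  \<comment> \<open>\<open>K\<close> is also the adjoint of \<open>L\<close>, so the gradient of the
    composition is \<open>K\<close> applied to the old gradient, with the same norm.\<close>
  define K where "K = inv L"
  have K: "orthogonal_transformation K" unfolding K_def by (rule orthogonal_transformation_inv[OF L(1)])
  have LK: "L (K w) = w" for w
    unfolding K_def using orthogonal_transformation_surj[OF L(1)] by (rule surj_f_inv_f)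
  have adj: "K w \<bullet> v = w \<bullet> L v" for w v
  proof -
    have "L (K w) \<bullet> L v = K w \<bullet> v" using L(1) unfolding orthogonal_transformation_def by blast
    then show ?thesis by (simp only: LK)
  qed
  have bl: "bounded_linear L" "bounded_linear K"
    using L(1) K orthogonal_transformation_linear linear_conv_bounded_linear by blast+
  have dg: "(g has_derivative L) (at x)" for x
    by (subst L(2)) (auto intro!: derivative_eq_intros bounded_linear_imp_has_derivative bl)
  show ?thesis
  proof (intro exI conjI allI)
    show "C1_grad (\<lambda>x. phi (g x)) (\<lambda>x. K (dphi (g x)))"
      unfolding C1_grad_def
    proof (intro conjI allI)
      fix x
      have "(phi has_derivative (\<lambda>v. dphi (g x) \<bullet> v)) (at (g x))" using phi unfolding C1_grad_def by blast
      then have "((\<lambda>x. phi (g x)) has_derivative (\<lambda>v. dphi (g x) \<bullet> L v)) (at x)"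
        by (rule has_derivative_compose[OF dg])
      then show "((\<lambda>x. phi (g x)) has_derivative (\<lambda>v. K (dphi (g x)) \<bullet> v)) (at x)"
        by (simp only: adj)
      show "continuous_on UNIV (\<lambda>x. K (dphi (g x)))"
        by (intro bounded_linear.continuous_on[OF bl(2)] continuous_on_compose2[OF C1_grad_continuous(2)[OF phi, of UNIV]]
            isometry2_continuous[OF g]) auto
    qed
    show "norm (K (dphi (g x))) = norm (dphi (g x))" for x
      by (rule orthogonal_transformation_norm[OF K])
  qed
qed

lemma isometric_energy_bound:
  assumes pos: "a > 0" "b > 0" "h > 0" and g: "isometry2 g"
    and phi: "C1_grad phi dphi"
    and U: "open U" "g ` trap_bdry a b h \<subseteq> U" "\<And>x. x \<in> U \<Longrightarrow> phi x = 0"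
  shows "slice_const a b h * (LINT z:(g ` trap_dom a b h)|lebesgue. (phi z)\<^sup>2)
    \<le> (LINT z:(g ` trap_dom a b h)|lebesgue. (norm (dphi z))\<^sup>2)"
proof -
  obtain dpsi where psi: "C1_grad (\<lambda>x. phi (g x)) dpsi" "\<And>x. norm (dpsi x) = norm (dphi (g x))"
    using C1_grad_isometry2[OF phi g] by blast
  have "open (g -` U)" using U(1) isometry2_continuous[OF g] by (rule open_vimage)
  then have "slice_const a b h * (LINT z|lborel. indicator (trap_dom a b h) z * (phi (g z))\<^sup>2)
    \<le> (LINT z|lborel. indicator (trap_dom a b h) z * (norm (dpsi z))\<^sup>2)"
    by (rule dirichlet_energy_bound[OF pos psi(1)]) (use U in auto)
  moreover have "(\<lambda>z. (phi z)\<^sup>2) \<in> borel_measurable borel" "(\<lambda>z. (norm (dphi z))\<^sup>2) \<in> borel_measurable borel"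
    by (intro borel_measurable_continuous_onI continuous_intros C1_grad_continuous[OF phi])+
  ultimately show ?thesis
    by (simp only: set_integral_isometry2[OF g borel_open[OF open_trap_dom]] psi(2))
qed

lemma integrable_isometric_trap:
  fixes q :: "pt \<Rightarrow> 'c::euclidean_space"
  assumes pos: "a > 0" "b > 0" "h > 0" and g: "isometry2 g" and q: "continuous_on UNIV q"
  shows "set_integrable lebesgue (g ` trap_dom a b h) q"
proof -
  have sub: "g ` trap_dom a b h \<subseteq> g ` closed_trap a b h"
    using trap_dom_subset_closed[OF pos] by blast
  have "compact (g ` closed_trap a b h)"
    by (rule compact_continuous_image[OF isometry2_continuous[OF g] compact_closed_trap[OF pos]])
  then have i: "set_integrable lborel (g ` closed_trap a b h) q"
    unfolding set_integrable_def using q by (intro borel_integrable_compact) (auto intro: continuous_on_subset)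
  have o: "open (g ` trap_dom a b h)"
    unfolding isometry2_image_vimage[OF g]
    by (rule open_vimage[OF open_trap_dom isometry2_continuous[OF isometry2_inv[OF g]]])
  have "set_integrable lborel (g ` trap_dom a b h) q"
    by (rule set_integrable_subset[OF i]) (use o sub in auto)
  then show ?thesis
    unfolding set_integrable_def by (subst integrable_completion) (auto dest: borel_measurable_integrable)
qed

text \<open>Both sides are continuous under the approximation that defines the boundary condition,
  so the inequality passes from the C1 approximants to \<open>u\<close> with the same constant. The
  gap inside \<open>slice_const\<close> survives because it does not depend on the function.\<close>

theorem H1_energy_bound:
  assumes pos: "a > 0" "b > 0" "h > 0" and g: "isometry2 g"
    and u: "H1_zero_on (g ` trap_dom a b h) (g ` trap_bdry a b h) u G"
  shows "slice_const a b h * (LINT z:(g ` trap_dom a b h)|lebesgue. (u z)\<^sup>2)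
    \<le> (LINT z:(g ` trap_dom a b h)|lebesgue. (norm (G z))\<^sup>2)"
proof -
  let ?D = "g ` trap_dom a b h"
  let ?i = "\<lambda>z. indicator ?D z :: real"
  have m: "set_borel_measurable lebesgue ?D u" "set_borel_measurable lebesgue ?D G"
    and i: "set_integrable lebesgue ?D (\<lambda>x. (u x)\<^sup>2)" "set_integrable lebesgue ?D (\<lambda>x. (norm (G x))\<^sup>2)"
    using u unfolding H1_zero_on_def weak_grad_def by blast+
  obtain phi dphi where phi: "\<And>n. C1_grad (phi n) (dphi n)"
    and U: "\<And>n. \<exists>U. open U \<and> g ` trap_bdry a b h \<subseteq> U \<and> (\<forall>x\<in>U. phi n x = 0)"
    and lim: "(\<lambda>n. LINT x:?D|lebesgue. (phi n x - u x)\<^sup>2) \<longlonglongrightarrow> 0"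
      "(\<lambda>n. LINT x:?D|lebesgue. (norm (dphi n x - G x))\<^sup>2) \<longlonglongrightarrow> 0"
    using u unfolding H1_zero_on_def by blast
  have sq: "(norm (indicator ?D x *\<^sub>R v))\<^sup>2 = indicator ?D x *\<^sub>R (norm v)\<^sup>2" for x and v :: "'z::real_normed_vector"
    by (cases "x \<in> ?D") auto
  have sr: "(norm (indicator ?D x *\<^sub>R v))\<^sup>2 = indicator ?D x *\<^sub>R v\<^sup>2" for x and v :: real
    by (cases "x \<in> ?D") auto
  have "(\<lambda>n. LINT x|lebesgue. (norm (indicator ?D x *\<^sub>R phi n x))\<^sup>2) \<longlonglongrightarrow> (LINT x|lebesgue. (norm (indicator ?D x *\<^sub>R u x))\<^sup>2)"
  proof (rule L2_norm_tendsto)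
    show "(\<lambda>x. indicator ?D x *\<^sub>R phi n x) \<in> borel_measurable lebesgue" for n
      using integrable_isometric_trap[OF pos g C1_grad_continuous(1)[OF phi]]
      unfolding set_integrable_def by (rule borel_measurable_integrable)
    show "(\<lambda>x. indicator ?D x *\<^sub>R u x) \<in> borel_measurable lebesgue"
      using m(1) by (simp add: set_borel_measurable_def)
    show "integrable lebesgue (\<lambda>x. (norm (indicator ?D x *\<^sub>R phi n x))\<^sup>2)" for n
      unfolding sr using integrable_isometric_trap[OF pos g continuous_on_power[OF C1_grad_continuous(1)[OF phi]]]
      by (simp only: set_integrable_def)
    show "integrable lebesgue (\<lambda>x. (norm (indicator ?D x *\<^sub>R u x))\<^sup>2)"
      unfolding sr using i(1) by (simp only: set_integrable_def)
    show "(\<lambda>n. LINT x|lebesgue. (norm (indicator ?D x *\<^sub>R phi n x - indicator ?D x *\<^sub>R u x))\<^sup>2) \<longlonglongrightarrow> 0"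
      unfolding scaleR_right_diff_distrib[symmetric] sr using lim(1) by (simp only: set_lebesgue_integral_def)
  qed
  then have l1: "(\<lambda>n. LINT x:?D|lebesgue. (phi n x)\<^sup>2) \<longlonglongrightarrow> (LINT x:?D|lebesgue. (u x)\<^sup>2)"
    by (simp only: sr set_lebesgue_integral_def)
  have "(\<lambda>n. LINT x|lebesgue. (norm (indicator ?D x *\<^sub>R dphi n x))\<^sup>2) \<longlonglongrightarrow> (LINT x|lebesgue. (norm (indicator ?D x *\<^sub>R G x))\<^sup>2)"
  proof (rule L2_norm_tendsto)
    show "(\<lambda>x. indicator ?D x *\<^sub>R dphi n x) \<in> borel_measurable lebesgue" for n
      using integrable_isometric_trap[OF pos g C1_grad_continuous(2)[OF phi]]
      unfolding set_integrable_def by (rule borel_measurable_integrable)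
    show "(\<lambda>x. indicator ?D x *\<^sub>R G x) \<in> borel_measurable lebesgue"
      using m(2) by (simp add: set_borel_measurable_def)
    show "integrable lebesgue (\<lambda>x. (norm (indicator ?D x *\<^sub>R dphi n x))\<^sup>2)" for n
      unfolding sq using integrable_isometric_trap[OF pos g continuous_on_power[OF continuous_on_norm[OF C1_grad_continuous(2)[OF phi]]]]
      by (simp only: set_integrable_def)
    show "integrable lebesgue (\<lambda>x. (norm (indicator ?D x *\<^sub>R G x))\<^sup>2)"
      unfolding sq using i(2) by (simp only: set_integrable_def)
    show "(\<lambda>n. LINT x|lebesgue. (norm (indicator ?D x *\<^sub>R dphi n x - indicator ?D x *\<^sub>R G x))\<^sup>2) \<longlonglongrightarrow> 0"
      unfolding scaleR_right_diff_distrib[symmetric] sq using lim(2) by (simp only: set_lebesgue_integral_def)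
  qed
  then have l2: "(\<lambda>n. LINT x:?D|lebesgue. (norm (dphi n x))\<^sup>2) \<longlonglongrightarrow> (LINT x:?D|lebesgue. (norm (G x))\<^sup>2)"
    by (simp only: sq set_lebesgue_integral_def)
  have "slice_const a b h * (LINT x:?D|lebesgue. (phi n x)\<^sup>2) \<le> (LINT x:?D|lebesgue. (norm (dphi n x))\<^sup>2)" for n
  proof -
    obtain U where "open U" "g ` trap_bdry a b h \<subseteq> U" "\<forall>x\<in>U. phi n x = 0" using U by blast
    then show ?thesis by (intro isometric_energy_bound[OF pos g phi]) auto
  qed
  then show ?thesis
    by (intro LIMSEQ_le[OF tendsto_mult_left[OF l1] l2]) auto
qed

section \<open>C1 functions as Sobolev functions\<close>

lemma integral_partial_compact_support:
  fixes v :: "pt \<Rightarrow> real"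
  assumes v: "C1_grad v dv" and K: "compact K" "\<And>z. z \<notin> K \<Longrightarrow> v z = 0" and i: "i \<in> Basis"
  shows "integrable lborel (\<lambda>z. dv z \<bullet> i)" "(LINT z|lborel. dv z \<bullet> i) = 0"
proof -
  have dv0: "dv z = 0" if "z \<notin> K" for z
    by (rule C1_grad_zero_on_open[OF v, of "- K"]) (use that K compact_imp_closed in \<open>auto simp: open_Compl\<close>)
  obtain R where R: "\<And>z. z \<in> K \<Longrightarrow> norm z < R" "R > 0"
    using compact_imp_bounded[OF K(1)] unfolding bounded_pos_less by blast
  have out: "v (x, y) = 0" "dv (x, y) = 0" if "R \<le> \<bar>x\<bar> \<or> R \<le> \<bar>y\<bar>" for x y
  proof -
    have "\<bar>x\<bar> \<le> norm (x, y)" "\<bar>y\<bar> \<le> norm (x, y)"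
      using norm_fst_le[of "(x, y)"] norm_snd_le[of y x] by (auto simp: norm_prod_def)
    then have "(x, y) \<notin> K" using R(1)[of "(x, y)"] that by auto
    then show "v (x, y) = 0" "dv (x, y) = 0" using K dv0 by auto
  qed
  have out': "dv (x, y) = 0" "dv (y, x) = 0" if "x \<notin> {-R<..<R}" for x y
    by (rule out(2); use that in auto)+
  note cdv = C1_grad_continuous(2)[OF v]
  have "integrable lborel (\<lambda>z. indicator K z *\<^sub>R (dv z \<bullet> i))"
    by (intro borel_integrable_compact K continuous_intros cdv)
  also have "(\<lambda>z. indicator K z *\<^sub>R (dv z \<bullet> i)) = (\<lambda>z. dv z \<bullet> i)"
    using dv0 by (auto simp: indicator_def fun_eq_iff)
  finally show int: "integrable lborel (\<lambda>z. dv z \<bullet> i)" .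
  have c: "continuous_on S (\<lambda>x. dv (x, y))" "continuous_on S (\<lambda>y. dv (x, y))" for S x y
    by (rule continuous_on_compose2[OF cdv[of UNIV]]; auto intro!: continuous_intros)+
  have slice_h: "(LINT x|lborel. fst (dv (x, y))) = 0" for y
  proof -
    have "(LINT x|lborel. fst (dv (x, y))) = integral {-R..R} (\<lambda>x. fst (dv (x, y)))"
      by (rule lborel_integral_eq_interval) (intro continuous_intros c, simp_all add: out')
    also have "\<dots> = v (R, y) - v (- R, y)"
      using C1_grad_partial(1)[OF v] R(2)
      by (intro integral_unique fundamental_theorem_of_calculus)
        (auto simp: has_real_derivative_iff_has_vector_derivative[symmetric])
    finally show ?thesis using out R(2) by simp
  qed
  have slice_v: "(LINT y|lborel. snd (dv (x, y))) = 0" for x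
  proof -
    have "(LINT y|lborel. snd (dv (x, y))) = integral {-R..R} (\<lambda>y. snd (dv (x, y)))"
      by (rule lborel_integral_eq_interval) (intro continuous_intros c, simp_all add: out')
    also have "\<dots> = v (x, R) - v (x, - R)"
      using C1_grad_partial(2)[OF v] R(2)
      by (intro integral_unique fundamental_theorem_of_calculus)
        (auto simp: has_real_derivative_iff_has_vector_derivative[symmetric])
    finally show ?thesis using out R(2) by simp
  qed
  consider "i = (1, 0)" | "i = (0, 1)" using i by (auto simp: Basis_prod_def)
  then show "(LINT z|lborel. dv z \<bullet> i) = 0"
  proof cases
    case 1
    then have e: "dv z \<bullet> i = fst (dv z)" for z by (simp add: inner_prod_def)
    \<comment> \<open>Every horizontal slice integrates to 0 by the fundamental theorem of calculus;
      comparison with the zero function in both directions gives equality for the plane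
      integral.\<close>
    have "(LINT z|lborel. fst (dv z)) \<le> (LINT z::pt|lborel. 0)" "(LINT z::pt|lborel. 0) \<le> (LINT z|lborel. fst (dv z))"
      using int slice_h unfolding e by (intro integral_mono_horizontal_slices; simp)+
    then show ?thesis by (simp add: e)
  next
    case 2
    then have e: "dv z \<bullet> i = snd (dv z)" for z by (simp add: inner_prod_def)
    have "(LINT z|lborel. snd (dv z)) \<le> (LINT z::pt|lborel. 0)" "(LINT z::pt|lborel. 0) \<le> (LINT z|lborel. snd (dv z))"
      using int slice_v unfolding e by (intro integral_mono_vertical_slices; simp)+
    then show ?thesis by (simp add: e)
  qed
qed

lemma C1_grad_mult:
  assumes "C1_grad u du" "C1_grad v dv"
  shows "C1_grad (\<lambda>z. u z * v z) (\<lambda>z. u z *\<^sub>R dv z + v z *\<^sub>R du z)"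
  unfolding C1_grad_def
proof (intro conjI allI)
  fix x
  have "(u has_derivative (\<lambda>w. du x \<bullet> w)) (at x)" "(v has_derivative (\<lambda>w. dv x \<bullet> w)) (at x)"
    using assms unfolding C1_grad_def by blast+
  then have "((\<lambda>z. u z * v z) has_derivative (\<lambda>w. u x * (dv x \<bullet> w) + (du x \<bullet> w) * v x)) (at x)"
    by (rule has_derivative_mult)
  then show "((\<lambda>z. u z * v z) has_derivative (\<lambda>w. (u x *\<^sub>R dv x + v x *\<^sub>R du x) \<bullet> w)) (at x)"
    by (simp add: inner_add_left mult.commute)
  show "continuous_on UNIV (\<lambda>z. u z *\<^sub>R dv z + v z *\<^sub>R du z)"
    by (intro continuous_intros C1_grad_continuous[OF assms(1)] C1_grad_continuous[OF assms(2)])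
qed

text \<open>The product of \<open>u\<close> with a test function is C1 with compact support inside
  the domain, so each partial derivative integrates to 0 over the plane. The product rule then gives
  integration by parts without boundary terms.\<close>

lemma weak_grad_C1:
  assumes pos: "a > 0" "b > 0" "h > 0" and g: "isometry2 g" and u: "C1_grad u du"
  shows "weak_grad (g ` trap_dom a b h) u du"
proof -
  let ?D = "g ` trap_dom a b h"
  note int = integrable_isometric_trap[OF pos g]
  show ?thesis
    unfolding weak_grad_def
  proof (intro conjI allI ballI impI)
    show "set_borel_measurable lebesgue ?D u" "set_borel_measurable lebesgue ?D du"
      using int[OF C1_grad_continuous(1)[OF u]] int[OF C1_grad_continuous(2)[OF u]]
      unfolding set_integrable_def set_borel_measurable_def by auto
    show "set_integrable lebesgue ?D (\<lambda>x. (u x)\<^sup>2)" "set_integrable lebesgue ?D (\<lambda>x. (norm (du x))\<^sup>2)"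
      by (intro int continuous_intros C1_grad_continuous[OF u])+
    fix phi dphi and i :: pt
    assume "C1_grad phi dphi \<and> compact (closure {x. phi x \<noteq> 0}) \<and> closure {x. phi x \<noteq> 0} \<subseteq> ?D"
      and i: "i \<in> Basis"
    then have phi: "C1_grad phi dphi" and K: "compact (closure {x. phi x \<noteq> 0})" and KD: "closure {x. phi x \<noteq> 0} \<subseteq> ?D"
      by blast+
    define K where "K = closure {x. phi x \<noteq> 0}"
    have "{x. phi x \<noteq> 0} \<subseteq> K" unfolding K_def by (rule closure_subset)
    then have phi0: "phi z = 0" if "z \<notin> K" for z using that by auto
    have cK: "compact K" using K by (simp only: K_def)
    have oK: "open (- K)" by (simp add: K_def open_Compl)
    have dphi0: "dphi z = 0" if "z \<notin> K" for z
      by (rule C1_grad_zero_on_open[OF phi oK]) (use that phi0 in auto)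
    have l: "(LINT x:?D|lebesgue. F x) = (LINT x|lborel. F x)"
      if "continuous_on UNIV F" "\<And>z. z \<notin> K \<Longrightarrow> F z = 0" for F :: "pt \<Rightarrow> real"
    proof -
      have "(\<lambda>x. indicator ?D x *\<^sub>R F x) = F"
        using that(2) KD by (auto simp: indicator_def fun_eq_iff K_def)
      then have "(LINT x:?D|lebesgue. F x) = (LINT x|lebesgue. F x)" by (simp add: set_lebesgue_integral_def)
      also have "\<dots> = (LINT x|lborel. F x)"
        using borel_measurable_continuous_onI[OF that(1)] by (intro integral_completion) simp
      finally show ?thesis .
    qed
    have ci: "integrable lborel F" if "continuous_on UNIV F" "\<And>z. z \<notin> K \<Longrightarrow> F z = 0" for F :: "pt \<Rightarrow> real"
    proof -
      have "integrable lborel (\<lambda>z. indicator K z *\<^sub>R F z)"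
        using K that(1) by (intro borel_integrable_compact) (auto simp: K_def intro: continuous_on_subset)
      also have "(\<lambda>z. indicator K z *\<^sub>R F z) = F"
        using that(2) by (auto simp: indicator_def fun_eq_iff)
      finally show ?thesis .
    qed
    note cu = C1_grad_continuous[OF u] and cp = C1_grad_continuous[OF phi]
    have A: "continuous_on UNIV (\<lambda>x. u x * (dphi x \<bullet> i))" "\<And>z. z \<notin> K \<Longrightarrow> u z * (dphi z \<bullet> i) = 0"
      by (intro continuous_intros cu cp) (simp add: dphi0)
    have B: "continuous_on UNIV (\<lambda>x. (du x \<bullet> i) * phi x)" "\<And>z. z \<notin> K \<Longrightarrow> (du z \<bullet> i) * phi z = 0"
      by (intro continuous_intros cu cp) (simp add: phi0)
    have "0 = (LINT z|lborel. (u z *\<^sub>R dphi z + phi z *\<^sub>R du z) \<bullet> i)"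
      by (rule integral_partial_compact_support(2)[OF C1_grad_mult[OF u phi] cK _ i, symmetric]) (simp add: phi0)
    also have "\<dots> = (LINT z|lborel. u z * (dphi z \<bullet> i) + (du z \<bullet> i) * phi z)"
      by (simp add: inner_add_left mult.commute)
    also have "\<dots> = (LINT z|lborel. u z * (dphi z \<bullet> i)) + (LINT z|lborel. (du z \<bullet> i) * phi z)"
      by (rule Bochner_Integration.integral_add[OF ci[OF A] ci[OF B]])
    finally have s: "0 = (LINT z|lborel. u z * (dphi z \<bullet> i)) + (LINT z|lborel. (du z \<bullet> i) * phi z)" .
    have "(LINT x:?D|lebesgue. u x * (dphi x \<bullet> i)) = (LINT z|lborel. u z * (dphi z \<bullet> i))" by (rule l[OF A])
    moreover have "(LINT x:?D|lebesgue. (du x \<bullet> i) * phi x) = (LINT z|lborel. (du z \<bullet> i) * phi z)" by (rule l[OF B])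
    ultimately show "(LINT x:?D|lebesgue. u x * (dphi x \<bullet> i)) = - (LINT x:?D|lebesgue. (du x \<bullet> i) * phi x)"
      using s by linarith
  qed
qed

lemma H1_zero_on_C1:
  assumes pos: "a > 0" "b > 0" "h > 0" and g: "isometry2 g" and u: "C1_grad u du"
    and U: "open U" "g ` trap_bdry a b h \<subseteq> U" "\<And>x. x \<in> U \<Longrightarrow> u x = 0"
  shows "H1_zero_on (g ` trap_dom a b h) (g ` trap_bdry a b h) u du"
proof -
  have "\<exists>U. open U \<and> g ` trap_bdry a b h \<subseteq> U \<and> (\<forall>x\<in>U. u x = 0)" using U by blast
  then show ?thesis
    unfolding H1_zero_on_def using weak_grad_C1[OF pos g u] u
    by (intro conjI exI[of _ "\<lambda>n. u"] exI[of _ "\<lambda>n. du"]) (auto simp: set_lebesgue_integral_def)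
qed

section \<open>Upper bounds\<close>

text \<open>Composing with soft makes a C1 function that vanishes on the Dirichlet sides vanish near them,
  without increasing its gradient.\<close>

definition soft :: "real \<Rightarrow> real \<Rightarrow> real" where
  "soft e s = sqrt ((max 0 (s - e))\<^sup>2 + e\<^sup>2) - e"

lemma DERIV_max_power2: "((\<lambda>x. (max 0 x)\<^sup>2) has_real_derivative 2 * max 0 x) (at x)" for x :: real
proof -
  consider "x > 0" | "x < 0" | "x = 0" by linarith
  then show ?thesis
  proof cases
    case 1
    have "((\<lambda>x. x\<^sup>2) has_real_derivative 2 * max 0 x) (at x)"
      using 1 by (auto intro!: derivative_eq_intros)
    then show ?thesis
      by (rule has_field_derivative_transform_within_open[of _ _ _ "{0<..}"]) (use 1 in auto)
  next
    case 2
    have "((\<lambda>x. 0) has_real_derivative 2 * max 0 x) (at x)"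
      using 2 by (auto intro!: derivative_eq_intros)
    then show ?thesis
      by (rule has_field_derivative_transform_within_open[of _ _ _ "{..<0}"]) (use 2 in auto)
  next
    case 3
    have "(\<lambda>k::real. max 0 k) \<midarrow>0\<rightarrow> max 0 0" by (intro tendsto_intros)
    \<comment> \<open>At 0 the difference quotient of the squared positive part is again the
      positive part, which tends to 0; squaring has removed the kink.\<close>
    moreover have eq: "max 0 k = ((max 0 (0 + k))\<^sup>2 - (max 0 (0::real))\<^sup>2) / k" if "k \<noteq> 0" for k :: real
      using that by (auto simp: max_def power2_eq_square)
    have "(\<lambda>k::real. max 0 k) \<midarrow>0\<rightarrow> 0 \<longleftrightarrow> (\<lambda>k::real. ((max 0 (0 + k))\<^sup>2 - (max 0 0)\<^sup>2) / k) \<midarrow>0\<rightarrow> 0"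
      by (rule LIM_cong[OF refl _ refl]) (rule eq)
    ultimately have "(\<lambda>k::real. ((max 0 (0 + k))\<^sup>2 - (max 0 0)\<^sup>2) / k) \<midarrow>0\<rightarrow> 0" by simp
    then show ?thesis using 3 by (simp add: DERIV_def)
  qed
qed

lemma soft_arg_pos: "e > 0 \<Longrightarrow> 0 < (max 0 (s - e))\<^sup>2 + e\<^sup>2" for e s :: real
  by (simp add: add_nonneg_pos)

lemma soft_zero: "0 \<le> e \<Longrightarrow> s \<le> e \<Longrightarrow> soft e s = 0"
  by (simp add: soft_def max_def)

lemma soft_bounds:
  assumes "0 \<le> e" "0 \<le> s"
  shows "0 \<le> soft e s" "soft e s \<le> s"
proof -
  have "sqrt (e\<^sup>2) \<le> sqrt ((max 0 (s - e))\<^sup>2 + e\<^sup>2)" by (rule real_sqrt_le_mono) simp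
  then show "0 \<le> soft e s" using assms by (simp add: soft_def)
  have "sqrt ((max 0 (s - e))\<^sup>2 + e\<^sup>2) \<le> sqrt ((max 0 (s - e))\<^sup>2) + sqrt (e\<^sup>2)"
    by (rule sqrt_add_le_add_sqrt) auto
  also have "\<dots> \<le> s + e" using assms by (simp add: max_def)
  finally show "soft e s \<le> s" by (simp add: soft_def)
qed

lemma DERIV_soft:
  assumes "e > 0"
  shows "(soft e has_real_derivative max 0 (s - e) / sqrt ((max 0 (s - e))\<^sup>2 + e\<^sup>2)) (at s)"
proof -
  have 1: "((\<lambda>s. (max 0 (s - e))\<^sup>2) has_real_derivative 2 * max 0 (s - e) * 1) (at s)"
    by (rule DERIV_chain2[OF DERIV_max_power2]) (auto intro!: derivative_eq_intros)
  have "((\<lambda>s. (max 0 (s - e))\<^sup>2 + e\<^sup>2) has_real_derivative 2 * max 0 (s - e)) (at s)"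
    using DERIV_add[OF 1 DERIV_const[of "e\<^sup>2"]] by simp
  note m = this
  have "((\<lambda>s. sqrt ((max 0 (s - e))\<^sup>2 + e\<^sup>2)) has_real_derivative
      inverse (sqrt ((max 0 (s - e))\<^sup>2 + e\<^sup>2)) / 2 * (2 * max 0 (s - e))) (at s)"
    by (rule DERIV_chain2[OF _ m]) (rule DERIV_real_sqrt[OF soft_arg_pos[OF assms]])
  from DERIV_diff[OF this DERIV_const[of e]]
  have "(soft e has_real_derivative
      inverse (sqrt ((max 0 (s - e))\<^sup>2 + e\<^sup>2)) / 2 * (2 * max 0 (s - e)) - 0) (at s)"
    unfolding soft_def[abs_def] .
  moreover have "inverse q / 2 * (2 * m) - 0 = m / q" for q m :: real
    by (cases "q = 0") (auto simp: field_simps)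
  ultimately show ?thesis by (simp only:)
qed

lemma C1_grad_soft:
  assumes F: "C1_grad F dF" and e: "e > 0"
  shows "\<exists>du. C1_grad (\<lambda>z. soft e (F z)) du \<and> (\<forall>z. norm (du z) \<le> norm (dF z))"
proof -
  define d where "d = (\<lambda>s. max 0 (s - e) / sqrt ((max 0 (s - e))\<^sup>2 + e\<^sup>2))"
  have pos: "0 < sqrt ((max 0 (s - e))\<^sup>2 + e\<^sup>2)" for s using soft_arg_pos[OF e] by simp
  have d1: "\<bar>d s\<bar> \<le> 1" for s
  proof -
    have "sqrt ((max 0 (s - e))\<^sup>2) \<le> sqrt ((max 0 (s - e))\<^sup>2 + e\<^sup>2)" by (rule real_sqrt_le_mono) simp
    then show ?thesis using pos[of s] by (simp add: d_def abs_divide)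
  qed
  have cd: "continuous_on UNIV d"
    unfolding d_def by (intro continuous_intros) (use pos in \<open>auto simp: less_le\<close>)
  show ?thesis
  proof (intro exI conjI allI)
    show "C1_grad (\<lambda>z. soft e (F z)) (\<lambda>z. d (F z) *\<^sub>R dF z)"
      unfolding C1_grad_def
    proof (intro conjI allI)
      fix x
      have "(F has_derivative (\<lambda>v. dF x \<bullet> v)) (at x)" using F unfolding C1_grad_def by blast
      moreover have "(soft e has_derivative (\<lambda>t. d (F x) * t)) (at (F x))"
        using DERIV_soft[OF e, of "F x"] unfolding d_def has_field_derivative_def .
      ultimately have "((\<lambda>z. soft e (F z)) has_derivative (\<lambda>v. d (F x) * (dF x \<bullet> v))) (at x)"
        by (rule has_derivative_compose)
      then show "((\<lambda>z. soft e (F z)) has_derivative (\<lambda>v. (d (F x) *\<^sub>R dF x) \<bullet> v)) (at x)"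
        by (simp only: inner_scaleR_left)
      show "continuous_on UNIV (\<lambda>z. d (F z) *\<^sub>R dF z)"
        by (intro continuous_on_scaleR continuous_on_compose2[OF cd] C1_grad_continuous[OF F]) auto
    qed
    show "norm (d (F z) *\<^sub>R dF z) \<le> norm (dF z)" for z
      using mult_right_mono[OF d1[of "F z"] norm_ge_zero[of "dF z"]] by simp
  qed
qed

section \<open>Rayleigh quotients and admissible test functions\<close>

definition rayleigh :: "pt set \<Rightarrow> pt set \<Rightarrow> real set" where
  "rayleigh \<Omega> \<Gamma> = {(LINT x:\<Omega>|lebesgue. (norm (G x))\<^sup>2) / (LINT x:\<Omega>|lebesgue. (u x)\<^sup>2)
       | u G. H1_zero_on \<Omega> \<Gamma> u G \<and> (LINT x:\<Omega>|lebesgue. (u x)\<^sup>2) \<noteq> 0}"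

lemma rayleighI:
  assumes "H1_zero_on \<Omega> \<Gamma> u G" "(LINT x:\<Omega>|lebesgue. (u x)\<^sup>2) \<noteq> 0"
  shows "(LINT x:\<Omega>|lebesgue. (norm (G x))\<^sup>2) / (LINT x:\<Omega>|lebesgue. (u x)\<^sup>2) \<in> rayleigh \<Omega> \<Gamma>"
  unfolding rayleigh_def mem_Collect_eq
  by (rule exI[of _ u], rule exI[of _ G], intro conjI refl assms)

lemma lambda1_rayleigh: "lambda1 \<Omega> \<Gamma> = Inf (rayleigh \<Omega> \<Gamma>)"
  by (simp only: lambda1_def rayleigh_def)

lemma set_integral_square_nonneg: "0 \<le> (LINT x:\<Omega>|M. (f x)\<^sup>2)" for f :: "'z \<Rightarrow> real"
  unfolding set_lebesgue_integral_def by (rule Bochner_Integration.integral_nonneg) (simp add: indicator_def)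

lemma rayleigh_nonneg:
  assumes "r \<in> rayleigh \<Omega> \<Gamma>"
  shows "0 \<le> r"
proof -
  obtain u and G :: "pt \<Rightarrow> pt" where "r = (LINT x:\<Omega>|lebesgue. (norm (G x))\<^sup>2) / (LINT x:\<Omega>|lebesgue. (u x)\<^sup>2)"
    using assms unfolding rayleigh_def mem_Collect_eq by blast
  then show ?thesis by (simp only:) (intro divide_nonneg_nonneg set_integral_square_nonneg)
qed

lemma trap_lambda_rayleigh:
  "trap_lambda g a b h = Inf (rayleigh (g ` trap_dom a b h) (g ` trap_bdry a b h))"
  by (simp only: trap_lambda_def lambda1_rayleigh trap_bdry_def)

lemma rayleigh_ge:
  assumes pos: "a > 0" "b > 0" "h > 0" and g: "isometry2 g"
    and r: "r \<in> rayleigh (g ` trap_dom a b h) (g ` trap_bdry a b h)"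
  shows "slice_const a b h \<le> r"
proof -
  let ?D = "g ` trap_dom a b h"
  obtain u G where u: "H1_zero_on ?D (g ` trap_bdry a b h) u G" and nz: "(LINT x:?D|lebesgue. (u x)\<^sup>2) \<noteq> 0"
    and r: "r = (LINT x:?D|lebesgue. (norm (G x))\<^sup>2) / (LINT x:?D|lebesgue. (u x)\<^sup>2)"
    using r unfolding rayleigh_def by blast
  have "0 < (LINT x:?D|lebesgue. (u x)\<^sup>2)" using nz set_integral_square_nonneg[of lebesgue ?D u] by linarith
  then show ?thesis
    using H1_energy_bound[OF pos g u] unfolding r by (simp add: pos_le_divide_eq)
qed

lemma rayleigh_C1:
  assumes pos: "a > 0" "b > 0" "h > 0" and g: "isometry2 g" and u: "C1_grad u du"
    and U: "open U" "trap_bdry a b h \<subseteq> U" "\<And>x. x \<in> U \<Longrightarrow> u x = 0"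
    and nz: "(LINT z|lborel. indicator (trap_dom a b h) z * (u z)\<^sup>2) \<noteq> 0"
  shows "(LINT z|lborel. indicator (trap_dom a b h) z * (norm (du z))\<^sup>2)
      / (LINT z|lborel. indicator (trap_dom a b h) z * (u z)\<^sup>2)
    \<in> rayleigh (g ` trap_dom a b h) (g ` trap_bdry a b h)"
proof -
  let ?k = "inv g"
  have k: "isometry2 ?k" by (rule isometry2_inv[OF g])
  have kg: "?k (g z) = z" for z using isometry2_bij[OF g] by (simp add: bij_is_inj)
  obtain dv where v: "C1_grad (\<lambda>x. u (?k x)) dv" and dv: "\<And>x. norm (dv x) = norm (du (?k x))"
    using C1_grad_isometry2[OF u k] by blast
  have H: "H1_zero_on (g ` trap_dom a b h) (g ` trap_bdry a b h) (\<lambda>x. u (?k x)) dv"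
  proof (rule H1_zero_on_C1[OF pos g v])
    show "open (?k -` U)" using U(1) isometry2_continuous[OF k] by (rule open_vimage)
    show "g ` trap_bdry a b h \<subseteq> ?k -` U" using U(2) kg by auto
    show "u (?k x) = 0" if "x \<in> ?k -` U" for x using that U(3) by simp
  qed
  have "(\<lambda>z. (u (?k z))\<^sup>2) \<in> borel_measurable borel" "(\<lambda>z. (norm (dv z))\<^sup>2) \<in> borel_measurable borel"
    by (intro borel_measurable_continuous_onI continuous_intros C1_grad_continuous[OF v])+
  note E = set_integral_isometry2[OF g borel_open[OF open_trap_dom] this(1)]
    set_integral_isometry2[OF g borel_open[OF open_trap_dom] this(2)]
  have e: "(LINT x:(g ` trap_dom a b h)|lebesgue. (u (?k x))\<^sup>2)
      = (LINT z|lborel. indicator (trap_dom a b h) z * (u z)\<^sup>2)"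
    "(LINT x:(g ` trap_dom a b h)|lebesgue. (norm (dv x))\<^sup>2)
      = (LINT z|lborel. indicator (trap_dom a b h) z * (norm (du z))\<^sup>2)"
    unfolding E by (simp_all only: kg dv)
  have "(LINT x:(g ` trap_dom a b h)|lebesgue. (norm (dv x))\<^sup>2) / (LINT x:(g ` trap_dom a b h)|lebesgue. (u (?k x))\<^sup>2)
      \<in> rayleigh (g ` trap_dom a b h) (g ` trap_bdry a b h)"
  proof (rule rayleighI[OF H])
    show "(LINT x:(g ` trap_dom a b h)|lebesgue. (u (?k x))\<^sup>2) \<noteq> 0"
      unfolding e(1) by (rule nz)
  qed
  then show ?thesis unfolding e .
qed

text \<open>A test function that vanishes only on the Dirichlet sides, not near them, is replaced by
  soft e (F z). This vanishes on the open set F < e around those sides, does not increase the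
  energy, and its mass tends to that of \<open>F\<close> by dominated convergence. The conclusion is
  a strict bound, so a single small e suffices.\<close>

lemma rayleigh_upper:
  assumes pos: "a > 0" "b > 0" "h > 0" and g: "isometry2 g" and F: "C1_grad F dF"
    and F0: "\<And>z. z \<in> trap_bdry a b h \<Longrightarrow> F z = 0" and Fnn: "\<And>z. z \<in> trap_dom a b h \<Longrightarrow> 0 \<le> F z"
    and I: "(LINT z|lborel. indicator (trap_dom a b h) z * (F z)\<^sup>2) > 0"
    and c: "(LINT z|lborel. indicator (trap_dom a b h) z * (norm (dF z))\<^sup>2)
        / (LINT z|lborel. indicator (trap_dom a b h) z * (F z)\<^sup>2) < c"
  shows "\<exists>r\<in>rayleigh (g ` trap_dom a b h) (g ` trap_bdry a b h). r < c"
proof -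
  let ?i = "\<lambda>z. indicator (trap_dom a b h) z :: real"
  define E where "E = (LINT z|lborel. ?i z * (norm (dF z))\<^sup>2)"
  define e where "e = (\<lambda>n. 1 / real (Suc n))"
  define J where "J = (\<lambda>n. LINT z|lborel. ?i z * (soft (e n) (F z))\<^sup>2)"
  have e: "e n > 0" for n by (simp add: e_def)
  have e0: "e \<longlonglongrightarrow> 0"
    unfolding e_def using LIMSEQ_inverse_real_of_nat by (simp add: inverse_eq_divide)
  have [measurable]: "trap_dom a b h \<in> sets borel" by (simp add: open_trap_dom)
  have mF[measurable]: "F \<in> borel_measurable borel"
    by (intro borel_measurable_continuous_onI C1_grad_continuous[OF F])
  have iF: "integrable lborel (\<lambda>z. ?i z * (F z)\<^sup>2)"
    by (intro integrable_trap_dom pos continuous_intros C1_grad_continuous[OF F])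
  have J: "J \<longlonglongrightarrow> (LINT z|lborel. ?i z * (F z)\<^sup>2)"
    unfolding J_def
  proof (rule integral_dominated_convergence[OF _ _ iF])
    show "(\<lambda>z. ?i z * (F z)\<^sup>2) \<in> borel_measurable lborel" by measurable
    show "(\<lambda>z. ?i z * (soft (e n) (F z))\<^sup>2) \<in> borel_measurable lborel" for n
      unfolding soft_def by measurable
    show "AE z in lborel. (\<lambda>n. ?i z * (soft (e n) (F z))\<^sup>2) \<longlonglongrightarrow> ?i z * (F z)\<^sup>2"
    proof (rule AE_I2)
      fix z
      show "(\<lambda>n. ?i z * (soft (e n) (F z))\<^sup>2) \<longlonglongrightarrow> ?i z * (F z)\<^sup>2"
      proof (cases "z \<in> trap_dom a b h")
        case True
        have "(\<lambda>n. soft (e n) (F z)) \<longlonglongrightarrow> sqrt ((max 0 (F z - 0))\<^sup>2 + 0\<^sup>2) - 0"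
          unfolding soft_def by (intro tendsto_intros e0)
        then have "(\<lambda>n. soft (e n) (F z)) \<longlonglongrightarrow> F z" using Fnn[OF True] by (simp add: max_def)
        then show ?thesis by (intro tendsto_intros)
      qed simp
    qed
    show "AE z in lborel. norm (?i z * (soft (e n) (F z))\<^sup>2) \<le> ?i z * (F z)\<^sup>2" for n
    proof (rule AE_I2)
      fix z
      show "norm (?i z * (soft (e n) (F z))\<^sup>2) \<le> ?i z * (F z)\<^sup>2"
        using soft_bounds[of "e n" "F z"] e[of n] Fnn[of z]
        by (cases "z \<in> trap_dom a b h") (auto intro!: power_mono)
    qed
  qed
  have "(\<lambda>n. E / J n) \<longlonglongrightarrow> E / (LINT z|lborel. ?i z * (F z)\<^sup>2)"
    using I by (intro tendsto_intros J) auto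
  then have "\<forall>\<^sub>F n in sequentially. E / J n < c"
    using c by (intro order_tendstoD) (auto simp: E_def)
  moreover have "\<forall>\<^sub>F n in sequentially. 0 < J n" using J I by (rule order_tendstoD)
  ultimately have "\<forall>\<^sub>F n in sequentially. E / J n < c \<and> 0 < J n" by (rule eventually_conj)
  then obtain n where n: "E / J n < c" "0 < J n"
    using eventually_happens trivial_limit_sequentially by blast
  obtain du where du: "C1_grad (\<lambda>z. soft (e n) (F z)) du" "\<And>z. norm (du z) \<le> norm (dF z)"
    using C1_grad_soft[OF F e] by blast
  have "(LINT z|lborel. ?i z * (norm (du z))\<^sup>2) / J n \<in> rayleigh (g ` trap_dom a b h) (g ` trap_bdry a b h)"
    unfolding J_def
  proof (rule rayleigh_C1[OF pos g du(1), of "F -` {..<e n}"])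
    show "open (F -` {..<e n})" by (rule open_vimage[OF open_lessThan C1_grad_continuous(1)[OF F]])
    show "trap_bdry a b h \<subseteq> F -` {..<e n}" using F0 e by auto
    show "soft (e n) (F z) = 0" if "z \<in> F -` {..<e n}" for z
      using that e[of n] by (intro soft_zero) auto
    show "(LINT z|lborel. ?i z * (soft (e n) (F z))\<^sup>2) \<noteq> 0" using n(2) by (simp add: J_def)
  qed
  moreover have "(LINT z|lborel. ?i z * (norm (du z))\<^sup>2) \<le> E"
    unfolding E_def
    by (intro integral_mono integrable_trap_dom pos continuous_intros C1_grad_continuous[OF du(1)]
        C1_grad_continuous[OF F] mult_left_mono power_mono du(2)) auto
  then have "(LINT z|lborel. ?i z * (norm (du z))\<^sup>2) / J n < c"
    using n by (meson divide_right_mono less_imp_le le_less_trans)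
  ultimately show ?thesis by blast
qed

lemma trap_dom_integral_one:
  assumes pos: "a > 0" "b > 0" "h > 0"
  shows "(LINT z|lborel. indicator (trap_dom a b h) z * (1::real)) = (a + b) * h / 2"
proof -
  have i: "integrable lborel (\<lambda>z. indicator (trap_dom a b h) z * (1::real))"
    by (rule integrable_trap_dom[OF pos]) simp
  have cw: "continuous_on S (trap_width a b h)" for S
    unfolding trap_width_def[abs_def] by (intro continuous_intros) (use pos in auto)
  have "(LINT z|lborel. indicator (trap_dom a b h) z * (1::real))
    = (LINT y|lborel. LINT x|lborel. indicator (trap_dom a b h) (x, y) * (1::real))"
    by (rule integral_horizontal_slices(2)[OF i, symmetric])
  also have "\<dots> = integral {0..h} (trap_width a b h)"
  proof (rule lborel_integral_eq_interval[OF cw])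
    fix y assume "y \<notin> {0<..<h}"
    then have "indicator (trap_dom a b h) (x, y) = (0::real)" for x by (auto simp: trap_dom_eq[OF pos])
    then show "(LINT x|lborel. indicator (trap_dom a b h) (x, y) * (1::real)) = 0" by simp
  next
    fix y assume y: "y \<in> {0<..<h}"
    then have "trap_width a b h y > 0" using pos by (intro trap_width_pos) auto
    then show "(LINT x|lborel. indicator (trap_dom a b h) (x, y) * (1::real)) = trap_width a b h y"
      using horizontal_slice_integral[OF pos, of y "\<lambda>_. 1"] y by simp
  qed
  also have "\<dots> = (a * h + (b - a) * h\<^sup>2 / (2 * h)) - (a * 0 + (b - a) * 0\<^sup>2 / (2 * h))"
    unfolding trap_width_def
    by (intro integral_unique fundamental_theorem_of_calculus)
      (use pos in \<open>auto simp: has_real_derivative_iff_has_vector_derivative[symmetric] intro!: derivative_eq_intros\<close>)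
  also have "\<dots> = (a + b) * h / 2" using pos by (simp add: power2_eq_square field_simps)
  finally show ?thesis .
qed

lemma measure_isometric_trap:
  assumes pos: "a > 0" "b > 0" "h > 0" and g: "isometry2 g"
  shows "measure lebesgue (g ` trap_dom a b h) = (a + b) * h / 2"
proof -
  have "measure lebesgue (g ` trap_dom a b h) = (LINT x:(g ` trap_dom a b h)|lebesgue. 1)"
    unfolding set_lebesgue_integral_def by simp
  also have "\<dots> = (LINT z|lborel. indicator (trap_dom a b h) z * 1)"
    by (rule set_integral_isometry2[OF g borel_open[OF open_trap_dom]]) simp
  finally show ?thesis using trap_dom_integral_one[OF pos] by simp
qed

lemma C1_grad_affine: "C1_grad (\<lambda>z. c + v \<bullet> z) (\<lambda>z. v)"
  unfolding C1_grad_def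
proof (intro conjI allI)
  show "((\<lambda>z. c + v \<bullet> z) has_derivative (\<lambda>w. v \<bullet> w)) (at x)" for x
    by (auto intro!: derivative_eq_intros)
qed (rule continuous_on_const)

text \<open>The infimum of the empty set of reals carries no information, so an admissible function
  must exist before lower bounds on quotients pass to the eigenvalue.\<close>

lemma rayleigh_nonempty:
  assumes pos: "a > 0" "b > 0" "h > 0" and g: "isometry2 g"
  shows "rayleigh (g ` trap_dom a b h) (g ` trap_bdry a b h) \<noteq> {}"
proof -
  \<comment> \<open>A product of three affine functions, one vanishing on each Dirichlet side and
    all positive in the interior.\<close>
  define F where "F = (\<lambda>z::pt. (0 + (0, 1) \<bullet> z) * (h + (0, -1) \<bullet> z) * (a + (-1, (b - a) / h) \<bullet> z))"
  obtain dF where F: "C1_grad F dF"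
    unfolding F_def using C1_grad_mult[OF C1_grad_mult[OF C1_grad_affine C1_grad_affine] C1_grad_affine] by blast
  have F_eq: "F z = snd z * (h - snd z) * (trap_width a b h (snd z) - fst z)" for z
    by (cases z) (simp add: F_def trap_width_def)
  have F0: "F z = 0" if "z \<in> trap_bdry a b h" for z
    using that pos
    by (auto simp: trap_bdry_def trap_l1_def trap_l2_def trap_w1_def in_segment F_eq trap_width_def field_simps)
  have Fpos: "0 < F z" if "z \<in> trap_dom a b h" for z
    using that by (auto simp: trap_dom_eq[OF pos] F_eq)
  have iF: "integrable lborel (\<lambda>z. indicator (trap_dom a b h) z * (F z)\<^sup>2)"
    by (intro integrable_trap_dom pos continuous_intros C1_grad_continuous[OF F])
  have "(LINT z|lborel. indicator (trap_dom a b h) z * (F z)\<^sup>2) \<noteq> 0"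
  proof
    assume "(LINT z|lborel. indicator (trap_dom a b h) z * (F z)\<^sup>2) = 0"
    then have "AE z in lborel. indicator (trap_dom a b h) z * (F z)\<^sup>2 = 0"
      using integral_nonneg_eq_0_iff_AE[OF iF] by simp
    \<comment> \<open>Since \<open>F\<close> has no zero inside, vanishing of its L2 norm would make
      the domain a null set, contradicting its positive area.\<close>
    then have "AE z in lborel. indicator (trap_dom a b h) z * (1::real) = 0"
      by eventually_elim (use Fpos in \<open>force simp: indicator_def\<close>)
    then have "(LINT z|lborel. indicator (trap_dom a b h) z * (1::real)) = 0"
      by (rule integral_eq_zero_AE)
    then show False using trap_dom_integral_one[OF pos] pos by simp
  qed
  moreover have "0 \<le> (LINT z|lborel. indicator (trap_dom a b h) z * (F z)\<^sup>2)"
    by (rule Bochner_Integration.integral_nonneg) simp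
  ultimately have I: "0 < (LINT z|lborel. indicator (trap_dom a b h) z * (F z)\<^sup>2)" by linarith
  have "\<exists>r\<in>rayleigh (g ` trap_dom a b h) (g ` trap_bdry a b h).
    r < (LINT z|lborel. indicator (trap_dom a b h) z * (norm (dF z))\<^sup>2)
        / (LINT z|lborel. indicator (trap_dom a b h) z * (F z)\<^sup>2) + 1"
    by (rule rayleigh_upper[OF pos g F F0 less_imp_le[OF Fpos] I]) simp_all
  then show ?thesis by blast
qed

lemma slice_const_le_trap_lambda:
  assumes pos: "a > 0" "b > 0" "h > 0" and g: "isometry2 g"
  shows "slice_const a b h \<le> trap_lambda g a b h"
  unfolding trap_lambda_rayleigh
  by (rule cInf_greatest[OF rayleigh_nonempty[OF pos g]]) (rule rayleigh_ge[OF pos g])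

section \<open>The eigenvalue of the rectangle\<close>

lemma C1_grad_comp_linear:
  assumes p: "\<And>x. (p has_real_derivative p' x) (at x)" and c: "continuous_on UNIV p'"
  shows "C1_grad (\<lambda>z. p (v \<bullet> z)) (\<lambda>z. p' (v \<bullet> z) *\<^sub>R v)"
  unfolding C1_grad_def
proof (intro conjI allI)
  fix x
  have "((\<lambda>z. v \<bullet> z) has_derivative (\<lambda>w. v \<bullet> w)) (at x)" by (auto intro!: derivative_eq_intros)
  moreover have "(p has_derivative (\<lambda>t. p' (v \<bullet> x) * t)) (at (v \<bullet> x))"
    using p[of "v \<bullet> x"] unfolding has_field_derivative_def .
  ultimately have "((\<lambda>z. p (v \<bullet> z)) has_derivative (\<lambda>w. p' (v \<bullet> x) * (v \<bullet> w))) (at x)"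
    by (rule has_derivative_compose)
  then show "((\<lambda>z. p (v \<bullet> z)) has_derivative (\<lambda>w. (p' (v \<bullet> x) *\<^sub>R v) \<bullet> w)) (at x)"
    by (simp only: inner_scaleR_left)
  show "continuous_on UNIV (\<lambda>z. p' (v \<bullet> z) *\<^sub>R v)"
    by (intro continuous_intros continuous_on_compose2[OF c]) auto
qed

lemma DERIV_sin_cos_scaled:
  fixes m x :: real
  shows "((\<lambda>x. sin (m * x)) has_real_derivative cos (m * x) * m) (at x within S)"
    and "((\<lambda>x. cos (m * x)) has_real_derivative - sin (m * x) * m) (at x within S)"
  by (auto intro!: derivative_eq_intros)

text \<open>The product condition sin * cos = 0 at the end covers both factors of the eigenfunction:
  the horizontal one, where the cosine vanishes, and the vertical one, where the sine does.\<close>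

lemma integral_trig_squares:
  fixes l m :: real
  assumes "l > 0" "m \<noteq> 0" "sin (m * l) * cos (m * l) = 0"
  shows "integral {0..l} (\<lambda>x. (cos (m * x))\<^sup>2) = l / 2" "integral {0..l} (\<lambda>x. (sin (m * x))\<^sup>2) = l / 2"
proof -
  have s: "1 / 2 + ((cos t)\<^sup>2 - (sin t)\<^sup>2) / 2 = (cos t)\<^sup>2" "1 / 2 - ((cos t)\<^sup>2 - (sin t)\<^sup>2) / 2 = (sin t)\<^sup>2"
    for t :: real
  proof -
    have "1 / 2 + (C - S) / 2 = C" "1 / 2 - (C - S) / 2 = S" if "S + C = 1" for S C :: real
      using that by (simp_all add: field_simps)
    from this[OF sin_cos_squared_add[of t]]
    show "1 / 2 + ((cos t)\<^sup>2 - (sin t)\<^sup>2) / 2 = (cos t)\<^sup>2"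
      "1 / 2 - ((cos t)\<^sup>2 - (sin t)\<^sup>2) / 2 = (sin t)\<^sup>2" .
  qed
  have d: "((\<lambda>x. sin (m * x) * cos (m * x) / (2 * m)) has_real_derivative ((cos (m * x))\<^sup>2 - (sin (m * x))\<^sup>2) / 2)
    (at x within S)" for x S
    by (rule DERIV_cong[OF DERIV_cdivide[OF DERIV_mult[OF DERIV_sin_cos_scaled]]])
      (use assms in \<open>simp add: field_simps power2_eq_square\<close>)
  have c: "((\<lambda>x. x / 2 + sin (m * x) * cos (m * x) / (2 * m)) has_real_derivative (cos (m * x))\<^sup>2) (at x within S)"
    for x S
    by (rule DERIV_cong[OF DERIV_add[OF DERIV_cdivide[OF DERIV_ident] d]]) (rule s(1))
  have c': "((\<lambda>x. x / 2 - sin (m * x) * cos (m * x) / (2 * m)) has_real_derivative (sin (m * x))\<^sup>2) (at x within S)"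
    for x S
    by (rule DERIV_cong[OF DERIV_diff[OF DERIV_cdivide[OF DERIV_ident] d]]) (rule s(2))
  have "((\<lambda>x. (cos (m * x))\<^sup>2) has_integral
      (l / 2 + sin (m * l) * cos (m * l) / (2 * m)) - (0 / 2 + sin (m * 0) * cos (m * 0) / (2 * m))) {0..l}"
    by (rule fundamental_theorem_of_calculus)
      (use assms c in \<open>auto simp: has_real_derivative_iff_has_vector_derivative[symmetric]\<close>)
  then show "integral {0..l} (\<lambda>x. (cos (m * x))\<^sup>2) = l / 2"
    unfolding assms(3) by (simp add: integral_unique)
  have "((\<lambda>x. (sin (m * x))\<^sup>2) has_integral
      (l / 2 - sin (m * l) * cos (m * l) / (2 * m)) - (0 / 2 - sin (m * 0) * cos (m * 0) / (2 * m))) {0..l}"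
    by (rule fundamental_theorem_of_calculus)
      (use assms c' in \<open>auto simp: has_real_derivative_iff_has_vector_derivative[symmetric]\<close>)
  then show "integral {0..l} (\<lambda>x. (sin (m * x))\<^sup>2) = l / 2"
    unfolding assms(3) by (simp add: integral_unique)
qed

lemma integral_rectangle_product:
  fixes p q :: "real \<Rightarrow> real"
  assumes pos: "a > 0" "h > 0" and p: "continuous_on UNIV p" and q: "continuous_on UNIV q"
  shows "(LINT z|lborel. indicator (trap_dom a a h) z * (p (fst z) * q (snd z)))
    = integral {0..a} p * integral {0..h} q"
proof -
  note pos' = pos(1) pos(1) pos(2)
  have w: "trap_width a a h y = a" for y by (simp add: trap_width_def)
  have cp: "continuous_on S p" and cq: "continuous_on S q" for S
    using p q continuous_on_subset by blast+
  have i: "integrable lborel (\<lambda>z. indicator (trap_dom a a h) z * (p (fst z) * q (snd z)))"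
    by (intro integrable_trap_dom pos continuous_on_mult continuous_on_compose2[OF p] continuous_on_compose2[OF q]
        continuous_on_fst continuous_on_snd continuous_on_id) auto
  have "(LINT z|lborel. indicator (trap_dom a a h) z * (p (fst z) * q (snd z)))
    = (LINT y|lborel. LINT x|lborel. indicator (trap_dom a a h) (x, y) * (p (fst (x, y)) * q (snd (x, y))))"
    by (rule integral_horizontal_slices(2)[OF i, symmetric])
  also have "\<dots> = integral {0..h} (\<lambda>y. integral {0..a} p * q y)"
  proof (rule lborel_integral_eq_interval)
    show "continuous_on {0..h} (\<lambda>y. integral {0..a} p * q y)" by (intro continuous_intros cq)
    fix y
    show "(LINT x|lborel. indicator (trap_dom a a h) (x, y) * (p (fst (x, y)) * q (snd (x, y)))) = 0"
      if "y \<notin> {0<..<h}"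
    proof -
      have "indicator (trap_dom a a h) (x, y) = (0::real)" for x using that by (auto simp: trap_dom_eq[OF pos'])
      then show ?thesis by simp
    qed
    show "(LINT x|lborel. indicator (trap_dom a a h) (x, y) * (p (fst (x, y)) * q (snd (x, y))))
        = integral {0..a} p * q y" if y: "y \<in> {0<..<h}"
    proof -
      have "(LINT x|lborel. indicator (trap_dom a a h) (x, y) * (p (fst (x, y)) * q (snd (x, y))))
        = integral {0..trap_width a a h y} (\<lambda>x. p (fst (x, y)) * q (snd (x, y)))"
        using y by (intro horizontal_slice_integral[OF pos', of y "\<lambda>z. p (fst z) * q (snd z)"])
          (auto intro!: continuous_intros cp)
      then show ?thesis by (simp add: w)
    qed
  qed
  also have "\<dots> = integral {0..a} p * integral {0..h} q" by simp
  finally show ?thesis .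
qed

lemma trap_lambda_rectangle:
  assumes pos: "a > 0" "h > 0" and g: "isometry2 g"
  shows "trap_lambda g a a h = slice_const a a h"
proof (rule antisym)
  note pos' = pos(1) pos(1) pos(2)
  let ?i = "\<lambda>z. indicator (trap_dom a a h) z :: real"
  define m n where "m = pi / (2 * a)" and "n = pi / h"
  have mn: "m > 0" "n > 0" using pos by (auto simp: m_def n_def)
  \<comment> \<open>The separated ground state: the cosine has slope zero on the Neumann side x = 0
    and vanishes at x = a, and the sine vanishes at y = 0 and y = h. Its quotient is (pi / (2 a))^2
    + (pi / h)^2.\<close>
  define F where "F = (\<lambda>z::pt. cos (m * ((1, 0) \<bullet> z)) * sin (n * ((0, 1) \<bullet> z)))"
  define dF :: "pt \<Rightarrow> pt" where "dF = (\<lambda>z. cos (m * ((1, 0) \<bullet> z)) *\<^sub>R ((cos (n * ((0, 1) \<bullet> z)) * n) *\<^sub>R (0, 1 :: real))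
    + sin (n * ((0, 1) \<bullet> z)) *\<^sub>R ((- sin (m * ((1, 0) \<bullet> z)) * m) *\<^sub>R (1, 0 :: real)))"
  have F: "C1_grad F dF"
  proof -
    have 1: "C1_grad (\<lambda>z. cos (m * ((1, 0) \<bullet> z))) (\<lambda>z. (- sin (m * ((1, 0) \<bullet> z)) * m) *\<^sub>R (1, 0))"
      by (rule C1_grad_comp_linear[OF DERIV_sin_cos_scaled(2)]) (intro continuous_intros)
    have 2: "C1_grad (\<lambda>z. sin (n * ((0, 1) \<bullet> z))) (\<lambda>z. (cos (n * ((0, 1) \<bullet> z)) * n) *\<^sub>R (0, 1))"
      by (rule C1_grad_comp_linear[OF DERIV_sin_cos_scaled(1)]) (intro continuous_intros)
    show ?thesis unfolding F_def dF_def by (rule C1_grad_mult[OF 1 2])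
  qed
  have F_eq: "F z = cos (m * fst z) * sin (n * snd z)" for z by (cases z) (simp add: F_def)
  have dF_eq: "(norm (dF z))\<^sup>2 = m\<^sup>2 * ((sin (m * fst z))\<^sup>2 * (sin (n * snd z))\<^sup>2)
      + n\<^sup>2 * ((cos (m * fst z))\<^sup>2 * (cos (n * snd z))\<^sup>2)" for z
    by (cases z) (simp add: dF_def norm_prod_def power_mult_distrib mult_ac)
  have F0: "F z = 0" if "z \<in> trap_bdry a a h" for z
  proof -
    have "snd z = 0 \<or> snd z = h \<or> fst z = a"
      using that pos by (auto simp: trap_bdry_def trap_l1_def trap_l2_def trap_w1_def in_segment algebra_simps)
    then show ?thesis using pos by (auto simp: F_eq m_def n_def)
  qed
  have Fnn: "0 \<le> F z" if "z \<in> trap_dom a a h" for z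
  proof -
    have z: "0 < fst z" "fst z < a" "0 < snd z" "snd z < h"
      using that by (auto simp: trap_dom_eq[OF pos'] trap_width_def)
    have "0 < cos (m * fst z)"
      using z pos by (intro cos_gt_zero) (auto simp: m_def field_simps)
    moreover have "0 < sin (n * snd z)"
      using z pos by (intro sin_gt_zero) (auto simp: n_def field_simps)
    ultimately show ?thesis by (simp add: F_eq)
  qed
  have tm: "sin (m * a) * cos (m * a) = 0" using pos by (simp add: m_def)
  have tn: "sin (n * h) * cos (n * h) = 0" using pos by (simp add: n_def)
  have mn0: "m \<noteq> 0" "n \<noteq> 0" using mn by auto
  note tr = integral_trig_squares[OF pos(1) mn0(1) tm] integral_trig_squares[OF pos(2) mn0(2) tn]
  have IF: "(LINT z|lborel. ?i z * (F z)\<^sup>2) = a * h / 4"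
  proof -
    have "(LINT z|lborel. ?i z * (F z)\<^sup>2) = (LINT z|lborel. ?i z * ((cos (m * fst z))\<^sup>2 * (sin (n * snd z))\<^sup>2))"
      by (simp only: F_eq power_mult_distrib)
    also have "\<dots> = integral {0..a} (\<lambda>x. (cos (m * x))\<^sup>2) * integral {0..h} (\<lambda>y. (sin (n * y))\<^sup>2)"
      by (rule integral_rectangle_product[OF pos]) (intro continuous_intros)+
    finally show ?thesis by (simp add: tr)
  qed
  have IdF: "(LINT z|lborel. ?i z * (norm (dF z))\<^sup>2) = (m\<^sup>2 + n\<^sup>2) * (a * h / 4)"
  proof -
    have i: "integrable lborel (\<lambda>z. ?i z * ((sin (m * fst z))\<^sup>2 * (sin (n * snd z))\<^sup>2))"
      "integrable lborel (\<lambda>z. ?i z * ((cos (m * fst z))\<^sup>2 * (cos (n * snd z))\<^sup>2))"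
      by (intro integrable_trap_dom pos' continuous_intros)+
    have "(LINT z|lborel. ?i z * (norm (dF z))\<^sup>2)
      = (LINT z|lborel. m\<^sup>2 * (?i z * ((sin (m * fst z))\<^sup>2 * (sin (n * snd z))\<^sup>2))
          + n\<^sup>2 * (?i z * ((cos (m * fst z))\<^sup>2 * (cos (n * snd z))\<^sup>2)))"
      by (simp only: dF_eq distrib_left mult.left_commute)
    also have "\<dots> = m\<^sup>2 * (LINT z|lborel. ?i z * ((sin (m * fst z))\<^sup>2 * (sin (n * snd z))\<^sup>2))
        + n\<^sup>2 * (LINT z|lborel. ?i z * ((cos (m * fst z))\<^sup>2 * (cos (n * snd z))\<^sup>2))"
      using i by (subst Bochner_Integration.integral_add) auto
    also have "(LINT z|lborel. ?i z * ((sin (m * fst z))\<^sup>2 * (sin (n * snd z))\<^sup>2))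
        = integral {0..a} (\<lambda>x. (sin (m * x))\<^sup>2) * integral {0..h} (\<lambda>y. (sin (n * y))\<^sup>2)"
      by (rule integral_rectangle_product[OF pos]) (intro continuous_intros)+
    also have "(LINT z|lborel. ?i z * ((cos (m * fst z))\<^sup>2 * (cos (n * snd z))\<^sup>2))
        = integral {0..a} (\<lambda>x. (cos (m * x))\<^sup>2) * integral {0..h} (\<lambda>y. (cos (n * y))\<^sup>2)"
      by (rule integral_rectangle_product[OF pos]) (intro continuous_intros)+
    finally show ?thesis by (simp add: tr distrib_right)
  qed
  have I: "0 < (LINT z|lborel. ?i z * (F z)\<^sup>2)" unfolding IF using pos by simp
  have Q: "(LINT z|lborel. ?i z * (norm (dF z))\<^sup>2) / (LINT z|lborel. ?i z * (F z)\<^sup>2) = slice_const a a h"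
    unfolding IF IdF using pos by (simp add: slice_const_def m_def n_def)
  show "trap_lambda g a a h \<le> slice_const a a h"
  \<comment> \<open>Arbitrarily small room is needed above the value, because \<open>F\<close>
    vanishes on the Dirichlet sides but not in a neighbourhood of them.\<close>
  proof (rule dense_ge)
    fix c assume "slice_const a a h < c"
    then obtain r where r: "r \<in> rayleigh (g ` trap_dom a a h) (g ` trap_bdry a a h)" "r < c"
      using rayleigh_upper[OF pos' g F F0 Fnn I, of c] unfolding Q by blast
    have "bdd_below (rayleigh (g ` trap_dom a a h) (g ` trap_bdry a a h))"
      by (rule bdd_belowI[of _ 0]) (rule rayleigh_nonneg)
    then have "trap_lambda g a a h \<le> r"
      unfolding trap_lambda_rayleigh using r(1) by (intro cInf_lower)
    then show "trap_lambda g a a h \<le> c" using r(2) by simp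
  qed
  show "slice_const a a h \<le> trap_lambda g a a h" by (rule slice_const_le_trap_lambda[OF pos' g])
qed

theorem theorem1p9:
  fixes a b h :: real and g g' :: "pt \<Rightarrow> pt"
  assumes "a > 0" and "b > 0" and "h > 0"
    and "isometry2 g" and "isometry2 g'"
  defines "A \<equiv> measure lebesgue (g ` trap_dom a b h)"
  shows "trap_lambda g a b h \<ge> trap_lambda g' (sqrt (A / 2)) (sqrt (A / 2)) (sqrt (2 * A))
       \<and> trap_lambda g' (sqrt (A / 2)) (sqrt (A / 2)) (sqrt (2 * A)) = pi\<^sup>2 / A
       \<and> (trap_lambda g a b h = trap_lambda g' (sqrt (A / 2)) (sqrt (A / 2)) (sqrt (2 * A))
         \<longleftrightarrow> trap_congruent g a b h g' (sqrt (A / 2)) (sqrt (A / 2)) (sqrt (2 * A)))"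
proof -
  note pos = assms(1-3) and g = assms(4) and g' = assms(5)
  define \<alpha> \<eta> where "\<alpha> = sqrt (A / 2)" and "\<eta> = sqrt (2 * A)"
  have A: "A = (a + b) * h / 2" unfolding A_def by (rule measure_isometric_trap[OF pos g])
  have Apos: "A > 0" using pos by (simp add: A)
  have \<alpha>: "\<alpha> > 0" and \<eta>: "\<eta> = 2 * \<alpha>"
  proof -
    show "\<alpha> > 0" using Apos by (simp add: \<alpha>_def)
    then show "\<eta> = 2 * \<alpha>" unfolding \<eta>_def
      by (intro real_sqrt_unique) (use Apos in \<open>auto simp: \<alpha>_def power_mult_distrib\<close>)
  qed
  have \<alpha>2: "\<alpha> * \<alpha> = A / 2" using Apos by (simp add: \<alpha>_def)
  have \<eta>0: "\<eta> > 0" using \<alpha> \<eta> by simp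
  have C: "2 * pi\<^sup>2 / ((a + b) * h) = pi\<^sup>2 / A" unfolding A by simp
  have rect: "trap_lambda g' \<alpha> \<alpha> \<eta> = pi\<^sup>2 / A"
  proof -
    have "trap_lambda g' \<alpha> \<alpha> \<eta> = slice_const \<alpha> \<alpha> \<eta>" by (rule trap_lambda_rectangle[OF \<alpha> \<eta>0 g'])
    also have "\<dots> = 2 * pi\<^sup>2 / ((\<alpha> + \<alpha>) * \<eta>)" using slice_const_ge(2)[OF \<alpha> \<alpha> \<eta>0] \<eta> by simp
    also have "(\<alpha> + \<alpha>) * \<eta> = 2 * A" using \<alpha>2 by (simp add: \<eta>)
    finally show ?thesis by simp
  qed
  \<comment> \<open>Stated for every placement \<open>f\<close>, since the converse direction of the
    equality case applies rigidity to a composed placement.\<close>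
  have lower: "pi\<^sup>2 / A \<le> trap_lambda f a b h"
    and rigid: "trap_lambda f a b h = pi\<^sup>2 / A \<Longrightarrow> a = b \<and> h = 2 * a" if f: "isometry2 f" for f
  proof -
    have 1: "slice_const a b h \<le> trap_lambda f a b h" by (rule slice_const_le_trap_lambda[OF pos f])
    then show "pi\<^sup>2 / A \<le> trap_lambda f a b h" using slice_const_ge(1)[OF pos] C by linarith
    show "a = b \<and> h = 2 * a" if "trap_lambda f a b h = pi\<^sup>2 / A"
      using 1 that slice_const_ge[OF pos] C by auto
  qed
  have "trap_lambda g a b h = pi\<^sup>2 / A \<longleftrightarrow> trap_congruent g a b h g' \<alpha> \<alpha> \<eta>"
  proof
    assume "trap_lambda g a b h = pi\<^sup>2 / A"
    then have ab: "b = a" "h = 2 * a" using rigid[OF g] by auto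
    have "A / 2 = a\<^sup>2" by (simp add: A ab power2_eq_square)
    then have eq: "\<alpha> = a" "\<eta> = h" using pos by (auto simp: \<alpha>_def \<eta> ab)
    have gi: "inv g (g z) = z" for z using isometry2_bij[OF g] by (simp add: bij_is_inj)
    have im: "(g' \<circ> inv g) ` (g ` S) = g' ` S" for S by (simp add: image_image gi)
    show "trap_congruent g a b h g' \<alpha> \<alpha> \<eta>"
      unfolding trap_congruent_def eq ab(1)
      \<comment> \<open>Once the parameters agree, undoing the first placement and applying the
        second carries each side to its counterpart.\<close>
      by (rule exI[of _ "g' \<circ> inv g"]) (simp only: im isometry2_comp[OF g' isometry2_inv[OF g]] simp_thms)
  next
    assume "trap_congruent g a b h g' \<alpha> \<alpha> \<eta>"
    then have "\<exists>f. isometry2 f \<and> f ` (g ` trap_dom a b h) = g' ` trap_dom \<alpha> \<alpha> \<eta>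
      \<and> f ` (g ` trap_bdry a b h) = g' ` trap_bdry \<alpha> \<alpha> \<eta>"
      unfolding trap_congruent_def trap_bdry_def by (simp only: image_Un) (elim exE conjE, intro exI conjI, assumption+, simp only:)
    then obtain f where f: "isometry2 f"
      and dom: "f ` (g ` trap_dom a b h) = g' ` trap_dom \<alpha> \<alpha> \<eta>"
      and bdry: "f ` (g ` trap_bdry a b h) = g' ` trap_bdry \<alpha> \<alpha> \<eta>"
      by (elim exE conjE)
    \<comment> \<open>The congruence identifies the domains and the Dirichlet parts, so both
      placements have the same set of Rayleigh quotients; rigidity then determines the
      shape.\<close>
    have "trap_lambda (f \<circ> g) a b h = trap_lambda g' \<alpha> \<alpha> \<eta>"
      unfolding trap_lambda_rayleigh image_comp[symmetric] dom bdry ..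
    then have ab: "a = b" "h = 2 * a" using rigid[OF isometry2_comp[OF f g]] rect by auto
    \<comment> \<open>With the shape known to be a rectangle, the explicit eigenvalue applies to the
      original placement too.\<close>
    have "trap_lambda g a b h = slice_const a b h"
      using trap_lambda_rectangle[OF pos(1,3) g] ab(1) by simp
    then show "trap_lambda g a b h = pi\<^sup>2 / A" using slice_const_ge(2)[OF pos] ab C by simp
  qed
  then show ?thesis using lower[OF g] rect unfolding \<alpha>_def \<eta>_def by simp
qed

end
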